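(* Let $B$ be a finite product of Nevanlinna interpolating Blaschke products. Then there exists $H_0=H_0(B)\in\mathrm{Har}_+(\mathbb{D})$ such that for any $g\in H^\infty$ with $|g(z)|\leq e^{-H_0(z)}$ for all $z\in\mathbb{D}$, the function $B-g$ factors as $B-g=B_1G$, where $B_1$ is a finite product of Nevanlinna interpolating Blaschke products and $G\in H^\infty$ is such that $1/G\in H^\infty$.
   Context: $\mathbb{D}$ is the unit disk, $H^\infty$ is the algebra of bounded analytic functions in $\mathbb{D}$, and $\mathrm{Har}_+(\mathbb{D})$ is the cone of positive harmonic functions in $\mathbb{D}$. The Nevanlinna class $\mathcal{N}$ is the set of analytic functions $f$ in $\mathbb{D}$ such that $\log^+|f|$ has a harmonic majorant in $\mathbb{D}$. For a sequence $\{\lambda_k\}_k$ in $\mathbb{D}$, let $W(\{\lambda_k\})$ be the set of complex sequences $\{w_k\}_k$ for which there is $H\in\mathrm{Har}_+(\mathbb{D})$ with $\log^+|w_k|\leq H(\lambda_k)$ for all $k$. A sequence $\{\lambda_k\}_k$ of distinct points of $\mathbb{D}$ is interpolating for $\mathcal{N}$ if for every $\{w_k\}_k\in W(\{\lambda_k\})$ there is $f\in\mathcal{N}$ with $f(\lambda_k)=w_k$ for all $k$. A Nevanlinna interpolating Blaschke product is a Blaschke product whose zeros (all simple) form a sequence interpolating for $\mathcal{N}$. *)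

theory Defs
  imports "HOL-Complex_Analysis.Complex_Analysis"
begin

abbreviation unit_disk :: "complex set" where
  "unit_disk \<equiv> ball 0 1"

text \<open>Twice continuously differentiable functions with vanishing Laplacian. The witnesses are the
  partial derivatives of first and second order with respect to the real and imaginary part.\<close>

definition harmonic_on :: "(complex \<Rightarrow> real) \<Rightarrow> complex set \<Rightarrow> bool" where
  "harmonic_on u S \<longleftrightarrow> open S \<and>
     (\<exists>ux uy uxx uxy uyx uyy.
        (\<forall>z\<in>S. (u has_derivative (\<lambda>h. ux z * Re h + uy z * Im h)) (at z) \<and>
               (ux has_derivative (\<lambda>h. uxx z * Re h + uxy z * Im h)) (at z) \<and>
               (uy has_derivative (\<lambda>h. uyx z * Re h + uyy z * Im h)) (at z)) \<and>
        continuous_on S uxx \<and> continuous_on S uxy \<and>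
        continuous_on S uyx \<and> continuous_on S uyy \<and>
        (\<forall>z\<in>S. uxx z + uyy z = 0))"

definition Har_pos :: "(complex \<Rightarrow> real) set" where
  "Har_pos = {H. harmonic_on H unit_disk \<and> (\<forall>z\<in>unit_disk. H z > 0)}"

definition log_plus :: "real \<Rightarrow> real" where
  "log_plus x = ln (max 1 x)"

definition H_infinity :: "(complex \<Rightarrow> complex) set" where
  "H_infinity = {f. f holomorphic_on unit_disk \<and> bounded (f ` unit_disk)}"

definition Nevanlinna_class :: "(complex \<Rightarrow> complex) set" where
  "Nevanlinna_class =
     {f. f holomorphic_on unit_disk \<and>
         (\<exists>u. harmonic_on u unit_disk \<and> (\<forall>z\<in>unit_disk. log_plus (cmod (f z)) \<le> u z))}"

text \<open>A finite or infinite sequence is a function \<open>a\<close> on the naturals together with the set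
  \<open>I\<close> of indices that are used; values of \<open>a\<close> outside \<open>I\<close> are irrelevant.\<close>

definition Nevanlinna_data :: "nat set \<Rightarrow> (nat \<Rightarrow> complex) \<Rightarrow> (nat \<Rightarrow> complex) set" where
  "Nevanlinna_data I a = {w. \<exists>H\<in>Har_pos. \<forall>k\<in>I. log_plus (cmod (w k)) \<le> H (a k)}"

definition Nevanlinna_interpolating :: "nat set \<Rightarrow> (nat \<Rightarrow> complex) \<Rightarrow> bool" where
  "Nevanlinna_interpolating I a \<longleftrightarrow>
     a ` I \<subseteq> unit_disk \<and> inj_on a I \<and>
     (\<forall>w\<in>Nevanlinna_data I a. \<exists>f\<in>Nevanlinna_class. \<forall>k\<in>I. f (a k) = w k)"

definition Blaschke_factor :: "complex \<Rightarrow> complex \<Rightarrow> complex" where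
  "Blaschke_factor a z =
     (if a = 0 then z else (of_real (cmod a) / a) * ((a - z) / (1 - cnj a * z)))"

definition Blaschke_condition :: "nat set \<Rightarrow> (nat \<Rightarrow> complex) \<Rightarrow> bool" where
  "Blaschke_condition I a \<longleftrightarrow>
     a ` I \<subseteq> unit_disk \<and> summable (\<lambda>k. if k \<in> I then 1 - cmod (a k) else 0)"

definition Blaschke_product :: "nat set \<Rightarrow> (nat \<Rightarrow> complex) \<Rightarrow> complex \<Rightarrow> complex" where
  "Blaschke_product I a z = (\<Prod>k. if k \<in> I then Blaschke_factor (a k) z else 1)"

text \<open>Functions on the disk are represented by functions on the whole plane, so all identities
  between them are only required on the disk.\<close>

definition Nevanlinna_interpolating_Blaschke :: "(complex \<Rightarrow> complex) \<Rightarrow> bool" where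
  "Nevanlinna_interpolating_Blaschke B \<longleftrightarrow>
     (\<exists>I a. Blaschke_condition I a \<and> Nevanlinna_interpolating I a \<and>
            (\<forall>z\<in>unit_disk. B z = Blaschke_product I a z))"

definition finite_product_NIB :: "(complex \<Rightarrow> complex) \<Rightarrow> bool" where
  "finite_product_NIB B \<longleftrightarrow>
     (\<exists>(n::nat) b. (\<forall>j<n. Nevanlinna_interpolating_Blaschke (b j)) \<and>
                   (\<forall>z\<in>unit_disk. B z = (\<Prod>j<n. b j z)))"

end

theory Submission
  imports Defs
begin

text \<open>Write \<open>\<rho>\<close> for the pseudohyperbolic distance of the disk. The argument rests on three facts about
a sequence \<open>a\<^sub>k\<close> satisfying the Blaschke condition.

\<^item> If its points are distinct, it is interpolating for the Nevanlinna class if and only if some positive harmonic \<open>H\<close>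
  satisfies \<open>\<Prod>\<^bsub>l\<noteq>k\<^esub> \<rho>(a\<^sub>k, a\<^sub>l) \<ge> exp (- H(a\<^sub>k))\<close> for all \<open>k\<close>
  (\<open>interpolating_imp_separated\<close>, \<open>separated_imp_interpolating\<close>). This converts interpolation into
  an estimate that survives perturbation.

\<^item> The sum \<open>\<Sum> (1 - \<rho>(z, a\<^sub>k)\<^sup>2)\<close> always lies below a positive harmonic function, a sum of
  dilated Poisson kernels. Hence the zeros at distance at least \<open>1/4\<close> from \<open>z\<close> cost only a factor \<open>exp (- H z)\<close> in
  \<open>|B(z)|\<close>, and only the zeros close to \<open>z\<close> matter (\<open>prod_far_pseudo_dist_ge\<close>).

\<^item> Multiplication by a Blaschke product does not change the supremum of the modulus on the disk, so that
  a bound on \<open>|q B|\<close> is a bound on \<open>|q|\<close> (\<open>bounded_by_quotient_Blaschke_product\<close>).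

Let \<open>B\<close> be a product of \<open>n\<close> interpolating Blaschke products. Each factor has at most one zero in a disk
of radius \<open>R \<le> exp (- H(z))\<close> around \<open>z\<close>, so by the pigeonhole principle the disk contains a point \<open>w\<close> that
stays away from all zeros on the scale \<open>R\<close>, and \<open>|B(w)| \<ge> R\<^sup>n exp (- H(z))\<close>
(\<open>finite_product_NIB_good_points\<close>). If \<open>|g| \<le> exp (- H\<^sub>0)\<close> with \<open>H\<^sub>0\<close> a large multiple of \<open>H\<close>, then
\<open>f = B - g\<close> inherits this lower bound, up to a factor \<open>1/2\<close>, for all \<open>R\<close> between \<open>exp (- 5 H(z))\<close> and
\<open>exp (- H(z))\<close>. By the Schwarz-Pick inequality \<open>f\<close> then has at most \<open>n\<close> zeros, with multiplicity,
in the disk of radius \<open>exp (- 2 H(z))\<close> around \<open>z\<close> (\<open>few_zeros_nearby\<close>). The relation of being closer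
than \<open>exp (- 4 H)\<close> on the zeros thus has degree less than \<open>n\<close>, and a greedy colouring splits the zeros of
\<open>f\<close> into \<open>n\<close> sequences without close pairs (\<open>colour_zeros\<close>). The lower bound for \<open>|f|\<close> at a point near
a given zero shows that each of these sequences is separated in the sense of the first fact
(\<open>colour_class_separated\<close>). So the Blaschke product \<open>B\<^sub>1\<close> of the zeros of \<open>f\<close> is a product of \<open>n\<close>
interpolating ones.

The quotient \<open>G = f/B\<^sub>1\<close> is bounded because \<open>f\<close> is. For \<open>1/G\<close> it suffices, by the third fact, to bound
\<open>B/G\<close>. Where \<open>|g| \<le> |B|/2\<close> this holds since \<open>|B| \<le> 2|f| \<le> 2|G|\<close>. Elsewhere \<open>|B| < 2 exp (- H\<^sub>0)\<close>, whereas
Harnack's inequality for the positive harmonic function \<open>ln (4/|G|)\<close>, applied between \<open>z\<close> and a nearby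
point at which \<open>|f|\<close> is large, gives \<open>|G| \<ge> exp (- c H)/16\<close> with a constant \<open>c\<close> that \<open>H\<^sub>0\<close> beats.\<close>

section \<open>Positive harmonic functions on the disk\<close>

lemma has_derivative_partial_Re:
  assumes "(u has_derivative (\<lambda>k. p * Re k + q * Im k)) (at (z + of_real s))"
  shows "((\<lambda>t. u (z + of_real t)) has_real_derivative p) (at s)"
proof -
  have "((\<lambda>t::real. z + complex_of_real t) has_derivative (\<lambda>t. of_real t)) (at s)"
    by (auto intro!: derivative_eq_intros)
  from has_derivative_compose[OF this] assms
  have "((\<lambda>t. u (z + of_real t)) has_derivative (\<lambda>t. p * Re (of_real t) + q * Im (of_real t))) (at s)"
    by blast
  then show ?thesis by (simp add: has_field_derivative_def)
qed

lemma has_derivative_partial_Im: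
  assumes "(u has_derivative (\<lambda>k. p * Re k + q * Im k)) (at (z + \<i> * of_real s))"
  shows "((\<lambda>t. u (z + \<i> * of_real t)) has_real_derivative q) (at s)"
proof -
  have "((\<lambda>t::real. z + \<i> * complex_of_real t) has_derivative (\<lambda>t. \<i> * of_real t)) (at s)"
    by (auto intro!: derivative_eq_intros)
  from has_derivative_compose[OF this] assms
  have "((\<lambda>t. u (z + \<i> * of_real t)) has_derivative (\<lambda>t. p * Re (\<i> * of_real t) + q * Im (\<i> * of_real t))) (at s)"
    by blast
  then show ?thesis by (simp add: has_field_derivative_def)
qed

text \<open>The second difference of \<open>u\<close> over a square of side \<open>t\<close> is evaluated with the mean value theorem in both
orders; the two resulting values of the mixed derivatives agree. Letting \<open>t\<close> tend to \<open>0\<close> gives the symmetry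
of the second derivative.\<close>

lemma mixed_partials_nearby:
  fixes u ux uy :: "complex \<Rightarrow> real"
  assumes t: "0 < t" and sub: "ball z (3 * t) \<subseteq> S"
    and u: "\<And>z. z \<in> S \<Longrightarrow> (u has_derivative (\<lambda>k. ux z * Re k + uy z * Im k)) (at z)"
    and ux: "\<And>z. z \<in> S \<Longrightarrow> (ux has_derivative (\<lambda>k. uxx z * Re k + uxy z * Im k)) (at z)"
    and uy: "\<And>z. z \<in> S \<Longrightarrow> (uy has_derivative (\<lambda>k. uyx z * Re k + uyy z * Im k)) (at z)"
  obtains p q where "p \<in> ball z (3 * t)" "q \<in> ball z (3 * t)" "uxy p = uyx q"
proof -
  have inS: "z + of_real a + \<i> * of_real b \<in> ball z (3 * t)" if "0 \<le> a" "a \<le> t" "0 \<le> b" "b \<le> t" for a b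
  proof -
    have "cmod (of_real a + \<i> * of_real b) \<le> cmod (of_real a) + cmod (\<i> * of_real b)"
      by (rule norm_triangle_ineq)
    also have "\<dots> < 3 * t" using that t by (simp add: norm_mult)
    finally have "cmod ((z + of_real a + \<i> * of_real b) - z) < 3 * t" by (simp add: add.assoc)
    then show ?thesis unfolding mem_ball dist_norm by (subst norm_minus_commute)
  qed
  define D where "D = u (z + of_real t + \<i> * of_real t) - u (z + of_real t) - u (z + \<i> * of_real t) + u z"
  have "\<exists>s. 0 < s \<and> s < t \<and> (u (z + \<i> * of_real t + of_real t) - u (z + of_real t)) - (u (z + \<i> * of_real t + of_real 0) - u (z + of_real 0))
      = (t - 0) * (ux (z + \<i> * of_real t + of_real s) - ux (z + of_real s))"
    by (rule MVT2[OF t]) (intro DERIV_diff has_derivative_partial_Re[OF u] subsetD[OF sub],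
      use inS[of _ t] inS[of _ 0] t in \<open>auto simp: add_ac\<close>)
  then obtain s where s: "0 < s" "s < t" "D = t * (ux (z + of_real s + \<i> * of_real t) - ux (z + of_real s))"
    by (auto simp: D_def algebra_simps)
  have "\<exists>r. 0 < r \<and> r < t \<and> ux (z + of_real s + \<i> * of_real t) - ux (z + of_real s + \<i> * of_real 0)
      = (t - 0) * uxy (z + of_real s + \<i> * of_real r)"
    by (rule MVT2[OF t]) (intro has_derivative_partial_Im[OF ux] subsetD[OF sub] inS, use s in auto)
  then obtain r where r: "0 < r" "r < t" "D = t * t * uxy (z + of_real s + \<i> * of_real r)"
    using s by auto
  have "\<exists>s. 0 < s \<and> s < t \<and> (u (z + of_real t + \<i> * of_real t) - u (z + \<i> * of_real t)) - (u (z + of_real t + \<i> * of_real 0) - u (z + \<i> * of_real 0))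
      = (t - 0) * (uy (z + of_real t + \<i> * of_real s) - uy (z + \<i> * of_real s))"
    by (rule MVT2[OF t]) (intro DERIV_diff has_derivative_partial_Im[OF u] subsetD[OF sub],
      use inS[of t] inS[of 0] t in \<open>auto simp: add_ac\<close>)
  then obtain s' where s': "0 < s'" "s' < t" "D = t * (uy (z + \<i> * of_real s' + of_real t) - uy (z + \<i> * of_real s'))"
    by (auto simp: D_def algebra_simps)
  have "\<exists>r. 0 < r \<and> r < t \<and> uy (z + \<i> * of_real s' + of_real t) - uy (z + \<i> * of_real s' + of_real 0)
      = (t - 0) * uyx (z + \<i> * of_real s' + of_real r)"
    by (rule MVT2[OF t]) (intro has_derivative_partial_Re[OF uy] subsetD[OF sub],
       use inS[of _ s'] s' in \<open>auto simp: add_ac\<close>)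
  then obtain r' where r': "0 < r'" "r' < t" "D = t * t * uyx (z + of_real r' + \<i> * of_real s')"
    using s' by (auto simp: add_ac)
  show ?thesis
    by (rule that[OF inS[of s r] inS[of r' s']]) (use r r' s s' t in auto)
qed

lemma mixed_partials_eq:
  fixes u ux uy :: "complex \<Rightarrow> real"
  assumes S: "open S" "z \<in> S"
    and u: "\<And>z. z \<in> S \<Longrightarrow> (u has_derivative (\<lambda>k. ux z * Re k + uy z * Im k)) (at z)"
    and ux: "\<And>z. z \<in> S \<Longrightarrow> (ux has_derivative (\<lambda>k. uxx z * Re k + uxy z * Im k)) (at z)"
    and uy: "\<And>z. z \<in> S \<Longrightarrow> (uy has_derivative (\<lambda>k. uyx z * Re k + uyy z * Im k)) (at z)"
    and cont: "continuous_on S uxy" "continuous_on S uyx"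
  shows "uxy z = uyx z"
proof (rule ccontr)
  define e where "e = \<bar>uxy z - uyx z\<bar> / 2"
  assume "uxy z \<noteq> uyx z"
  then have e: "e > 0" by (simp add: e_def)
  have "isCont uxy z" "isCont uyx z"
    using cont S continuous_on_eq_continuous_at by blast+
  then obtain d1 d2 where d: "d1 > 0" "d2 > 0" "\<And>w. dist w z < d1 \<Longrightarrow> dist (uxy w) (uxy z) < e"
      "\<And>w. dist w z < d2 \<Longrightarrow> dist (uyx w) (uyx z) < e"
    using e unfolding continuous_at_eps_delta by metis
  obtain d3 where d3: "d3 > 0" "ball z d3 \<subseteq> S"
    using S open_contains_ball by blast
  define t where "t = min d1 (min d2 d3) / 3"
  have t: "t > 0" "3 * t \<le> d1" "3 * t \<le> d2" "3 * t \<le> d3" using d d3 by (auto simp: t_def)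
  have sub: "ball z (3 * t) \<subseteq> S" using t d3 by (meson subset_ball subset_trans)
  obtain p q where pq: "p \<in> ball z (3 * t)" "q \<in> ball z (3 * t)" "uxy p = uyx q"
    using mixed_partials_nearby[of t z S u ux uy uxx uxy uyx uyy, OF t(1) sub u ux uy] by blast
  have "dist (uxy p) (uxy z) < e" using pq(1) t d(3)[of p] by (simp add: dist_commute)
  moreover have "dist (uyx q) (uyx z) < e" using pq(2) t d(4)[of q] by (simp add: dist_commute)
  ultimately
  show False using pq by (simp add: dist_real_def e_def field_simps abs_if split: if_splits)
qed

text \<open>The function \<open>u\<^sub>x - \<i> u\<^sub>y\<close> is holomorphic: its Cauchy-Riemann equations are the Laplace equation and the
symmetry of the mixed derivatives. A primitive on the convex disk has real part \<open>u\<close> up to a constant.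
From here on, harmonic functions are handled only as real parts of holomorphic ones.\<close>

lemma harmonic_on_disk_iff:
  "harmonic_on u unit_disk \<longleftrightarrow> (\<exists>h. h holomorphic_on unit_disk \<and> (\<forall>z\<in>unit_disk. u z = Re (h z)))"
proof
  assume "harmonic_on u unit_disk"
  then obtain ux uy uxx uxy uyx uyy where
      u: "\<And>z. z \<in> unit_disk \<Longrightarrow> (u has_derivative (\<lambda>k. ux z * Re k + uy z * Im k)) (at z)"
    and ux: "\<And>z. z \<in> unit_disk \<Longrightarrow> (ux has_derivative (\<lambda>k. uxx z * Re k + uxy z * Im k)) (at z)"
    and uy: "\<And>z. z \<in> unit_disk \<Longrightarrow> (uy has_derivative (\<lambda>k. uyx z * Re k + uyy z * Im k)) (at z)"
    and cont: "continuous_on unit_disk uxy" "continuous_on unit_disk uyx"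
    and lap: "\<And>z. z \<in> unit_disk \<Longrightarrow> uxx z + uyy z = 0"
    unfolding harmonic_on_def by blast
  define f where "f z = complex_of_real (ux z) - \<i> * of_real (uy z)" for z
  have "(f has_field_derivative (of_real (uxx z) - \<i> * of_real (uyx z))) (at z)" if z: "z \<in> unit_disk" for z
  proof -
    have eq: "uxy z = uyx z"
      by (rule mixed_partials_eq[OF open_ball z u ux uy cont])
    have "(f has_derivative (\<lambda>k. of_real (uxx z * Re k + uxy z * Im k) - \<i> * of_real (uyx z * Re k + uyy z * Im k))) (at z)"
      unfolding f_def by (auto intro!: derivative_eq_intros ux[OF z] uy[OF z])
    also have "(\<lambda>k. of_real (uxx z * Re k + uxy z * Im k) - \<i> * of_real (uyx z * Re k + uyy z * Im k))
        = (*) (of_real (uxx z) - \<i> * of_real (uyx z))"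
    proof -
      have "uyy z = - uxx z" using lap[OF z] by simp
      then show ?thesis using eq by (auto simp: fun_eq_iff complex_eq_iff)
    qed
    finally show ?thesis by (simp add: has_field_derivative_def)
  qed
  then have "f holomorphic_on unit_disk"
    using holomorphic_on_open by blast
  then obtain h where h: "\<And>z. z \<in> unit_disk \<Longrightarrow> (h has_field_derivative f z) (at z within unit_disk)"
    using holomorphic_convex_primitive'[OF convex_ball open_ball] by metis
  have h': "(h has_field_derivative f z) (at z)" if "z \<in> unit_disk" for z
    using h[OF that] at_within_open[OF that open_ball] by simp
  have "\<exists>c. \<forall>z\<in>unit_disk. u z - Re (h z) = c"
  proof (rule has_derivative_zero_constant[OF convex_ball])
    fix z :: complex assume z: "z \<in> unit_disk"
    have "((\<lambda>z. u z - Re (h z)) has_derivative (\<lambda>k. (ux z * Re k + uy z * Im k) - Re (f z * k))) (at z)"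
      using h'[OF z] by (auto intro!: derivative_eq_intros u[OF z] simp: has_field_derivative_def)
    also have "(\<lambda>k. (ux z * Re k + uy z * Im k) - Re (f z * k)) = (\<lambda>k. 0)"
      by (auto simp: f_def)
    finally show "((\<lambda>z. u z - Re (h z)) has_derivative (\<lambda>k. 0)) (at z within unit_disk)"
      by (rule has_derivative_at_withinI)
  qed
  then obtain c where c: "\<forall>z\<in>unit_disk. u z - Re (h z) = c" by blast
  have "h holomorphic_on unit_disk"
    unfolding holomorphic_on_open[OF open_ball] using h' by blast
  then have "(\<lambda>z. h z + of_real c) holomorphic_on unit_disk"
    by (intro holomorphic_intros)
  then show "\<exists>h. h holomorphic_on unit_disk \<and> (\<forall>z\<in>unit_disk. u z = Re (h z))"
    using c by (intro exI[of _ "\<lambda>z. h z + of_real c"]) auto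
next
  assume "\<exists>h. h holomorphic_on unit_disk \<and> (\<forall>z\<in>unit_disk. u z = Re (h z))"
  then obtain h where h: "h holomorphic_on unit_disk" and u: "\<And>z. z \<in> unit_disk \<Longrightarrow> u z = Re (h z)"
    by blast
  have h1: "deriv h holomorphic_on unit_disk" and h2: "deriv (deriv h) holomorphic_on unit_disk"
    using h holomorphic_deriv by blast+
  have d: "(f has_derivative (\<lambda>k. deriv f z * k)) (at z)" if "f holomorphic_on unit_disk" "z \<in> unit_disk" for f z
    using holomorphic_derivI[OF that(1) open_ball that(2), of UNIV] by (simp add: has_field_derivative_def)
  have c: "continuous_on unit_disk (deriv (deriv h))"
    using h2 holomorphic_on_imp_continuous_on by blast
  have d0: "(u has_derivative (\<lambda>k. Re (deriv h z * k))) (at z)" if z: "z \<in> unit_disk" for z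
    by (rule has_derivative_transform_within_open[OF has_derivative_Re[OF d[OF h z]] open_ball z])
       (simp add: u)
  show "harmonic_on u unit_disk"
    unfolding harmonic_on_def
  proof (intro conjI exI ballI)
    fix z assume z: "z \<in> unit_disk"
    show "(u has_derivative (\<lambda>k. Re (deriv h z) * Re k + (- Im (deriv h z)) * Im k)) (at z)"
      using d0[OF z] by simp
    show "((\<lambda>z. Re (deriv h z)) has_derivative
        (\<lambda>k. Re (deriv (deriv h) z) * Re k + (- Im (deriv (deriv h) z)) * Im k)) (at z)"
      using has_derivative_Re[OF d[OF h1 z]] by simp
    show "((\<lambda>z. - Im (deriv h z)) has_derivative
        (\<lambda>k. (- Im (deriv (deriv h) z)) * Re k + (- Re (deriv (deriv h) z)) * Im k)) (at z)"
      using has_derivative_minus[OF has_derivative_Im[OF d[OF h1 z]]] by (simp add: algebra_simps)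
  qed (use c in \<open>auto intro!: continuous_intros\<close>)
qed

lemma Har_pos_iff:
  "H \<in> Har_pos \<longleftrightarrow>
     (\<exists>h. h holomorphic_on unit_disk \<and> (\<forall>z\<in>unit_disk. H z = Re (h z) \<and> 0 < Re (h z)))"
  unfolding Har_pos_def harmonic_on_disk_iff by auto

lemma Har_posI:
  "h holomorphic_on unit_disk \<Longrightarrow> (\<And>z. z \<in> unit_disk \<Longrightarrow> H z = Re (h z)) \<Longrightarrow>
    (\<And>z. z \<in> unit_disk \<Longrightarrow> 0 < H z) \<Longrightarrow> H \<in> Har_pos"
  unfolding Har_pos_iff by auto

lemma Har_pos_pos: "H \<in> Har_pos \<Longrightarrow> z \<in> unit_disk \<Longrightarrow> 0 < H z"
  by (auto simp: Har_pos_def)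

lemma Har_pos_const: "c > 0 \<Longrightarrow> (\<lambda>z. c) \<in> Har_pos"
  by (rule Har_posI[of "\<lambda>_. of_real c"]) auto

lemma Har_pos_add:
  assumes "H \<in> Har_pos" "K \<in> Har_pos" shows "(\<lambda>z. H z + K z) \<in> Har_pos"
proof -
  obtain h k where "h holomorphic_on unit_disk" "\<forall>z\<in>unit_disk. H z = Re (h z) \<and> 0 < Re (h z)"
      "k holomorphic_on unit_disk" "\<forall>z\<in>unit_disk. K z = Re (k z) \<and> 0 < Re (k z)"
    using assms unfolding Har_pos_iff by auto
  then show ?thesis
    by (intro Har_posI[of "\<lambda>z. h z + k z"]) (auto intro!: holomorphic_intros add_pos_pos)
qed

lemma Har_pos_scale:
  assumes "H \<in> Har_pos" "c > 0" shows "(\<lambda>z. c * H z) \<in> Har_pos"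
proof -
  obtain h where "h holomorphic_on unit_disk" "\<forall>z\<in>unit_disk. H z = Re (h z) \<and> 0 < Re (h z)"
    using assms unfolding Har_pos_iff by auto
  then show ?thesis using assms
    by (intro Har_posI[of "\<lambda>z. of_real c * h z"]) (auto intro!: holomorphic_intros)
qed

text \<open>The constant \<open>c\<close> keeps the sum positive when the index set is empty.\<close>

lemma Har_pos_sum:
  assumes "finite A" "\<And>i. i \<in> A \<Longrightarrow> H i \<in> Har_pos" "c > 0"
  shows "(\<lambda>z. c + (\<Sum>i\<in>A. H i z)) \<in> Har_pos"
  using assms
proof (induction A rule: finite_induct)
  case empty
  then show ?case using Har_pos_const[of c] by simp
next
  case (insert i A)
  then have "(\<lambda>z. c + (\<Sum>i\<in>A. H i z)) \<in> Har_pos" "H i \<in> Har_pos" by auto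
  from Har_pos_add[OF this(2,1)] have "(\<lambda>z. H i z + (c + (\<Sum>i\<in>A. H i z))) \<in> Har_pos" .
  then show ?case using insert by (simp add: add_ac)
qed

section \<open>The pseudohyperbolic distance\<close>

definition pseudo_dist :: "complex \<Rightarrow> complex \<Rightarrow> real" where
  "pseudo_dist z w = cmod ((z - w) / (1 - cnj w * z))"

definition disk_moebius :: "complex \<Rightarrow> complex \<Rightarrow> complex" where
  "disk_moebius a z = (z - a) / (1 - cnj a * z)"

lemma cmod_disk_moebius: "cmod (disk_moebius a z) = pseudo_dist z a"
  by (simp add: disk_moebius_def pseudo_dist_def)

lemma cmod_cnj_mult_less_1: "z \<in> unit_disk \<Longrightarrow> w \<in> unit_disk \<Longrightarrow> cmod (cnj w * z) < 1"
  using mult_strict_mono'[of "cmod w" 1 "cmod z" 1] by (simp add: norm_mult)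

lemma disk_denom_nonzero: "z \<in> unit_disk \<Longrightarrow> w \<in> unit_disk \<Longrightarrow> 1 - cnj w * z \<noteq> 0"
  using cmod_cnj_mult_less_1[of z w] by auto

lemma one_minus_norm_sq_pos: "z \<in> unit_disk \<Longrightarrow> 0 < 1 - (cmod z)\<^sup>2"
  by (simp add: abs_square_less_1)

lemma one_minus_pseudo_dist_sq:
  assumes "z \<in> unit_disk" "w \<in> unit_disk"
  shows "1 - (pseudo_dist z w)\<^sup>2 = (1 - (cmod z)\<^sup>2) * (1 - (cmod w)\<^sup>2) / (cmod (1 - cnj w * z))\<^sup>2"
proof -
  have "(cmod (1 - cnj w * z))\<^sup>2 - (cmod (z - w))\<^sup>2 = (1 - (cmod z)\<^sup>2) * (1 - (cmod w)\<^sup>2)"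
    unfolding cmod_power2 by (simp add: power2_eq_square algebra_simps)
  then show ?thesis using disk_denom_nonzero[OF assms]
    by (simp add: pseudo_dist_def norm_divide power_divide field_simps)
qed

lemma pseudo_dist_nonneg [simp]: "0 \<le> pseudo_dist z w"
  by (simp add: pseudo_dist_def)

lemma pseudo_dist_self [simp]: "pseudo_dist z z = 0"
  by (simp add: pseudo_dist_def)

lemma pseudo_dist_0_right [simp]: "pseudo_dist z 0 = cmod z"
  by (simp add: pseudo_dist_def)

lemma pseudo_dist_less_1:
  assumes "z \<in> unit_disk" "w \<in> unit_disk" shows "pseudo_dist z w < 1"
proof -
  have "0 < 1 - (pseudo_dist z w)\<^sup>2"
    unfolding one_minus_pseudo_dist_sq[OF assms]
    using one_minus_norm_sq_pos[OF assms(1)] one_minus_norm_sq_pos[OF assms(2)] disk_denom_nonzero[OF assms] by simp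
  then show ?thesis using pseudo_dist_nonneg[of z w] by (simp add: power_less_one_iff abs_square_less_1)
qed

lemma pseudo_dist_commute: "pseudo_dist z w = pseudo_dist w z"
proof -
  have "cmod (1 - cnj w * z) = cmod (cnj (1 - cnj w * z))" by (simp only: complex_mod_cnj)
  also have "\<dots> = cmod (1 - cnj z * w)" by (simp add: mult.commute)
  finally show ?thesis by (simp add: pseudo_dist_def norm_divide norm_minus_commute)
qed

lemma pseudo_dist_eq_0_iff: "z \<in> unit_disk \<Longrightarrow> w \<in> unit_disk \<Longrightarrow> pseudo_dist z w = 0 \<longleftrightarrow> z = w"
  using disk_denom_nonzero[of z w] by (auto simp: pseudo_dist_def)

lemma disk_moebius_in_disk: "z \<in> unit_disk \<Longrightarrow> a \<in> unit_disk \<Longrightarrow> disk_moebius a z \<in> unit_disk"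
  using pseudo_dist_less_1[of z a] by (simp add: cmod_disk_moebius)


lemma cmod_Blaschke_factor: "cmod (Blaschke_factor a z) = pseudo_dist z a"
  by (auto simp: Blaschke_factor_def pseudo_dist_def norm_mult norm_divide norm_minus_commute)

lemma pseudo_dist_disk_moebius:
  assumes "x \<in> unit_disk" "y \<in> unit_disk" "a \<in> unit_disk"
  shows "pseudo_dist (disk_moebius a x) (disk_moebius a y) = pseudo_dist x y"
proof -
  have nz: "1 - cnj a * x \<noteq> 0" "1 - cnj a * y \<noteq> 0" "1 - a * cnj y \<noteq> 0" "1 - cnj y * x \<noteq> 0" "1 - cnj a * a \<noteq> 0"
    using disk_denom_nonzero[OF assms(1,3)] disk_denom_nonzero[OF assms(2,3)]
      disk_denom_nonzero[OF assms(3,2)] disk_denom_nonzero[OF assms(1,2)] disk_denom_nonzero[OF assms(3,3)]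
    by (auto simp: mult.commute)
  have 1: "disk_moebius a x - disk_moebius a y = (x - y) * (1 - cnj a * a) / ((1 - cnj a * x) * (1 - cnj a * y))"
    using nz by (simp add: disk_moebius_def divide_simps) (simp add: algebra_simps)
  have 2: "1 - cnj (disk_moebius a y) * disk_moebius a x = (1 - cnj y * x) * (1 - cnj a * a) / ((1 - a * cnj y) * (1 - cnj a * x))"
    using nz by (simp add: disk_moebius_def divide_simps) (simp add: algebra_simps)
  have "cmod (1 - a * cnj y) = cmod (cnj (1 - a * cnj y))" by (simp only: complex_mod_cnj)
  then have 3: "cmod (1 - a * cnj y) = cmod (1 - cnj a * y)" by simp
  show ?thesis unfolding pseudo_dist_def 1 2 using nz by (simp add: norm_mult norm_divide 3)
qed

text \<open>The triangle inequality through the origin, to which the general one reduces by Moebius invariance. It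
follows from \<open>1 - ((s + t)/(1 + s t))\<^sup>2 = (1 - s\<^sup>2)(1 - t\<^sup>2)/(1 + s t)\<^sup>2\<close>.\<close>

lemma pseudo_dist_le_norm_add:
  assumes "u \<in> unit_disk" "v \<in> unit_disk"
  shows "pseudo_dist u v \<le> cmod u + cmod v"
proof -
  define s t where "s = cmod u" and "t = cmod v"
  have st: "0 \<le> s" "s < 1" "0 \<le> t" "t < 1" using assms by (auto simp: s_def t_def)
  have "cmod (1 - cnj v * u) \<le> 1 + s * t"
    using norm_triangle_ineq4[of 1 "cnj v * u"] by (simp add: norm_mult s_def t_def mult.commute)
  then have "(1 - s\<^sup>2) * (1 - t\<^sup>2) / (1 + s * t)\<^sup>2 \<le> (1 - s\<^sup>2) * (1 - t\<^sup>2) / (cmod (1 - cnj v * u))\<^sup>2"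
    using st disk_denom_nonzero[OF assms]
    by (intro divide_left_mono power_mono mult_nonneg_nonneg mult_pos_pos) (auto simp: abs_square_le_1 intro!: add_pos_nonneg)
  also have "\<dots> = 1 - (pseudo_dist u v)\<^sup>2" by (simp add: one_minus_pseudo_dist_sq[OF assms] s_def t_def)
  finally have "(pseudo_dist u v)\<^sup>2 \<le> 1 - (1 - s\<^sup>2) * (1 - t\<^sup>2) / (1 + s * t)\<^sup>2" by simp
  also have "\<dots> = ((s + t) / (1 + s * t))\<^sup>2"
  proof -
    have "1 + s * t > 0" using st by (intro add_pos_nonneg) auto
    then have "1 - (1 - s\<^sup>2) * (1 - t\<^sup>2) / (1 + s * t)\<^sup>2
        = ((1 + s * t)\<^sup>2 - (1 - s\<^sup>2) * (1 - t\<^sup>2)) / (1 + s * t)\<^sup>2"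
      by (simp add: diff_divide_distrib)
    also have "(1 + s * t)\<^sup>2 - (1 - s\<^sup>2) * (1 - t\<^sup>2) = (s + t)\<^sup>2"
      by (simp add: power2_eq_square algebra_simps)
    finally show ?thesis by (simp add: power_divide)
  qed
  finally have "pseudo_dist u v \<le> (s + t) / (1 + s * t)"
    by (rule power2_le_imp_le) (use st in simp)
  also have "\<dots> \<le> (s + t) / 1"
    using mult_nonneg_nonneg[OF st(1,3)] st by (intro divide_left_mono) (auto intro: add_pos_nonneg)
  finally show ?thesis by (simp add: s_def t_def)
qed

lemma pseudo_dist_triangle:
  assumes "x \<in> unit_disk" "y \<in> unit_disk" "z \<in> unit_disk"
  shows "pseudo_dist x z \<le> pseudo_dist x y + pseudo_dist y z"
  using pseudo_dist_le_norm_add[OF disk_moebius_in_disk[OF assms(1,2)] disk_moebius_in_disk[OF assms(3,2)]]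
  unfolding pseudo_dist_disk_moebius[OF assms(1,3,2)] cmod_disk_moebius pseudo_dist_commute[of z y] .

section \<open>Schwarz-Pick, Harnack and compactness\<close>

text \<open>The modulus of a Blaschke factor tends uniformly to \<open>1\<close> at the unit circle, so the maximum principle on
circles of radius tending to \<open>1\<close> bounds \<open>q\<close> by the same constant.\<close>

lemma bounded_by_quotient_Blaschke:
  assumes q: "q holomorphic_on unit_disk" and a: "a \<in> unit_disk"
    and bd: "\<And>z. z \<in> unit_disk \<Longrightarrow> cmod (q z) * pseudo_dist z a \<le> C" and z: "z \<in> unit_disk"
  shows "cmod (q z) \<le> C"
proof -
  have C: "0 \<le> C" using bd[OF a] by simp
  define K where "K = (1 - (cmod a)\<^sup>2) / (1 - cmod a)\<^sup>2"
  have lim: "((\<lambda>r. cmod (q z) * sqrt (1 - K * (1 - r\<^sup>2))) \<longlongrightarrow> cmod (q z) * sqrt (1 - K * (1 - 1\<^sup>2))) (at_left (1::real))"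
    by (intro tendsto_intros)
  have lim0: "((\<lambda>r. 1 - K * (1 - r\<^sup>2)) \<longlongrightarrow> 1 - K * (1 - 1\<^sup>2)) (at_left (1::real))"
    by (intro tendsto_intros)
  have ev0: "\<forall>\<^sub>F r in at_left (1::real). 0 < 1 - K * (1 - r\<^sup>2)"
    using order_tendstoD(1)[OF lim0, of 0] by simp
  have ev1: "\<forall>\<^sub>F r in at_left (1::real). r \<in> {max 0 (cmod z)<..<1}"
    using z by (intro eventually_at_leftI[of "max 0 (cmod z)"]) auto
  have "\<forall>\<^sub>F r in at_left 1. cmod (q z) * sqrt (1 - K * (1 - r\<^sup>2)) \<le> C"
    using ev0 ev1
  proof eventually_elim
    case (elim r)
    then have "cmod z < r" "r < 1" by auto
    moreover from this have "0 < r" using norm_ge_zero[of z] by linarith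
    ultimately have r: "0 < r" "cmod z < r" "r < 1" by auto
    have "cmod (q z) \<le> C / sqrt (1 - K * (1 - r\<^sup>2))"
    proof (rule maximum_modulus_frontier[of q "ball 0 r"])
      show "q holomorphic_on interior (ball 0 r)"
        using r by (auto intro: holomorphic_on_subset[OF q])
      show "continuous_on (closure (ball 0 r)) q"
        using r by (intro continuous_on_subset[OF holomorphic_on_imp_continuous_on[OF q]]) auto
      fix w :: complex assume "w \<in> frontier (ball 0 r)"
      then have w: "cmod w = r" using r by (simp add: frontier_ball)
      then have wD: "w \<in> unit_disk" using r by simp
      have le: "1 - cmod a \<le> cmod (1 - cnj a * w)"
      proof -
        have "cmod (cnj a * w) \<le> cmod a" using w r by (simp add: norm_mult mult_left_le)
        then show ?thesis using norm_triangle_ineq2[of 1 "cnj a * w"] by simp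
      qed
      have "1 - (pseudo_dist w a)\<^sup>2 \<le> K * (1 - r\<^sup>2)"
        unfolding one_minus_pseudo_dist_sq[OF wD a] w K_def times_divide_eq_left
        using le a r one_minus_norm_sq_pos[OF a] one_minus_norm_sq_pos[OF wD] w
        by (subst mult.commute, intro divide_left_mono power_mono mult_nonneg_nonneg) (auto intro!: mult_pos_pos)
      then have "1 - K * (1 - r\<^sup>2) \<le> (pseudo_dist w a)\<^sup>2" by simp
      then have "sqrt (1 - K * (1 - r\<^sup>2)) \<le> pseudo_dist w a"
        by (simp add: real_le_lsqrt real_sqrt_le_iff sqrt_le_D real_sqrt_le_mono[THEN order_trans])
      then have "cmod (q w) * sqrt (1 - K * (1 - r\<^sup>2)) \<le> C"
        using mult_left_mono[of _ "pseudo_dist w a" "cmod (q w)"] bd[OF wD] by fastforce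
      then show "cmod (q w) \<le> C / sqrt (1 - K * (1 - r\<^sup>2))"
        using elim by (simp add: pos_le_divide_eq)
    qed (use r in auto)
    then show ?case using elim by (simp add: pos_le_divide_eq)
  qed
  from tendsto_upperbound[OF lim this] show ?thesis by simp
qed

lemma divide_out_zero:
  assumes f: "f holomorphic_on unit_disk" and a: "a \<in> unit_disk" "f a = 0"
    and bd: "\<And>z. z \<in> unit_disk \<Longrightarrow> cmod (f z) \<le> C"
  obtains q where "q holomorphic_on unit_disk" "\<And>z. z \<in> unit_disk \<Longrightarrow> f z = disk_moebius a z * q z"
    "\<And>z. z \<in> unit_disk \<Longrightarrow> cmod (q z) \<le> C"
proof -
  define p where "p z = (if z = a then deriv f a else (f z - f a) / (z - a))" for z
  have p: "p holomorphic_on unit_disk"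
    unfolding p_def[abs_def] by (rule pole_lemma_open[OF f open_ball])
  define q where "q z = p z * (1 - cnj a * z)" for z
  have q: "q holomorphic_on unit_disk" unfolding q_def[abs_def] by (intro holomorphic_intros p)
  have eq: "f z = disk_moebius a z * q z" if "z \<in> unit_disk" for z
    using disk_denom_nonzero[OF that a(1)] a(2) by (simp add: disk_moebius_def q_def p_def)
  show ?thesis
  proof (rule that[OF q eq])
    fix z assume "z \<in> unit_disk"
    then show "cmod (q z) \<le> C"
      by (intro bounded_by_quotient_Blaschke[OF q a(1)]) (use bd eq in \<open>auto simp: norm_mult cmod_disk_moebius mult.commute\<close>)
  qed
qed

text \<open>Each zero can be divided out by a Moebius factor without increasing the bound.\<close>

lemma Schwarz_Pick_finite:
  assumes "finite A" "A \<subseteq> unit_disk" "f holomorphic_on unit_disk" "\<And>a. a \<in> A \<Longrightarrow> f a = 0"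
    "\<And>z. z \<in> unit_disk \<Longrightarrow> cmod (f z) \<le> C" "z \<in> unit_disk"
  shows "cmod (f z) \<le> C * (\<Prod>a\<in>A. pseudo_dist z a)"
  using assms
proof (induction A arbitrary: f rule: finite_induct)
  case empty
  then show ?case by simp
next
  case (insert a A)
  obtain q where q: "q holomorphic_on unit_disk" "\<And>z. z \<in> unit_disk \<Longrightarrow> f z = disk_moebius a z * q z"
    "\<And>z. z \<in> unit_disk \<Longrightarrow> cmod (q z) \<le> C"
    by (rule divide_out_zero[of f a C]) (use insert.prems in auto)
  have "q b = 0" if "b \<in> A" for b
  proof -
    have "b \<in> unit_disk" "a \<in> unit_disk" "b \<noteq> a" using that insert by auto
    then have "disk_moebius a b \<noteq> 0" using pseudo_dist_eq_0_iff[of b a] by (metis cmod_disk_moebius norm_zero)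
    then show ?thesis using q(2)[of b] insert.prems(3)[of b] that \<open>b \<in> unit_disk\<close> by simp
  qed
  then have "cmod (q z) \<le> C * (\<Prod>a\<in>A. pseudo_dist z a)"
    using insert.prems by (intro insert.IH q) auto
  then have "pseudo_dist z a * cmod (q z) \<le> pseudo_dist z a * (C * (\<Prod>a\<in>A. pseudo_dist z a))"
    by (intro mult_left_mono) auto
  then show ?case using q(2)[OF insert.prems(5)] insert.hyps by (simp add: norm_mult cmod_disk_moebius mult_ac)
qed

text \<open>The Schwarz-Pick inequality for maps into the right half plane, with the Cayley transform that sends
\<open>h z\<close> to \<open>0\<close>. It yields both Harnack's inequality and the local bounds needed for normal families.\<close>

lemma Schwarz_Pick_half_plane:
  assumes h: "h holomorphic_on unit_disk" "\<And>z. z \<in> unit_disk \<Longrightarrow> 0 < Re (h z)"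
    and z: "z \<in> unit_disk" and w: "w \<in> unit_disk"
  shows "cmod (h w - h z) \<le> pseudo_dist w z * cmod (h w + cnj (h z))"
proof -
  have nz: "h x + cnj (h z) \<noteq> 0" if "x \<in> unit_disk" for x
    using h(2)[OF that] h(2)[OF z] by (auto simp: complex_eq_iff)
  define f where "f x = (h x - h z) / (h x + cnj (h z))" for x
  have "f holomorphic_on unit_disk"
    unfolding f_def[abs_def] by (intro holomorphic_intros h(1)) (use nz in auto)
  moreover have "cmod (f x) \<le> 1" if x: "x \<in> unit_disk" for x
  proof -
    have "(cmod (h x - h z))\<^sup>2 \<le> (cmod (h x + cnj (h z)))\<^sup>2"
      using mult_pos_pos[OF h(2)[OF x] h(2)[OF z]] unfolding cmod_power2
      by (simp add: power2_eq_square algebra_simps)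
    then have "cmod (h x - h z) \<le> cmod (h x + cnj (h z))" by (rule power2_le_imp_le) simp
    then show ?thesis using nz[OF x] by (simp add: f_def norm_divide divide_le_eq)
  qed
  moreover have "f z = 0" by (simp add: f_def)
  ultimately have "cmod (f w) \<le> 1 * (\<Prod>a\<in>{z}. pseudo_dist w a)"
    using z w by (intro Schwarz_Pick_finite[of "{z}" f]) auto
  then show ?thesis using nz[OF w] by (simp add: f_def norm_divide divide_le_eq)
qed

lemma Harnack:
  assumes H: "H \<in> Har_pos" and z: "z \<in> unit_disk" and w: "w \<in> unit_disk" and le: "pseudo_dist w z \<le> 1/3"
  shows "H w \<le> 2 * H z"
proof -
  obtain h where h: "h holomorphic_on unit_disk" "\<And>z. z \<in> unit_disk \<Longrightarrow> 0 < Re (h z)"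
      "\<And>z. z \<in> unit_disk \<Longrightarrow> H z = Re (h z)"
    using H unfolding Har_pos_iff by blast
  have "cmod (h w - h z) \<le> 1/3 * cmod (h w + cnj (h z))"
    using Schwarz_Pick_half_plane[OF h(1,2) z w] le mult_right_mono[OF le norm_ge_zero, of "h w + cnj (h z)"] by linarith
  then have "(3 * cmod (h w - h z))\<^sup>2 \<le> (cmod (h w + cnj (h z)))\<^sup>2"
    by (intro power_mono) auto
  then have "9 * (Re (h w) - Re (h z))\<^sup>2 + 8 * (Im (h w) - Im (h z))\<^sup>2 \<le> (Re (h w) + Re (h z))\<^sup>2"
    unfolding power_mult_distrib cmod_power2 by simp
  moreover have "(3 * (Re (h w) - Re (h z)))\<^sup>2 = 9 * (Re (h w) - Re (h z))\<^sup>2"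
    by (simp only: power_mult_distrib) simp
  ultimately have "(3 * (Re (h w) - Re (h z)))\<^sup>2 \<le> (Re (h w) + Re (h z))\<^sup>2"
    using zero_le_power2[of "Im (h w) - Im (h z)"] by linarith
  then have "3 * (Re (h w) - Re (h z)) \<le> Re (h w) + Re (h z)"
    by (rule power2_le_imp_le) (use h(2)[OF z] h(2)[OF w] in simp)
  then show ?thesis using h(3) z w by simp
qed

text \<open>Normalising the conjugate functions by \<open>Im (h\<^sub>n 0) = 0\<close>, the half plane form of Schwarz-Pick bounds the
\<open>h\<^sub>n\<close> locally uniformly in terms of \<open>M\<close>, and Montel's theorem applies. A limit of positive functions may
vanish identically, which is why \<open>1\<close> is added.\<close>

lemma Har_pos_compact:
  assumes U: "\<And>n. U n \<in> Har_pos" "\<And>n. U n 0 \<le> M"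
  obtains V and r :: "nat \<Rightarrow> nat" where "V \<in> Har_pos" "strict_mono r"
    "\<And>z. z \<in> unit_disk \<Longrightarrow> (\<lambda>n. U (r n) z) \<longlonglongrightarrow> V z - 1"
proof -
  have "\<exists>h. h holomorphic_on unit_disk \<and> (\<forall>z\<in>unit_disk. U n z = Re (h z) \<and> 0 < Re (h z)) \<and> Im (h 0) = 0" for n
  proof -
    obtain h where "h holomorphic_on unit_disk" "\<forall>z\<in>unit_disk. U n z = Re (h z) \<and> 0 < Re (h z)"
      using U(1)[of n] unfolding Har_pos_iff by blast
    then show ?thesis
      by (intro exI[of _ "\<lambda>z. h z - \<i> * of_real (Im (h 0))"]) (auto intro!: holomorphic_intros)
  qed
  then obtain h where h: "\<And>n. h n holomorphic_on unit_disk" "\<And>n z. z \<in> unit_disk \<Longrightarrow> U n z = Re (h n z)"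
      "\<And>n z. z \<in> unit_disk \<Longrightarrow> 0 < Re (h n z)" "\<And>n. Im (h n 0) = 0" by metis
  have bd: "cmod (h n z) * (1 - cmod z) \<le> M * (1 + cmod z)" if z: "z \<in> unit_disk" for n z
  proof -
    have 0: "cmod (h n 0) \<le> M" using U(2)[of n] h(2)[of 0 n] h(3)[of 0 n] h(4)[of n] by (simp add: cmod_eq_Re)
    have "cmod (h n z - h n 0) \<le> cmod z * cmod (h n z + cnj (h n 0))"
      using Schwarz_Pick_half_plane[OF h(1,3), of 0 z n] z by simp
    also have "\<dots> \<le> cmod z * (cmod (h n z) + M)"
      using norm_triangle_ineq[of "h n z" "cnj (h n 0)"] 0 by (intro mult_left_mono) auto
    finally have "cmod (h n z) - M \<le> cmod z * (cmod (h n z) + M)"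
      using norm_triangle_ineq2[of "h n z" "h n 0"] 0 by linarith
    then show ?thesis by (simp add: algebra_simps)
  qed
  obtain g r where g: "g holomorphic_on unit_disk" "strict_mono (r :: nat \<Rightarrow> nat)"
      "\<And>x. x \<in> unit_disk \<Longrightarrow> ((\<lambda>n. h (r n) x) \<longlongrightarrow> g x) sequentially"
  proof (rule Montel[of unit_disk "range h" h])
    fix K :: "complex set" assume K: "compact K" "K \<subseteq> unit_disk"
    show "\<exists>B. \<forall>h\<in>range h. \<forall>z\<in>K. cmod (h z) \<le> B"
    proof (cases "K = {}")
      case False
      obtain x where x: "x \<in> K" "\<And>y. y \<in> K \<Longrightarrow> cmod y \<le> cmod x"
        using continuous_attains_sup[OF K(1) False continuous_on_norm_id] by auto
      have x1: "cmod x < 1" using x K by auto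
      have M: "0 \<le> M" using U(2)[of 0] Har_pos_pos[OF U(1), of 0 0] by simp
      have "cmod (h n z) \<le> M * 2 / (1 - cmod x)" if "z \<in> K" for n z
      proof -
        have z: "z \<in> unit_disk" using that K by auto
        have "cmod (h n z) * (1 - cmod x) \<le> cmod (h n z) * (1 - cmod z)"
          using x(2)[OF that] by (intro mult_left_mono) auto
        also have "\<dots> \<le> M * (1 + cmod z)" by (rule bd[OF z])
        also have "\<dots> \<le> M * 2" using z M by (intro mult_left_mono) auto
        finally show ?thesis using x1 by (simp add: pos_le_divide_eq)
      qed
      then show ?thesis by blast
    qed auto
  qed (use h(1) in auto)
  have lim: "(\<lambda>n. U (r n) z) \<longlonglongrightarrow> Re (g z)" if "z \<in> unit_disk" for z
    using tendsto_Re[OF g(3)[OF that]] h(2)[OF that] by simp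
  show ?thesis
  proof (rule that[OF _ g(2), of "\<lambda>z. Re (g z + 1)"])
    show "(\<lambda>z. Re (g z + 1)) \<in> Har_pos"
    proof (rule Har_posI)
      show "(\<lambda>z. g z + 1) holomorphic_on unit_disk" by (intro holomorphic_intros g)
      fix z :: complex assume z: "z \<in> unit_disk"
      have "0 \<le> Re (g z)"
        by (rule tendsto_lowerbound[OF lim[OF z]]) (use Har_pos_pos[OF U(1) z] in \<open>auto intro!: always_eventually less_imp_le\<close>)
      then show "0 < Re (g z + 1)" by simp
    qed auto
  qed (use lim in auto)
qed

section \<open>Blaschke products\<close>

lemma Blaschke_factor_fun: "a \<noteq> 0 \<Longrightarrow> Blaschke_factor a = (\<lambda>z. (of_real (cmod a) / a) * ((a - z) / (1 - cnj a * z)))"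
  "Blaschke_factor 0 = (\<lambda>z. z)"
  by (auto simp: Blaschke_factor_def fun_eq_iff)

lemma Blaschke_factor_holomorphic: 
  assumes "a \<in> unit_disk" shows "Blaschke_factor a holomorphic_on unit_disk"
proof (cases "a = 0")
  case False
  then show ?thesis unfolding Blaschke_factor_fun(1)[OF False]
    by (intro holomorphic_intros) (use disk_denom_nonzero[OF _ assms] in auto)
qed (simp add: Blaschke_factor_fun)

lemma Blaschke_factor_eq_0_iff: "z \<in> unit_disk \<Longrightarrow> a \<in> unit_disk \<Longrightarrow> Blaschke_factor a z = 0 \<longleftrightarrow> z = a"
  using pseudo_dist_eq_0_iff[of z a] cmod_Blaschke_factor[of a z] by (metis norm_eq_zero)

lemma Blaschke_factor_minus_1:
  assumes a: "a \<in> unit_disk" and z: "z \<in> unit_disk"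
  shows "cmod (Blaschke_factor a z - 1) \<le> 2 / (1 - cmod z) * (1 - cmod a)"
proof -
  have z1: "cmod z < 1" using z by simp
  show ?thesis
  proof (cases "a = 0")
    case True
    have "cmod (z - 1) \<le> 2" using norm_triangle_ineq4[of z 1] z1 by simp
    also have "2 \<le> 2 / (1 - cmod z)" using z1 by (simp add: pos_le_divide_eq)
    finally show ?thesis using True by (simp add: Blaschke_factor_def)
  next
    case False
    have nz: "1 - cnj a * z \<noteq> 0" using disk_denom_nonzero[OF z a] .
    have aa: "of_real (cmod a) * of_real (cmod a) = a * cnj a"
      by (metis complex_norm_square power2_eq_square of_real_mult)
    have "Blaschke_factor a z - 1 = (of_real (cmod a) * (a - z) - a * (1 - cnj a * z)) / (a * (1 - cnj a * z))"
    proof -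
      have "x / a * (y / d) - 1 = (x * y - a * d) / (a * d)" if "d \<noteq> 0" for x y d
        using False that by (simp add: field_simps)
      from this[OF nz] show ?thesis using False by (simp only: Blaschke_factor_def if_False)
    qed
    also have "of_real (cmod a) * (a - z) - a * (1 - cnj a * z) = - (of_real (1 - cmod a) * (a + of_real (cmod a) * z))"
    proof -
      have "a * (1 - cnj a * z) = a - (of_real (cmod a) * of_real (cmod a)) * z"
        unfolding aa right_diff_distrib mult_1_right mult.assoc ..
      then show ?thesis by (simp only:) (simp add: algebra_simps)
    qed
    finally have "cmod (Blaschke_factor a z - 1) = (1 - cmod a) * cmod (a + of_real (cmod a) * z) / (cmod a * cmod (1 - cnj a * z))"
      using a by (simp only: norm_divide norm_mult norm_minus_cancel norm_of_real) simp
    also have "\<dots> \<le> (1 - cmod a) * (cmod a * 2) / (cmod a * (1 - cmod z))"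
    proof (intro frac_le mult_left_mono)
      have "cmod (a + of_real (cmod a) * z) \<le> cmod a + cmod a * cmod z"
        using norm_triangle_ineq[of a "of_real (cmod a) * z"] by (simp add: norm_mult)
      also have "\<dots> \<le> cmod a * 2" using z1 by (simp add: mult_left_le)
      finally show "cmod (a + of_real (cmod a) * z) \<le> cmod a * 2" .
      have "cmod (cnj a * z) \<le> cmod z" using a by (simp add: norm_mult mult_left_le_one_le)
      then show "1 - cmod z \<le> cmod (1 - cnj a * z)" using norm_triangle_ineq2[of 1 "cnj a * z"] by simp
    qed (use a z1 False in auto)
    also have "\<dots> = 2 / (1 - cmod z) * (1 - cmod a)" using False by simp
    finally show ?thesis .
  qed
qed

lemma holomorphic_suminf_disk:
  fixes f :: "nat \<Rightarrow> complex \<Rightarrow> complex"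
  assumes f: "\<And>k. f k holomorphic_on unit_disk" and M: "summable M"
    and bd: "\<And>r. 0 \<le> r \<Longrightarrow> r < 1 \<Longrightarrow> \<exists>C. \<forall>k z. cmod z \<le> r \<longrightarrow> cmod (f k z) \<le> C * M k"
  shows "(\<lambda>z. \<Sum>k. f k z) holomorphic_on unit_disk"
    and "\<And>z. z \<in> unit_disk \<Longrightarrow> summable (\<lambda>k. cmod (f k z))"
proof -
  have ul: "uniform_limit (cball 0 r) (\<lambda>n z. \<Sum>k<n. f k z) (\<lambda>z. \<Sum>k. f k z) sequentially"
    if r: "0 \<le> r" "r < 1" for r
  proof -
    obtain C where "\<forall>k z. cmod z \<le> r \<longrightarrow> cmod (f k z) \<le> C * M k" using bd[OF r] by blast
    then show ?thesis
      by (intro Weierstrass_m_test[OF _ summable_mult[OF M, of C]]) auto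
  qed
  show "(\<lambda>z. \<Sum>k. f k z) holomorphic_on unit_disk"
  proof (rule holomorphic_uniform_sequence[OF open_ball])
    show "(\<lambda>z. \<Sum>k<n. f k z) holomorphic_on unit_disk" for n
      by (intro holomorphic_intros f)
    fix x :: complex assume x: "x \<in> unit_disk"
    define d where "d = (1 - cmod x) / 2"
    have sub: "cball x d \<subseteq> cball 0 ((1 + cmod x) / 2)"
      by (rule cball_subset_cball_iff[THEN iffD2]) (simp add: d_def field_simps)
    show "\<exists>d>0. cball x d \<subseteq> unit_disk \<and> uniform_limit (cball x d) (\<lambda>n z. \<Sum>k<n. f k z) (\<lambda>z. \<Sum>k. f k z) sequentially"
    proof (intro exI[of _ d] conjI)
      show "uniform_limit (cball x d) (\<lambda>n z. \<Sum>k<n. f k z) (\<lambda>z. \<Sum>k. f k z) sequentially"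
        by (rule uniform_limit_on_subset[OF ul sub]) (use x in \<open>auto intro: add_nonneg_nonneg\<close>)
      show "cball x d \<subseteq> unit_disk" using x by (intro order_trans[OF sub]) auto
    qed (use x in \<open>simp add: d_def\<close>)
  qed
  fix z :: complex assume z: "z \<in> unit_disk"
  then obtain C where C: "\<forall>k w. cmod w \<le> cmod z \<longrightarrow> cmod (f k w) \<le> C * M k" using bd[of "cmod z"] by auto
  show "summable (\<lambda>k. cmod (f k z))"
    by (rule summable_comparison_test'[OF summable_mult[OF M, of C], of 0]) (use C in auto)
qed

context
  fixes I :: "nat set" and a :: "nat \<Rightarrow> complex"
  assumes B: "Blaschke_condition I a"
begin

lemma Blaschke_in_disk: "k \<in> I \<Longrightarrow> a k \<in> unit_disk"
  using B unfolding Blaschke_condition_def by auto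

lemma Blaschke_summable: "summable (\<lambda>k. if k \<in> I then 1 - cmod (a k) else 0)"
  using B by (simp add: Blaschke_condition_def)

lemma Blaschke_condition_mono:
  assumes "J \<subseteq> I" shows "Blaschke_condition J a"
proof -
  have "summable (\<lambda>k. if k \<in> J then 1 - cmod (a k) else 0)"
    by (rule summable_comparison_test'[OF Blaschke_summable, of 0]) (use assms Blaschke_in_disk in \<open>auto simp: less_imp_le\<close>)
  then show ?thesis using assms Blaschke_in_disk by (auto simp: Blaschke_condition_def)
qed

lemma Blaschke_finite_occs: "finite {k\<in>I. a k = z}" 
proof (cases "{k\<in>I. a k = z} = {}")
  case False
  then have "z \<in> unit_disk" using Blaschke_in_disk by auto
  then have "0 < 1 - cmod z" by simp
  then have "\<forall>\<^sub>F k in sequentially. (if k \<in> I then 1 - cmod (a k) else 0) < 1 - cmod z"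
    using order_tendstoD(2)[OF summable_LIMSEQ_zero[OF Blaschke_summable]] by blast
  then obtain N where "\<And>k. k \<ge> N \<Longrightarrow> (if k \<in> I then 1 - cmod (a k) else 0) < 1 - cmod z"
    unfolding eventually_sequentially by blast
  then have "{k\<in>I. a k = z} \<subseteq> {..<N}" by (force simp: not_le[symmetric])
  then show ?thesis using finite_subset by blast
next
  case True
  then show ?thesis by (simp only: finite.emptyI)
qed

lemma Blaschke_term_bound:
  assumes "z \<in> unit_disk"
  shows "cmod ((if k \<in> I then Blaschke_factor (a k) z else 1) - 1)
    \<le> 2 / (1 - cmod z) * (if k \<in> I then 1 - cmod (a k) else 0)"
  using Blaschke_factor_minus_1[OF Blaschke_in_disk assms] by auto

lemma Blaschke_convergent_prod:
  assumes "z \<in> unit_disk"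
  shows "convergent_prod (\<lambda>k. if k \<in> I then Blaschke_factor (a k) z else 1)"
proof (rule abs_convergent_prod_imp_convergent_prod)
  show "abs_convergent_prod (\<lambda>k. if k \<in> I then Blaschke_factor (a k) z else 1)"
    unfolding abs_convergent_prod_conv_summable
    by (rule summable_comparison_test'[OF summable_mult[OF Blaschke_summable, of "2 / (1 - cmod z)"], of 0])
       (use Blaschke_term_bound[OF assms] in simp)
qed

lemma Blaschke_has_prod:
  "z \<in> unit_disk \<Longrightarrow> (\<lambda>k. if k \<in> I then Blaschke_factor (a k) z else 1) has_prod Blaschke_product I a z"
  unfolding Blaschke_product_def by (rule convergent_prod_has_prod[OF Blaschke_convergent_prod])

lemma Blaschke_product_LIMSEQ:
  assumes "z \<in> unit_disk"
  shows "(\<lambda>N. \<Prod>k<N. if k \<in> I then Blaschke_factor (a k) z else 1) \<longlonglongrightarrow> Blaschke_product I a z"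
  using convergent_prod_LIMSEQ[OF Blaschke_convergent_prod[OF assms]]
  unfolding Blaschke_product_def by (subst LIMSEQ_lessThan_iff_atMost)

lemma Blaschke_product_holomorphic: "Blaschke_product I a holomorphic_on unit_disk"
proof (rule holomorphic_uniform_sequence[OF open_ball])
  have fh: "(\<lambda>z. if k \<in> I then Blaschke_factor (a k) z else 1) holomorphic_on unit_disk" for k
    using Blaschke_factor_holomorphic[OF Blaschke_in_disk] by (cases "k \<in> I") auto
  then show "(\<lambda>z. \<Prod>k<N. if k \<in> I then Blaschke_factor (a k) z else 1) holomorphic_on unit_disk" for N
    by (intro holomorphic_intros)
  fix x :: complex assume x: "x \<in> unit_disk"
  define d where "d = (1 - cmod x) / 2"
  define r where "r = (1 + cmod x) / 2"
  have r: "0 \<le> r" "r < 1" using x by (auto simp: r_def)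
  have sub: "cball x d \<subseteq> cball 0 r"
    by (rule cball_subset_cball_iff[THEN iffD2]) (simp add: d_def r_def field_simps)
  have sub1: "cball 0 r \<subseteq> unit_disk" using r by auto
  let ?P = "\<lambda>N z. \<Prod>k<N. if k \<in> I then Blaschke_factor (a k) z else 1"
  have "uniformly_convergent_on (cball 0 r) ?P"
  proof (rule uniformly_convergent_on_prod')
    show "continuous_on (cball 0 r) (\<lambda>z. if k \<in> I then Blaschke_factor (a k) z else 1)" for k
      by (rule continuous_on_subset[OF holomorphic_on_imp_continuous_on[OF fh] sub1])
    show "uniformly_convergent_on (cball 0 r) (\<lambda>N z. \<Sum>k<N. cmod ((if k \<in> I then Blaschke_factor (a k) z else 1) - 1))"
    proof (rule Weierstrass_m_test')
      show "summable (\<lambda>k. 2 / (1 - r) * (if k \<in> I then 1 - cmod (a k) else 0))"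
        by (rule summable_mult[OF Blaschke_summable])
      fix k and z :: complex assume z: "z \<in> cball 0 r"
      then have zD: "z \<in> unit_disk" using sub1 by auto
      have "0 \<le> (if k \<in> I then 1 - cmod (a k) else 0)" using Blaschke_in_disk[of k] by auto
      moreover have "2 / (1 - cmod z) \<le> 2 / (1 - r)" using z r by (intro divide_left_mono) auto
      ultimately have "2 / (1 - cmod z) * (if k \<in> I then 1 - cmod (a k) else 0) \<le> 2 / (1 - r) * (if k \<in> I then 1 - cmod (a k) else 0)"
        by (rule mult_right_mono[rotated])
      with Blaschke_term_bound[OF zD, of k]
      show "norm (cmod ((if k \<in> I then Blaschke_factor (a k) z else 1) - 1)) \<le> 2 / (1 - r) * (if k \<in> I then 1 - cmod (a k) else 0)"
        by simp
    qed
  qed auto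
  then obtain g where g: "uniform_limit (cball 0 r) ?P g sequentially"
    by (auto simp: uniformly_convergent_on_def)
  have "uniform_limit (cball 0 r) ?P (Blaschke_product I a) sequentially"
  proof (rule uniform_limit_cong'[THEN iffD1, OF _ _ g])
    fix z :: complex assume z: "z \<in> cball 0 r"
    show "g z = Blaschke_product I a z"
      using LIMSEQ_unique[OF tendsto_uniform_limitI[OF g z] Blaschke_product_LIMSEQ] z sub1 by auto
  qed auto
  then have "uniform_limit (cball x d) ?P (Blaschke_product I a) sequentially"
    using sub by (rule uniform_limit_on_subset)
  moreover have "d > 0" using x by (simp add: d_def)
  ultimately show "\<exists>d>0. cball x d \<subseteq> unit_disk \<and> uniform_limit (cball x d) ?P (Blaschke_product I a) sequentially"
    using order_trans[OF sub sub1] by blast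
qed

lemma Blaschke_product_eq_0_iff:
  assumes "z \<in> unit_disk" shows "Blaschke_product I a z = 0 \<longleftrightarrow> z \<in> a ` I"
proof -
  have "Blaschke_product I a z = 0 \<longleftrightarrow> (\<exists>k. (if k \<in> I then Blaschke_factor (a k) z else 1) = 0)"
    using has_prod_eq_0_iff[OF Blaschke_has_prod[OF assms]] by (auto simp: image_iff)
  also have "\<dots> \<longleftrightarrow> (\<exists>k\<in>I. z = a k)"
    using Blaschke_factor_eq_0_iff[OF assms Blaschke_in_disk] by (metis one_neq_zero)
  finally show ?thesis by auto
qed

lemma cmod_Blaschke_partial:
  "cmod (\<Prod>k<N. if k \<in> I then Blaschke_factor (a k) z else 1) = (\<Prod>k\<in>I \<inter> {..<N}. pseudo_dist z (a k))"
proof -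
  have "cmod (\<Prod>k<N. if k \<in> I then Blaschke_factor (a k) z else 1) = (\<Prod>k<N. if k \<in> I then pseudo_dist z (a k) else 1)"
    unfolding prod_norm[symmetric] by (intro prod.cong) (auto simp: cmod_Blaschke_factor)
  also have "\<dots> = (\<Prod>k\<in>{..<N} \<inter> I. pseudo_dist z (a k))" by (simp add: prod.inter_restrict)
  finally show ?thesis by (simp add: Int_commute)
qed

lemma cmod_Blaschke_product_le:
  assumes z: "z \<in> unit_disk" and F: "finite F" "F \<subseteq> I"
  shows "cmod (Blaschke_product I a z) \<le> (\<Prod>k\<in>F. pseudo_dist z (a k))"
proof (rule tendsto_upperbound[OF tendsto_norm[OF Blaschke_product_LIMSEQ[OF z]]])
  obtain N where N: "F \<subseteq> {..<N}" using F(1) by (meson finite_nat_iff_bounded)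
  have "cmod (\<Prod>k<n. if k \<in> I then Blaschke_factor (a k) z else 1) \<le> (\<Prod>k\<in>F. pseudo_dist z (a k))" if "n \<ge> N" for n
  proof -
    have sub: "F \<subseteq> I \<inter> {..<n}" using N F that by auto
    have "(\<Prod>k\<in>I \<inter> {..<n} - F. pseudo_dist z (a k)) \<le> 1"
      by (rule prod_le_1) (use pseudo_dist_less_1[OF z Blaschke_in_disk] in \<open>auto intro: less_imp_le\<close>)
    then have "(\<Prod>k\<in>I \<inter> {..<n} - F. pseudo_dist z (a k)) * (\<Prod>k\<in>F. pseudo_dist z (a k)) \<le> 1 * (\<Prod>k\<in>F. pseudo_dist z (a k))"
      by (intro mult_right_mono prod_nonneg) auto
    then show ?thesis unfolding cmod_Blaschke_partial
      using prod.subset_diff[OF sub, of "\<lambda>k. pseudo_dist z (a k)"] by simp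
  qed
  then show "\<forall>\<^sub>F n in sequentially. cmod (\<Prod>k<n. if k \<in> I then Blaschke_factor (a k) z else 1) \<le> (\<Prod>k\<in>F. pseudo_dist z (a k))"
    by (rule eventually_sequentiallyI)
qed simp

lemma cmod_Blaschke_product_le_1: "z \<in> unit_disk \<Longrightarrow> cmod (Blaschke_product I a z) \<le> 1"
  using cmod_Blaschke_product_le[of z "{}"] by simp

lemma cmod_Blaschke_product_ge:
  assumes z: "z \<in> unit_disk" and c: "\<And>F. finite F \<Longrightarrow> F \<subseteq> I \<Longrightarrow> c \<le> (\<Prod>k\<in>F. pseudo_dist z (a k))"
  shows "c \<le> cmod (Blaschke_product I a z)"
  by (rule tendsto_lowerbound[OF tendsto_norm[OF Blaschke_product_LIMSEQ[OF z]]])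
     (auto simp: cmod_Blaschke_partial intro!: always_eventually c)

end

lemma Blaschke_product_Un:
  assumes B: "Blaschke_condition (I \<union> J) a" and disj: "I \<inter> J = {}" and z: "z \<in> unit_disk"
  shows "Blaschke_product (I \<union> J) a z = Blaschke_product I a z * Blaschke_product J a z"
proof -
  have I: "Blaschke_condition I a" "Blaschke_condition J a"
    using Blaschke_condition_mono[OF B] by auto
  have "Blaschke_product I a z * Blaschke_product J a z
     = (\<Prod>k. (if k \<in> I then Blaschke_factor (a k) z else 1) * (if k \<in> J then Blaschke_factor (a k) z else 1))"
    unfolding Blaschke_product_def
    by (rule prodinf_mult[OF Blaschke_convergent_prod[OF I(1) z] Blaschke_convergent_prod[OF I(2) z]])
  also have "\<dots> = Blaschke_product (I \<union> J) a z"
    unfolding Blaschke_product_def using disj by (intro prodinf_cong) auto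
  finally show ?thesis by simp
qed

lemma Blaschke_product_finite: "finite F \<Longrightarrow> Blaschke_product F a z = (\<Prod>k\<in>F. Blaschke_factor (a k) z)"
  unfolding Blaschke_product_def by (subst prodinf_finite[of F]) auto

lemma Blaschke_condition_finite:
  assumes "finite F" "a ` F \<subseteq> unit_disk" shows "Blaschke_condition F a"
  using assms summable_finite[of F "\<lambda>k. if k \<in> F then 1 - cmod (a k) else 0"] by (auto simp: Blaschke_condition_def)

lemma Blaschke_product_split:
  assumes B: "Blaschke_condition I a" and F: "finite F" "F \<subseteq> I" and z: "z \<in> unit_disk"
  shows "Blaschke_product I a z = (\<Prod>k\<in>F. Blaschke_factor (a k) z) * Blaschke_product (I - F) a z"
  using Blaschke_product_Un[of F "I - F" a z] B F z by (simp add: Un_absorb1 Blaschke_product_finite)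

text \<open>Split off the finitely many factors vanishing at \<open>\<alpha>\<close>; the remaining product is nonzero there.\<close>

lemma zorder_Blaschke_product:
  assumes B: "Blaschke_condition I a" and \<alpha>: "\<alpha> \<in> unit_disk"
  shows "zorder (Blaschke_product I a) \<alpha> = int (card {k\<in>I. a k = \<alpha>})"
proof -
  define F where "F = {k\<in>I. a k = \<alpha>}"
  have F: "finite F" "F \<subseteq> I" using Blaschke_finite_occs[OF B] by (auto simp: F_def)
  define u where "u z = (if \<alpha> = 0 then 1 else - (of_real (cmod \<alpha>) / \<alpha>) / (1 - cnj \<alpha> * z))" for z
  have u: "u holomorphic_on unit_disk"
    unfolding u_def[abs_def] by (cases "\<alpha> = 0") (auto intro!: holomorphic_intros dest: disk_denom_nonzero[OF _ \<alpha>, rotated 0])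
  have BI: "Blaschke_condition (I - F) a" using Blaschke_condition_mono[OF B] by auto
  have eq: "Blaschke_factor \<alpha> z = u z * (z - \<alpha>)" for z
    by (simp add: Blaschke_factor_def u_def) (simp add: divide_simps algebra_simps)
  have "zorder (Blaschke_product I a) \<alpha> = int (card F)"
  proof (rule zorder_eqI[OF open_ball \<alpha>, of "\<lambda>z. u z ^ card F * Blaschke_product (I - F) a z"])
    show "(\<lambda>z. u z ^ card F * Blaschke_product (I - F) a z) holomorphic_on unit_disk"
      by (intro holomorphic_intros u Blaschke_product_holomorphic[OF BI])
    have "Blaschke_product (I - F) a \<alpha> \<noteq> 0"
      unfolding Blaschke_product_eq_0_iff[OF BI \<alpha>] by (auto simp: F_def)
    then show "u \<alpha> ^ card F * Blaschke_product (I - F) a \<alpha> \<noteq> 0"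
      using disk_denom_nonzero[OF \<alpha> \<alpha>] by (auto simp: u_def)
    fix w assume w: "w \<in> unit_disk" "w \<noteq> \<alpha>"
    have "(\<Prod>k\<in>F. Blaschke_factor (a k) w) = (\<Prod>k\<in>F. u w * (w - \<alpha>))"
      by (intro prod.cong refl) (auto simp: F_def eq)
    then show "Blaschke_product I a w = u w ^ card F * Blaschke_product (I - F) a w * (w - \<alpha>) powi int (card F)"
      by (simp add: Blaschke_product_split[OF B F w(1)] power_mult_distrib mult_ac)
  qed
  then show ?thesis by (simp add: F_def)
qed

lemma bounded_by_quotient_finite_Blaschke:
  assumes "finite F" "a ` F \<subseteq> unit_disk" "q holomorphic_on unit_disk"
    "\<And>z. z \<in> unit_disk \<Longrightarrow> cmod (q z) * (\<Prod>k\<in>F. pseudo_dist z (a k)) \<le> C" "z \<in> unit_disk"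
  shows "cmod (q z) \<le> C"
  using assms
proof (induction F arbitrary: q z rule: finite_induct)
  case empty
  then show ?case by simp
next
  case (insert k F)
  have h: "(\<lambda>z. q z * Blaschke_factor (a k) z) holomorphic_on unit_disk"
    using insert.prems by (intro holomorphic_intros Blaschke_factor_holomorphic) auto
  have "cmod (q z * Blaschke_factor (a k) z) \<le> C" if "z \<in> unit_disk" for z
    by (rule insert.IH[OF _ h _ that]) (use insert in \<open>auto simp: norm_mult cmod_Blaschke_factor mult.assoc\<close>)
  then show ?case
    by (intro bounded_by_quotient_Blaschke[of q "a k"])
       (use insert.prems in \<open>auto simp: norm_mult cmod_Blaschke_factor\<close>)
qed

text \<open>Dividing by finite partial products gives \<open>|q|\<close> times the modulus of the remaining tail at most \<open>C\<close>.
Multiplying by the partial product again and passing to the limit gives \<open>|q| |B| \<le> C |B|\<close>, which is what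
is wanted at points where \<open>B\<close> does not vanish. The factors vanishing at the given point are removed
beforehand.\<close>

lemma bounded_by_quotient_Blaschke_product:
  assumes B: "Blaschke_condition I a" and q: "q holomorphic_on unit_disk"
    and bd: "\<And>z. z \<in> unit_disk \<Longrightarrow> cmod (q z) * cmod (Blaschke_product I a z) \<le> C"
    and z: "z \<in> unit_disk"
  shows "cmod (q z) \<le> C"
proof -
  have part: "cmod (q w) * cmod (Blaschke_product (I - F) a w) \<le> C"
    if F: "finite F" "F \<subseteq> I" and w: "w \<in> unit_disk" for F w
  proof -
    have BI: "Blaschke_condition (I - F) a" using Blaschke_condition_mono[OF B] by auto
    have "cmod (q w * Blaschke_product (I - F) a w) \<le> C"
    proof (rule bounded_by_quotient_finite_Blaschke[OF F(1) _ _ _ w])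
      show "a ` F \<subseteq> unit_disk" using Blaschke_in_disk[OF B] F by auto
      show "(\<lambda>w. q w * Blaschke_product (I - F) a w) holomorphic_on unit_disk"
        by (intro holomorphic_intros q Blaschke_product_holomorphic[OF BI])
      fix x assume x: "x \<in> unit_disk"
      show "cmod (q x * Blaschke_product (I - F) a x) * (\<Prod>k\<in>F. pseudo_dist x (a k)) \<le> C"
        using bd[OF x] unfolding Blaschke_product_split[OF B F x]
        by (simp add: norm_mult mult_ac cmod_Blaschke_factor flip: prod_norm)
    qed
    then show ?thesis by (simp add: norm_mult)
  qed
  \<comment> \<open>Without the factors vanishing at \<open>z\<close>, the limit can be cancelled.\<close>
  define F where "F = {k\<in>I. a k = z}"
  have F: "finite F" "F \<subseteq> I" using Blaschke_finite_occs[OF B] by (auto simp: F_def)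
  have BJ: "Blaschke_condition (I - F) a" using Blaschke_condition_mono[OF B] by auto
  have "cmod (q z) * cmod (Blaschke_product (I - F) a z) \<le> C * cmod (Blaschke_product (I - F) a z)"
  proof (rule tendsto_lowerbound[OF tendsto_mult_left[OF tendsto_norm[OF Blaschke_product_LIMSEQ[OF BJ z]]]])
    show "\<forall>\<^sub>F N in sequentially. cmod (q z) * cmod (Blaschke_product (I - F) a z)
            \<le> C * cmod (\<Prod>k<N. if k \<in> I - F then Blaschke_factor (a k) z else 1)"
    proof (rule always_eventually, rule allI)
      fix N
      let ?G = "(I - F) \<inter> {..<N}"
      have "cmod (Blaschke_product (I - F) a z) = (\<Prod>k\<in>?G. pseudo_dist z (a k)) * cmod (Blaschke_product (I - F - ?G) a z)"
        using Blaschke_product_split[OF BJ, of ?G z] z by (simp add: norm_mult cmod_Blaschke_factor flip: prod_norm)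
      moreover have "cmod (q z) * cmod (Blaschke_product (I - F - ?G) a z) \<le> C"
        using part[of "F \<union> ?G" z] F z by (simp add: Diff_Un Diff_eq Int_ac)
      then have "(\<Prod>k\<in>?G. pseudo_dist z (a k)) * (cmod (q z) * cmod (Blaschke_product (I - F - ?G) a z)) \<le> (\<Prod>k\<in>?G. pseudo_dist z (a k)) * C"
        by (intro mult_left_mono prod_nonneg) auto
      ultimately show "cmod (q z) * cmod (Blaschke_product (I - F) a z)
            \<le> C * cmod (\<Prod>k<N. if k \<in> I - F then Blaschke_factor (a k) z else 1)"
        unfolding cmod_Blaschke_partial[OF BJ] by (simp add: mult_ac)
    qed
  qed simp
  moreover have "Blaschke_product (I - F) a z \<noteq> 0"
    unfolding Blaschke_product_eq_0_iff[OF BJ z] by (auto simp: F_def)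
  ultimately show ?thesis by simp
qed

section \<open>Poisson sums\<close>

text \<open>The Cayley transform \<open>(1 + w)/(1 - w)\<close> maps the disk to the right half plane, so the real part of the sum
is positive. At \<open>w = cnj a\<^sub>k z\<close> it is the Poisson kernel with pole \<open>a\<^sub>k/|a\<^sub>k|\<close>, dilated by \<open>|a\<^sub>k|\<close>, and the
Blaschke condition makes the weights \<open>1 - |a\<^sub>k|\<^sup>2\<close> summable.\<close>

definition Poisson_sum :: "nat set \<Rightarrow> (nat \<Rightarrow> complex) \<Rightarrow> complex \<Rightarrow> complex" where
  "Poisson_sum I a z = (\<Sum>k. if k \<in> I then of_real (1 - (cmod (a k))\<^sup>2) * ((1 + cnj (a k) * z) / (1 - cnj (a k) * z)) else 0)"

lemma Re_Cayley: "w \<noteq> 1 \<Longrightarrow> Re ((1 + w) / (1 - w)) = (1 - (cmod w)\<^sup>2) / (cmod (1 - w))\<^sup>2"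
proof -
  assume "w \<noteq> 1"
  have "(1 + w) / (1 - w) = (1 + w) * cnj (1 - w) / of_real ((cmod (1 - w))\<^sup>2)"
    by (simp add: complex_div_cnj[of "1 + w"])
  then have "Re ((1 + w) / (1 - w)) = Re ((1 + w) * cnj (1 - w)) / (cmod (1 - w))\<^sup>2"
    by (simp only: Re_divide_of_real)
  also have "Re ((1 + w) * cnj (1 - w)) = 1 - (cmod w)\<^sup>2"
    unfolding cmod_power2 by (simp add: power2_eq_square algebra_simps)
  finally show ?thesis .
qed

context
  fixes I :: "nat set" and a :: "nat \<Rightarrow> complex"
  assumes B: "Blaschke_condition I a"
begin

lemma Poisson_term_Re:
  assumes k: "k \<in> I" and z: "z \<in> unit_disk"
  shows "Re (of_real (1 - (cmod (a k))\<^sup>2) * ((1 + cnj (a k) * z) / (1 - cnj (a k) * z)))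
     = (1 - (cmod (a k))\<^sup>2) * (1 - (cmod (cnj (a k) * z))\<^sup>2) / (cmod (1 - cnj (a k) * z))\<^sup>2"
proof -
  have "cnj (a k) * z \<noteq> 1" using disk_denom_nonzero[OF z Blaschke_in_disk[OF B k]] by auto
  note C = Re_Cayley[OF this]
  have R: "Re (of_real c * w) = c * Re w" for c w by simp
  show ?thesis unfolding R C by (simp only: times_divide_eq_right)
qed

lemma Poisson_term_bound:
  assumes "cmod z \<le> r" "r < 1" "k \<in> I"
  shows "cmod (of_real (1 - (cmod (a k))\<^sup>2) * ((1 + cnj (a k) * z) / (1 - cnj (a k) * z))) \<le> 4 / (1 - r) * (1 - cmod (a k))"
proof -
  have a: "cmod (a k) < 1" using Blaschke_in_disk[OF B assms(3)] by simp
  have l: "cmod (cnj (a k) * z) \<le> r" using a assms mult_left_le_one_le[of "cmod z" "cmod (a k)"] by (simp add: norm_mult)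
  have "1 - (cmod (a k))\<^sup>2 = (1 + cmod (a k)) * (1 - cmod (a k))" by (simp add: power2_eq_square algebra_simps)
  also have "\<dots> \<le> 2 * (1 - cmod (a k))" using a by (intro mult_right_mono) auto
  finally have 1: "1 - (cmod (a k))\<^sup>2 \<le> 2 * (1 - cmod (a k))" .
  have 2: "cmod ((1 + cnj (a k) * z) / (1 - cnj (a k) * z)) \<le> 2 / (1 - r)"
    unfolding norm_divide
    using norm_triangle_ineq[of 1 "cnj (a k) * z"] norm_triangle_ineq2[of 1 "cnj (a k) * z"] l assms
    by (intro frac_le) auto
  have "0 \<le> 1 - (cmod (a k))\<^sup>2" using one_minus_norm_sq_pos[OF Blaschke_in_disk[OF B assms(3)]] by simp
  then have "cmod (of_real (1 - (cmod (a k))\<^sup>2) * ((1 + cnj (a k) * z) / (1 - cnj (a k) * z)))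
      = (1 - (cmod (a k))\<^sup>2) * cmod ((1 + cnj (a k) * z) / (1 - cnj (a k) * z))"
    unfolding norm_mult norm_of_real by simp
  also have "\<dots> \<le> (2 * (1 - cmod (a k))) * (2 / (1 - r))"
    using 1 2 a by (intro mult_mono) auto
  finally show ?thesis by simp
qed

lemma Poisson_sum_holomorphic: "Poisson_sum I a holomorphic_on unit_disk"
  and Poisson_sum_summable: "z \<in> unit_disk \<Longrightarrow> summable (\<lambda>k. cmod (if k \<in> I then of_real (1 - (cmod (a k))\<^sup>2) * ((1 + cnj (a k) * z) / (1 - cnj (a k) * z)) else 0))"
proof -
  let ?f = "\<lambda>k z. if k \<in> I then of_real (1 - (cmod (a k))\<^sup>2) * ((1 + cnj (a k) * z) / (1 - cnj (a k) * z)) else 0"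
  have 1: "?f k holomorphic_on unit_disk" for k
    by (cases "k \<in> I") (auto intro!: holomorphic_intros dest: disk_denom_nonzero[OF _ Blaschke_in_disk[OF B], rotated 0])
  have 2: "\<exists>C. \<forall>k z. cmod z \<le> r \<longrightarrow> cmod (?f k z) \<le> C * (if k \<in> I then 1 - cmod (a k) else 0)"
    if "0 \<le> r" "r < 1" for r
    using Poisson_term_bound[of _ r] that by (intro exI[of _ "4 / (1 - r)"]) auto
  show "Poisson_sum I a holomorphic_on unit_disk"
    unfolding Poisson_sum_def[abs_def] by (rule holomorphic_suminf_disk(1)[OF 1 Blaschke_summable[OF B] 2])
  show "z \<in> unit_disk \<Longrightarrow> summable (\<lambda>k. cmod (?f k z))"
    by (rule holomorphic_suminf_disk(2)[OF 1 Blaschke_summable[OF B] 2])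
qed

lemma Poisson_sum_ge:
  assumes z: "z \<in> unit_disk" and F: "finite F" "F \<subseteq> I"
  shows "(\<Sum>k\<in>F. (1 - (cmod (a k))\<^sup>2) * (1 - (cmod (cnj (a k) * z))\<^sup>2) / (cmod (1 - cnj (a k) * z))\<^sup>2) \<le> Re (Poisson_sum I a z)"
proof -
  let ?f = "\<lambda>k. if k \<in> I then of_real (1 - (cmod (a k))\<^sup>2) * ((1 + cnj (a k) * z) / (1 - cnj (a k) * z)) else 0"
  have s: "summable ?f" using Poisson_sum_summable[OF z] by (rule summable_norm_cancel)
  have pos: "0 \<le> Re (?f k)" for k
  proof (cases "k \<in> I")
    case True
    have 1: "0 \<le> 1 - (cmod (a k))\<^sup>2"
      using one_minus_norm_sq_pos[OF Blaschke_in_disk[OF B True]] by (rule less_imp_le)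
    have 2: "0 \<le> 1 - (cmod (cnj (a k) * z))\<^sup>2"
      using power_le_one[OF norm_ge_zero less_imp_le[OF cmod_cnj_mult_less_1[OF z Blaschke_in_disk[OF B True]]], of 2] by simp
    have "0 \<le> Re (of_real (1 - (cmod (a k))\<^sup>2) * ((1 + cnj (a k) * z) / (1 - cnj (a k) * z)))"
      unfolding Poisson_term_Re[OF True z] using mult_nonneg_nonneg[OF 1 2] by (rule divide_nonneg_nonneg) simp
    then show ?thesis by (simp only: True if_True)
  qed simp
  have "(\<Sum>k\<in>F. Re (?f k)) \<le> (\<Sum>k. Re (?f k))"
    by (rule sum_le_suminf[OF summable_Re[OF s] F(1)]) (use pos in auto)
  also have "\<dots> = Re (Poisson_sum I a z)"
    unfolding Poisson_sum_def by (rule sums_unique[OF sums_Re[OF summable_sums[OF s]], symmetric])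
  finally show ?thesis
    using Poisson_term_Re[OF _ z] F by (simp add: subset_iff cong: sum.cong)
qed

lemma Poisson_sum_nonneg: "z \<in> unit_disk \<Longrightarrow> 0 \<le> Re (Poisson_sum I a z)"
  using Poisson_sum_ge[of z "{}"] by simp

lemma Poisson_Har_pos: "(\<lambda>z. 1 + Re (Poisson_sum I a z)) \<in> Har_pos"
  by (rule Har_posI[of "\<lambda>z. 1 + Poisson_sum I a z"])
     (use Poisson_sum_nonneg in \<open>auto intro!: holomorphic_intros Poisson_sum_holomorphic add_pos_nonneg\<close>)

text \<open>In \<open>1 - \<rho>(z, a)\<^sup>2\<close> the numerator contains \<open>1 - |z|\<^sup>2\<close>, which is at most \<open>1 - |a z|\<^sup>2\<close>, and the latter is the
numerator of the kernel.\<close>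

lemma sum_one_minus_pseudo_dist_sq_le:
  assumes z: "z \<in> unit_disk" and F: "finite F" "F \<subseteq> I"
  shows "(\<Sum>k\<in>F. 1 - (pseudo_dist z (a k))\<^sup>2) \<le> Re (Poisson_sum I a z)"
proof -
  have "(\<Sum>k\<in>F. 1 - (pseudo_dist z (a k))\<^sup>2) \<le> (\<Sum>k\<in>F. (1 - (cmod (a k))\<^sup>2) * (1 - (cmod (cnj (a k) * z))\<^sup>2) / (cmod (1 - cnj (a k) * z))\<^sup>2)"
  proof (rule sum_mono)
    fix k assume "k \<in> F"
    then have a: "a k \<in> unit_disk" using F Blaschke_in_disk[OF B] by auto
    have "cmod (cnj (a k) * z) \<le> cmod z" using a by (simp add: norm_mult mult_left_le_one_le)
    then have "(cmod (cnj (a k) * z))\<^sup>2 \<le> (cmod z)\<^sup>2" by (intro power_mono) auto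
    then have "(1 - (cmod (a k))\<^sup>2) * (1 - (cmod z)\<^sup>2) \<le> (1 - (cmod (a k))\<^sup>2) * (1 - (cmod (cnj (a k) * z))\<^sup>2)"
      using one_minus_norm_sq_pos[OF a] by (intro mult_left_mono) auto
    then show "1 - (pseudo_dist z (a k))\<^sup>2 \<le> (1 - (cmod (a k))\<^sup>2) * (1 - (cmod (cnj (a k) * z))\<^sup>2) / (cmod (1 - cnj (a k) * z))\<^sup>2"
      unfolding one_minus_pseudo_dist_sq[OF z a] by (intro divide_right_mono) (auto simp: mult.commute)
  qed
  also have "\<dots> \<le> Re (Poisson_sum I a z)" by (rule Poisson_sum_ge[OF z F])
  finally show ?thesis .
qed

text \<open>For \<open>x\<close> between \<open>1/4\<close> and \<open>1\<close> one has \<open>- ln x \<le> 8 (1 - x\<^sup>2)\<close>, so the far zeros are controlled by the Poisson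
sum.\<close>

lemma prod_far_pseudo_dist_ge:
  assumes z: "z \<in> unit_disk" and F: "finite F" "F \<subseteq> I" "\<And>k. k \<in> F \<Longrightarrow> 1/4 \<le> pseudo_dist z (a k)"
  shows "exp (- (8 * Re (Poisson_sum I a z))) \<le> (\<Prod>k\<in>F. pseudo_dist z (a k))"
proof -
  have "(\<Sum>k\<in>F. - (8 * (1 - (pseudo_dist z (a k))\<^sup>2))) = - (8 * (\<Sum>k\<in>F. 1 - (pseudo_dist z (a k))\<^sup>2))"
    by (simp only: sum_negf sum_distrib_left[symmetric])
  then have "exp (- (8 * Re (Poisson_sum I a z))) \<le> exp (\<Sum>k\<in>F. - (8 * (1 - (pseudo_dist z (a k))\<^sup>2)))"
    using sum_one_minus_pseudo_dist_sq_le[OF z F(1,2)] by simp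
  also have "\<dots> = (\<Prod>k\<in>F. exp (- (8 * (1 - (pseudo_dist z (a k))\<^sup>2))))" using F(1) by (rule exp_sum)
  also have "\<dots> \<le> (\<Prod>k\<in>F. pseudo_dist z (a k))"
  proof (intro prod_mono conjI)
    fix k assume "k \<in> F"
    define x where "x = pseudo_dist z (a k)"
    have x: "1/4 \<le> x" "x < 1" using F \<open>k \<in> F\<close> pseudo_dist_less_1[OF z Blaschke_in_disk[OF B]] by (auto simp: x_def)
    have "ln (1 / x\<^sup>2) \<le> 1 / x\<^sup>2 - 1" using x by (intro ln_le_minus_one) auto
    also have "\<dots> = (1 - x\<^sup>2) / x\<^sup>2" using x by (simp add: field_simps)
    also have "\<dots> \<le> (1 - x\<^sup>2) / (1/4)\<^sup>2" using x by (intro divide_left_mono power_mono mult_pos_pos) (auto simp: abs_square_le_1)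
    also have "\<dots> = 16 * (1 - x\<^sup>2)" by (simp add: power2_eq_square)
    finally have "- (8 * (1 - x\<^sup>2)) \<le> ln x" using x by (simp add: ln_div ln_realpow)
    then have "exp (- (8 * (1 - x\<^sup>2))) \<le> exp (ln x)" by (simp only: exp_le_cancel_iff)
    also have "exp (ln x) = x" using x by simp
    finally show "exp (- (8 * (1 - (pseudo_dist z (a k))\<^sup>2))) \<le> pseudo_dist z (a k)" by (simp only: x_def)
  qed auto
  finally show ?thesis .
qed

end

section \<open>Separated sequences are interpolating\<close>

text \<open>This bounds below the modulus at \<open>a\<^sub>k\<close> of the Blaschke product without the factor of \<open>a\<^sub>k\<close>; the formulation
by finite partial products avoids convergence questions and zeros of the logarithm.\<close>

definition Nevanlinna_separated :: "nat set \<Rightarrow> (nat \<Rightarrow> complex) \<Rightarrow> (complex \<Rightarrow> real) \<Rightarrow> bool" where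
  "Nevanlinna_separated I a H \<longleftrightarrow>
     (\<forall>k\<in>I. \<forall>F. finite F \<longrightarrow> F \<subseteq> I - {k} \<longrightarrow> exp (- H (a k)) \<le> (\<Prod>l\<in>F. pseudo_dist (a k) (a l)))"

lemma log_plus_le:
  assumes "0 \<le> x" "0 \<le> y" "r \<le> exp x * y" shows "log_plus r \<le> x + y"
proof -
  have "y \<le> exp y" using exp_ge_add_one_self[of y] by linarith
  then have "r \<le> exp (x + y)" using assms(3) by (simp add: exp_add) (meson mult_left_mono exp_ge_zero order_trans)
  then have "ln (max 1 r) \<le> ln (exp (x + y))" using assms by (intro ln_mono) auto
  then show ?thesis by (simp add: log_plus_def)
qed

lemma le_exp_log_plus: "x \<le> exp (log_plus x)"
  by (simp add: log_plus_def)

lemma log_plus_nonneg: "0 \<le> log_plus x"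
  by (simp add: log_plus_def)

text \<open>Let \<open>B\<^sub>k\<close> be the Blaschke product without the factor of \<open>a\<^sub>k\<close>, and \<open>h\<close> holomorphic with real part the sum of
the majorant of the data and the separation function. The interpolating function is \<open>exp h\<close> times the sum
of \<open>\<gamma>\<^sub>k B\<^sub>k(z)\<close> times the square of the normalised Szego kernel at \<open>a\<^sub>k\<close>, with \<open>\<gamma>\<^sub>k\<close> chosen to match the
data. The choice of \<open>h\<close> makes \<open>|\<gamma>\<^sub>k| \<le> 1\<close>. The squared kernels then sum to at most the Poisson sum of the
sequence, which is itself harmonic; since \<open>x \<le> exp x\<close>, this suffices for the Nevanlinna class.\<close>

theorem separated_imp_interpolating:
  assumes B: "Blaschke_condition I a" and inj: "inj_on a I"
    and H: "H \<in> Har_pos" and sep: "Nevanlinna_separated I a H"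
  shows "Nevanlinna_interpolating I a"
  unfolding Nevanlinna_interpolating_def
proof (intro conjI ballI)
  show "a ` I \<subseteq> unit_disk" using Blaschke_in_disk[OF B] by auto
  show "inj_on a I" by fact
  note aD = Blaschke_in_disk[OF B]
  fix w assume "w \<in> Nevanlinna_data I a"
  then obtain K where K: "K \<in> Har_pos" "\<And>k. k \<in> I \<Longrightarrow> log_plus (cmod (w k)) \<le> K (a k)"
    unfolding Nevanlinna_data_def by auto
  obtain h where h: "h holomorphic_on unit_disk" "\<And>z. z \<in> unit_disk \<Longrightarrow> H z + K z = Re (h z)"
     "\<And>z. z \<in> unit_disk \<Longrightarrow> 0 < Re (h z)"
    using Har_pos_add[OF H K(1)] unfolding Har_pos_iff by auto
  define b where "b k = Blaschke_product (I - {k}) a" for k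
  have BJ: "Blaschke_condition (I - {k}) a" for k using Blaschke_condition_mono[OF B] by auto
  have b_hol: "b k holomorphic_on unit_disk" for k
    unfolding b_def by (rule Blaschke_product_holomorphic[OF BJ])
  have b_le: "cmod (b k z) \<le> 1" if "z \<in> unit_disk" for k z
    unfolding b_def by (rule cmod_Blaschke_product_le_1[OF BJ that])
  have b_ge: "exp (- H (a k)) \<le> cmod (b k (a k))" if "k \<in> I" for k
    unfolding b_def by (rule cmod_Blaschke_product_ge[OF BJ aD[OF that]])
       (use sep that in \<open>auto simp: Nevanlinna_separated_def\<close>)
  have b_nz: "b k (a k) \<noteq> 0" if "k \<in> I" for k
    using b_ge[OF that] exp_gt_zero[of "- H (a k)"] by auto
  have b_0: "b k (a l) = 0" if "k \<in> I" "l \<in> I" "k \<noteq> l" for k l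
    unfolding b_def Blaschke_product_eq_0_iff[OF BJ aD[OF that(2)]] using that by auto
  define \<gamma> where "\<gamma> k = w k * exp (- h (a k)) / b k (a k)" for k
  have \<gamma>: "cmod (\<gamma> k) \<le> 1" if "k \<in> I" for k
  proof -
    have "cmod (w k) \<le> exp (K (a k))"
      using le_exp_log_plus[of "cmod (w k)"] K(2)[OF that] by (meson exp_le_cancel_iff order_trans)
    then have "cmod (\<gamma> k) \<le> exp (K (a k)) * exp (- (H (a k) + K (a k))) / exp (- H (a k))"
      unfolding \<gamma>_def norm_mult norm_divide norm_exp_eq_Re
      using b_ge[OF that] h(2)[OF aD[OF that]] by (intro frac_le mult_mono) auto
    also have "\<dots> = 1" by (simp only: exp_add[symmetric] exp_diff[symmetric]) simp
    finally show ?thesis .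
  qed
  define t where "t k z = (if k \<in> I then \<gamma> k * b k z * (of_real (1 - (cmod (a k))\<^sup>2) / (1 - cnj (a k) * z))\<^sup>2 else 0)" for k z
  have t_le: "cmod (t k z) \<le> (1 - (cmod (a k))\<^sup>2)\<^sup>2 / (cmod (1 - cnj (a k) * z))\<^sup>2" if "k \<in> I" "z \<in> unit_disk" for k z
  proof -
    have "cmod (t k z) = cmod (\<gamma> k) * cmod (b k z) * ((1 - (cmod (a k))\<^sup>2)\<^sup>2 / (cmod (1 - cnj (a k) * z))\<^sup>2)"
      using that by (simp add: t_def norm_mult norm_power norm_divide power_divide del: of_real_diff)
    also have "\<dots> \<le> 1 * 1 * ((1 - (cmod (a k))\<^sup>2)\<^sup>2 / (cmod (1 - cnj (a k) * z))\<^sup>2)"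
      using \<gamma>[OF that(1)] b_le[OF that(2)] by (intro mult_right_mono mult_mono) auto
    finally show ?thesis by simp
  qed
  have t_hol: "t k holomorphic_on unit_disk" for k
  proof (cases "k \<in> I")
    case True
    show ?thesis unfolding t_def[abs_def] using True disk_denom_nonzero[OF _ aD[OF True]]
      by (auto intro!: holomorphic_intros b_hol)
  next
    case False
    then show ?thesis unfolding t_def[abs_def] by simp
  qed
  have t_bd: "\<exists>C. \<forall>k z. cmod z \<le> r \<longrightarrow> cmod (t k z) \<le> C * (if k \<in> I then 1 - cmod (a k) else 0)" if r: "0 \<le> r" "r < 1" for r
  proof (intro exI allI impI)
    fix k and z :: complex assume z: "cmod z \<le> r"
    show "cmod (t k z) \<le> 4 / (1 - r)\<^sup>2 * (if k \<in> I then 1 - cmod (a k) else 0)"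
    proof (cases "k \<in> I")
      case True
      have a: "cmod (a k) < 1" using aD[OF True] by simp
      have l: "cmod (cnj (a k) * z) \<le> r" using a z mult_left_le_one_le[of "cmod z" "cmod (a k)"] by (simp add: norm_mult)
      have "1 - (cmod (a k))\<^sup>2 = (1 + cmod (a k)) * (1 - cmod (a k))" by (simp add: power2_eq_square algebra_simps)
      also have "\<dots> \<le> 2 * (1 - cmod (a k))" using a by (intro mult_right_mono) auto
      finally have "(1 - (cmod (a k))\<^sup>2)\<^sup>2 \<le> (2 * (1 - cmod (a k)))\<^sup>2"
        using one_minus_norm_sq_pos[OF aD[OF True]] by (intro power_mono) auto
      also have "\<dots> \<le> 4 * (1 - cmod (a k))"
      proof -
        have "(1 - cmod (a k)) * (1 - cmod (a k)) \<le> 1 * (1 - cmod (a k))"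
          using a by (intro mult_right_mono) auto
        then show ?thesis unfolding power_mult_distrib power2_eq_square[of "1 - cmod (a k)"] by simp
      qed
      finally have 1: "(1 - (cmod (a k))\<^sup>2)\<^sup>2 \<le> 4 * (1 - cmod (a k))" .
      have "cmod (t k z) \<le> (1 - (cmod (a k))\<^sup>2)\<^sup>2 / (cmod (1 - cnj (a k) * z))\<^sup>2"
        by (rule t_le[OF True]) (use z r in auto)
      also have "\<dots> \<le> 4 * (1 - cmod (a k)) / (1 - r)\<^sup>2"
        using norm_triangle_ineq2[of 1 "cnj (a k) * z"] l r a 1 by (intro frac_le power_mono) auto
      finally show ?thesis using True by simp
    qed (simp add: t_def)
  qed
  define f where "f z = exp (h z) * (\<Sum>k. t k z)" for z
  note ts = holomorphic_suminf_disk[OF t_hol Blaschke_summable[OF B] t_bd]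
  have f_hol: "f holomorphic_on unit_disk"
    unfolding f_def[abs_def] by (intro holomorphic_intros h ts(1))
  show "\<exists>f\<in>Nevanlinna_class. \<forall>k\<in>I. f (a k) = w k"
  proof (intro bexI[of _ f] ballI)
    fix k assume k: "k \<in> I"
    have "(\<Sum>j. t j (a k)) = (\<Sum>j\<in>{k}. t j (a k))"
      by (rule suminf_finite) (use b_0 k in \<open>auto simp: t_def\<close>)
    also have "\<dots> = \<gamma> k * b k (a k)"
    proof -
      have "1 - cnj (a k) * a k = of_real (1 - (cmod (a k))\<^sup>2)"
        by (simp add: mult.commute[of "cnj (a k)"] flip: complex_norm_square)
      moreover have "1 - cnj (a k) * a k \<noteq> 0" by (rule disk_denom_nonzero[OF aD[OF k] aD[OF k]])
      ultimately have "of_real (1 - (cmod (a k))\<^sup>2) / (1 - cnj (a k) * a k) = 1" by (metis divide_self)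
      then show ?thesis using k by (simp add: t_def del: of_real_diff)
    qed
    also have "\<dots> = w k * exp (- h (a k))" using b_nz[OF k] by (simp add: \<gamma>_def)
    finally show "f (a k) = w k" by (simp add: f_def exp_minus field_simps)
  next
    show "f \<in> Nevanlinna_class"
      unfolding Nevanlinna_class_def
    proof (intro CollectI conjI f_hol exI ballI)
      show "harmonic_on (\<lambda>z. Re (h z) + Re (Poisson_sum I a z)) unit_disk"
        unfolding harmonic_on_disk_iff
        by (intro exI[of _ "\<lambda>z. h z + Poisson_sum I a z"]) (auto intro!: holomorphic_intros h Poisson_sum_holomorphic[OF B])
      fix z assume z: "z \<in> unit_disk"
      have "cmod (\<Sum>k. t k z) \<le> Re (Poisson_sum I a z)"
      proof (rule LIMSEQ_le_const2[OF tendsto_norm[OF summable_LIMSEQ[OF summable_norm_cancel[OF ts(2)[OF _ _ z]]]]])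
        show "\<exists>N. \<forall>n\<ge>N. cmod (\<Sum>k<n. t k z) \<le> Re (Poisson_sum I a z)"
        proof (intro exI allI impI)
          fix n :: nat
          have "cmod (\<Sum>k<n. t k z) \<le> (\<Sum>k<n. cmod (t k z))" by (rule norm_sum)
          also have "\<dots> = (\<Sum>k\<in>I \<inter> {..<n}. cmod (t k z))"
            by (rule sum.mono_neutral_right) (auto simp: t_def)
          also have "\<dots> \<le> (\<Sum>k\<in>I \<inter> {..<n}. (1 - (cmod (a k))\<^sup>2) * (1 - (cmod (cnj (a k) * z))\<^sup>2) / (cmod (1 - cnj (a k) * z))\<^sup>2)"
          proof (rule sum_mono)
            fix k assume "k \<in> I \<inter> {..<n}"
            then have k: "k \<in> I" by simp
            have "cmod (cnj (a k) * z) \<le> cmod (a k)" using z by (simp add: norm_mult mult_left_le)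
            then have "(cmod (cnj (a k) * z))\<^sup>2 \<le> (cmod (a k))\<^sup>2" by (intro power_mono) auto
            then have "(1 - (cmod (a k))\<^sup>2)\<^sup>2 \<le> (1 - (cmod (a k))\<^sup>2) * (1 - (cmod (cnj (a k) * z))\<^sup>2)"
              using one_minus_norm_sq_pos[OF aD[OF k]] unfolding power2_eq_square[of "1 - (cmod (a k))\<^sup>2"] by (intro mult_left_mono) auto
            then have "(1 - (cmod (a k))\<^sup>2)\<^sup>2 / (cmod (1 - cnj (a k) * z))\<^sup>2 \<le> (1 - (cmod (a k))\<^sup>2) * (1 - (cmod (cnj (a k) * z))\<^sup>2) / (cmod (1 - cnj (a k) * z))\<^sup>2"
              by (rule divide_right_mono) simp
            with t_le[OF k z] show "cmod (t k z) \<le> (1 - (cmod (a k))\<^sup>2) * (1 - (cmod (cnj (a k) * z))\<^sup>2) / (cmod (1 - cnj (a k) * z))\<^sup>2"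
              by (rule order_trans)
          qed
          also have "\<dots> \<le> Re (Poisson_sum I a z)" by (rule Poisson_sum_ge[OF B z]) auto
          finally show "cmod (\<Sum>k<n. t k z) \<le> Re (Poisson_sum I a z)" .
        qed
      qed
      then have "cmod (f z) \<le> exp (Re (h z)) * Re (Poisson_sum I a z)"
        by (simp add: f_def norm_mult)
      then show "log_plus (cmod (f z)) \<le> Re (h z) + Re (Poisson_sum I a z)"
        by (intro log_plus_le Poisson_sum_nonneg[OF B z] less_imp_le[OF h(3)[OF z]])
    qed
  qed
qed

section \<open>Interpolating sequences are separated\<close>

definition log_pseudo_dist :: "(nat \<Rightarrow> complex) \<Rightarrow> nat \<Rightarrow> nat \<Rightarrow> real" where
  "log_pseudo_dist a k l = - ln (pseudo_dist (a k) (a l))"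

lemma exp_sum_log_pseudo_dist:
  assumes "inj_on a I" "a ` I \<subseteq> unit_disk" "k \<in> I" "F \<subseteq> I - {k}" "finite F"
  shows "exp (- (\<Sum>l\<in>F. log_pseudo_dist a k l)) = (\<Prod>l\<in>F. pseudo_dist (a k) (a l))"
proof -
  have "0 < pseudo_dist (a k) (a l)" if "l \<in> F" for l
  proof -
    have "l \<in> I" "l \<noteq> k" using assms(4) that by auto
    then have "a k \<noteq> a l" "a k \<in> unit_disk" "a l \<in> unit_disk" using assms(1-3) by (auto dest: inj_onD)
    then show ?thesis using pseudo_dist_eq_0_iff[of "a k" "a l"] pseudo_dist_nonneg[of "a k" "a l"] by linarith
  qed
  then show ?thesis using assms(5)
    by (simp add: log_pseudo_dist_def sum_negf exp_sum)
qed

lemma log_pseudo_dist_nonneg: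
  assumes "a k \<in> unit_disk" "a l \<in> unit_disk" shows "0 \<le> log_pseudo_dist a k l"
proof (cases "pseudo_dist (a k) (a l) = 0")
  case False
  then have "0 < pseudo_dist (a k) (a l)" using pseudo_dist_nonneg[of "a k" "a l"] by linarith
  then show ?thesis using pseudo_dist_less_1[OF assms] by (simp add: log_pseudo_dist_def)
qed (simp add: log_pseudo_dist_def)

text \<open>Interpolate the value \<open>1\<close> on \<open>T\<close> and \<open>0\<close> off \<open>T\<close> by \<open>f\<close>. Dividing by \<open>exp h\<close>, where \<open>Re h\<close> majorises
\<open>ln |f|\<close>, leaves a function bounded by \<open>1\<close> to which Schwarz-Pick applies. Thus every partition of the
sequence into two parts gives a harmonic bound for the sums across the partition.\<close>

lemma interpolating_imp_partition_bound:
  assumes NI: "Nevanlinna_interpolating I a" and T: "T \<subseteq> I"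
  obtains u where "u \<in> Har_pos"
    "\<And>k F. k \<in> T \<Longrightarrow> finite F \<Longrightarrow> F \<subseteq> I - T \<Longrightarrow> (\<Sum>l\<in>F. log_pseudo_dist a k l) \<le> u (a k)"
proof -
  have aD: "a ` I \<subseteq> unit_disk" and inj: "inj_on a I"
    using NI by (auto simp: Nevanlinna_interpolating_def)
  define w :: "nat \<Rightarrow> complex" where "w k = (if k \<in> T then 1 else 0)" for k
  have "w \<in> Nevanlinna_data I a"
    unfolding Nevanlinna_data_def
    by (intro CollectI bexI[OF _ Har_pos_const[of 1]]) (auto simp: w_def log_plus_def)
  then obtain f where f: "f \<in> Nevanlinna_class" "\<And>k. k \<in> I \<Longrightarrow> f (a k) = w k"
    using NI unfolding Nevanlinna_interpolating_def by blast
  then obtain u0 where f_hol: "f holomorphic_on unit_disk" and u0: "harmonic_on u0 unit_disk"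
      "\<And>z. z \<in> unit_disk \<Longrightarrow> log_plus (cmod (f z)) \<le> u0 z"
    unfolding Nevanlinna_class_def by blast
  obtain h where h: "h holomorphic_on unit_disk" "\<And>z. z \<in> unit_disk \<Longrightarrow> u0 z = Re (h z)"
    using u0(1) unfolding harmonic_on_disk_iff by blast
  have pos: "0 \<le> Re (h z)" if "z \<in> unit_disk" for z
    using log_plus_nonneg[of "cmod (f z)"] u0(2)[OF that] h(2)[OF that] by linarith
  define g where "g z = f z * exp (- h z)" for z
  have g_hol: "g holomorphic_on unit_disk"
    unfolding g_def[abs_def] by (intro holomorphic_intros f_hol h)
  have g_le: "cmod (g z) \<le> 1" if z: "z \<in> unit_disk" for z
  proof -
    have "cmod (f z) \<le> exp (Re (h z))"
      using le_exp_log_plus[of "cmod (f z)"] u0(2)[OF z] h(2)[OF z] by (metis exp_le_cancel_iff order_trans)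
    then have "cmod (f z) * exp (- Re (h z)) \<le> exp (Re (h z)) * exp (- Re (h z))" by (intro mult_right_mono) auto
    then show ?thesis by (simp add: g_def norm_mult norm_exp_eq_Re flip: exp_add)
  qed
  show ?thesis
  proof (rule that)
    show "(\<lambda>z. Re (h z) + 1) \<in> Har_pos"
      by (rule Har_posI[of "\<lambda>z. h z + 1"]) (use pos in \<open>auto intro!: holomorphic_intros h(1) add_nonneg_pos\<close>)
    fix k F assume k: "k \<in> T" and F: "finite F" "F \<subseteq> I - T"
    have kI: "k \<in> I" using k T by auto
    have akD: "a k \<in> unit_disk" using kI aD by auto
    have "cmod (g (a k)) \<le> 1 * (\<Prod>b\<in>a ` F. pseudo_dist (a k) b)"
      by (rule Schwarz_Pick_finite[OF _ _ g_hol _ g_le akD]) (use F aD f(2) in \<open>auto simp: g_def w_def\<close>)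
    also have "(\<Prod>b\<in>a ` F. pseudo_dist (a k) b) = (\<Prod>l\<in>F. pseudo_dist (a k) (a l))"
      using inj_on_subset[OF inj, of F] F by (subst prod.reindex) auto
    also have "\<dots> = exp (- (\<Sum>l\<in>F. log_pseudo_dist a k l))"
      by (rule exp_sum_log_pseudo_dist[symmetric, OF inj aD kI]) (use F k in auto)
    also have "cmod (g (a k)) = exp (- Re (h (a k)))"
      using f(2)[OF kI] k by (simp add: g_def w_def)
    finally show "(\<Sum>l\<in>F. log_pseudo_dist a k l) \<le> Re (h (a k)) + 1" by simp
  qed
qed

text \<open>A Baire category argument in the space of subsets of the naturals, done by hand as a gliding hump: if no
bound \<open>M\<close> worked on any cylinder, one could extend finite initial segments successively to violate the
bounds \<open>0, 1, 2, \<dots>\<close>, and the set obtained in the limit would have no bound at all. The condition at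
stage \<open>n\<close> sees only the part of the set below \<open>n\<close>, so it is inherited by the limit.\<close>

lemma uniform_on_cylinder:
  fixes Q :: "nat \<Rightarrow> nat \<Rightarrow> nat set \<Rightarrow> bool"
  assumes mono: "\<And>M M' n n' T. Q M n T \<Longrightarrow> M \<le> M' \<Longrightarrow> n' \<le> n \<Longrightarrow> Q M' n' T"
    and dep: "\<And>M n T T'. T \<inter> {..<n} = T' \<inter> {..<n} \<Longrightarrow> Q M n T \<Longrightarrow> Q M n T'"
    and all: "\<And>T. \<exists>M. \<forall>n. Q M n T"
  obtains M m T0 where "\<And>T n. T \<inter> {..<m} = T0 \<inter> {..<m} \<Longrightarrow> Q M n T"
proof -
  have "\<exists>M m T0. \<forall>T n. T \<inter> {..<m} = T0 \<inter> {..<m} \<longrightarrow> Q M n T"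
  proof (rule ccontr)
    assume contr: "\<not> ?thesis"
    have ex: "\<exists>p. fst p \<inter> {..<m} = T0 \<inter> {..<m} \<and> \<not> Q M (snd p) (fst p)" for M m T0
    proof (rule ccontr)
      assume no: "\<not> ?thesis"
      have "Q M n T" if "T \<inter> {..<m} = T0 \<inter> {..<m}" for T n
      proof (rule ccontr)
        assume "\<not> Q M n T"
        then have "\<exists>p. fst p \<inter> {..<m} = T0 \<inter> {..<m} \<and> \<not> Q M (snd p) (fst p)"
          using that by (intro exI[of _ "(T, n)"]) simp
        then show False using no by contradiction
      qed
      then have "\<forall>T n. T \<inter> {..<m} = T0 \<inter> {..<m} \<longrightarrow> Q M n T" by (intro allI impI)
      then have "\<exists>M m T0. \<forall>T n. T \<inter> {..<m} = T0 \<inter> {..<m} \<longrightarrow> Q M n T" by (intro exI)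
      then show False using contr by contradiction
    qed
    define \<pi> where "\<pi> M m T0 = (SOME p. fst p \<inter> {..<m} = T0 \<inter> {..<m} \<and> \<not> Q M (snd p) (fst p))" for M m T0
    define \<tau> \<nu> where "\<tau> M m T0 = fst (\<pi> M m T0)" and "\<nu> M m T0 = snd (\<pi> M m T0)" for M m T0
    have \<tau>: "\<tau> M m T0 \<inter> {..<m} = T0 \<inter> {..<m}" "\<not> Q M (\<nu> M m T0) (\<tau> M m T0)" for M m T0
      unfolding \<tau>_def \<nu>_def \<pi>_def by (rule conjunct1[OF someI_ex[OF ex]], rule conjunct2[OF someI_ex[OF ex]])
    define s where "s = rec_nat ({}::nat set, 0::nat) (\<lambda>i p. (\<tau> i (snd p) (fst p), max (\<nu> i (snd p) (fst p)) (Suc (snd p))))"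
    define S m where "S i = fst (s i)" and "m i = snd (s i)" for i
    have S_Suc: "S (Suc i) = \<tau> i (m i) (S i)" and m_Suc: "m (Suc i) = max (\<nu> i (m i) (S i)) (Suc (m i))" for i
      by (simp_all add: S_def m_def s_def)
    have notQ: "\<not> Q i (m (Suc i)) (S (Suc i))" for i
      using \<tau>(2)[of i "m i" "S i"] mono[of i "m (Suc i)" "S (Suc i)" i "\<nu> i (m i) (S i)"] by (auto simp: S_Suc m_Suc)
    have m_less: "m i < m (Suc i)" for i by (simp add: m_Suc)
    have m_mono: "m i \<le> m j" if "i \<le> j" for i j
      using lift_Suc_mono_le[of m] m_less that by (simp add: less_imp_le)
    have m_ge: "i \<le> m i" for i
      by (induction i) (use m_less in \<open>auto simp: Suc_le_eq intro: le_less_trans\<close>)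
    have stable: "S j \<inter> {..<m i} = S i \<inter> {..<m i}" if "i \<le> j" for i j
      using that
    proof (induction j rule: dec_induct)
      case (step j)
      have "S (Suc j) \<inter> {..<m j} = S j \<inter> {..<m j}" unfolding S_Suc by (rule \<tau>(1))
      then have "S (Suc j) \<inter> {..<m j} \<inter> {..<m i} = S j \<inter> {..<m j} \<inter> {..<m i}" by (rule arg_cong)
      moreover have "{..<m j} \<inter> {..<m i} = {..<m i}" using m_mono[OF step(1)] by auto
      ultimately have "S (Suc j) \<inter> {..<m i} = S j \<inter> {..<m i}" unfolding Int_assoc by simp
      then show ?case using step(3) by (rule trans)
    qed simp
    define T where "T = {x. x \<in> S (Suc x)}"
    have T: "T \<inter> {..<m i} = S i \<inter> {..<m i}" for i
    proof (intro set_eqI)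
      fix x
      have "x < m (Suc x)" using m_ge[of "Suc x"] by simp
      then have "x < m i \<Longrightarrow> x \<in> S (Suc x) \<longleftrightarrow> x \<in> S i"
        using stable[of i "Suc x"] stable[of "Suc x" i] by (cases "i \<le> Suc x") (auto simp: set_eq_iff)
      then show "x \<in> T \<inter> {..<m i} \<longleftrightarrow> x \<in> S i \<inter> {..<m i}" by (auto simp: T_def)
    qed
    obtain M where "Q M (m (Suc M)) T" using all[of T] by blast
    then have "Q M (m (Suc M)) (S (Suc M))" by (rule dep[OF T])
    then show False using notQ by blast
  qed
  then show ?thesis using that by blast
qed

lemma card_subsets_separating:
  assumes "finite J" "k \<in> J" "l \<in> J" "k \<noteq> l"
  shows "4 * card {S \<in> Pow J. k \<in> S \<and> l \<notin> S} = 2 ^ card J"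
proof -
  have "{S \<in> Pow J. k \<in> S \<and> l \<notin> S} = insert k ` Pow (J - {k, l})"
  proof (intro set_eqI iffI)
    fix S assume "S \<in> {S \<in> Pow J. k \<in> S \<and> l \<notin> S}"
    then show "S \<in> insert k ` Pow (J - {k, l})" by (intro image_eqI[of _ _ "S - {k}"]) auto
  qed (use assms in auto)
  moreover have "inj_on (insert k) (Pow (J - {k, l}))" by (rule inj_onI) (auto simp: set_eq_iff)
  ultimately have "card {S \<in> Pow J. k \<in> S \<and> l \<notin> S} = 2 ^ card (J - {k, l})"
    using assms(1) by (simp add: card_image card_Pow)
  moreover have "card J = Suc (Suc (card (J - {k, l})))"
    using assms card_Suc_Diff1[of J k] card_Suc_Diff1[of "J - {k}" l] by (simp add: Diff_insert2[symmetric] insert_commute)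
  ultimately show ?thesis by simp
qed

text \<open>A quarter of all subsets of \<open>J\<close> contain \<open>k\<close> but not \<open>l\<close>. Averaging the bounds across partitions therefore
bounds the full sum over \<open>l \<noteq> k\<close>, at the price of a factor \<open>4\<close>.\<close>

lemma average_over_partitions:
  fixes L :: "nat \<Rightarrow> nat \<Rightarrow> real" and v :: "nat set \<Rightarrow> real"
  assumes J: "finite J" "k \<in> J"
    and v: "\<And>S. S \<subseteq> J \<Longrightarrow> 0 \<le> v S" "\<And>S. S \<subseteq> J \<Longrightarrow> k \<in> S \<Longrightarrow> (\<Sum>l\<in>J - S. L k l) \<le> v S"
  shows "2 ^ card J * (\<Sum>l\<in>J - {k}. L k l) \<le> 4 * (\<Sum>S\<in>Pow J. v S)"
proof -
  have "2 ^ card J * (\<Sum>l\<in>J - {k}. L k l) = (\<Sum>l\<in>J - {k}. 4 * real (card {S \<in> Pow J. k \<in> S \<and> l \<notin> S}) * L k l)"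
    unfolding sum_distrib_left
  proof (intro sum.cong refl)
    fix l assume "l \<in> J - {k}"
    then have "real (4 * card {S \<in> Pow J. k \<in> S \<and> l \<notin> S}) = real (2 ^ card J)"
      using card_subsets_separating[OF J, of l] by auto
    then show "2 ^ card J * L k l = 4 * real (card {S \<in> Pow J. k \<in> S \<and> l \<notin> S}) * L k l" by simp
  qed
  also have "\<dots> = 4 * (\<Sum>l\<in>J - {k}. \<Sum>S\<in>{S \<in> Pow J. k \<in> S \<and> l \<notin> S}. L k l)"
    by (simp add: sum_distrib_left mult_ac)
  also have "(\<Sum>l\<in>J - {k}. \<Sum>S\<in>{S \<in> Pow J. k \<in> S \<and> l \<notin> S}. L k l)
      = (\<Sum>l\<in>J - {k}. \<Sum>S\<in>Pow J. if k \<in> S \<and> l \<notin> S then L k l else 0)"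
    using J by (intro sum.cong[OF refl] sum.inter_filter) auto
  also have "\<dots> = (\<Sum>S\<in>Pow J. \<Sum>l\<in>J - {k}. if k \<in> S \<and> l \<notin> S then L k l else 0)"
    by (rule sum.swap)
  also have "\<dots> \<le> (\<Sum>S\<in>Pow J. v S)"
  proof (rule sum_mono)
    fix S assume S: "S \<in> Pow J"
    show "(\<Sum>l\<in>J - {k}. if k \<in> S \<and> l \<notin> S then L k l else 0) \<le> v S"
    proof (cases "k \<in> S")
      case True
      have "(\<Sum>l\<in>J - {k}. if k \<in> S \<and> l \<notin> S then L k l else 0) = (\<Sum>l\<in>J - S. L k l)"
        using True J(1) by (intro sum.mono_neutral_cong_right) auto
      then show ?thesis using v(2)[of S] S True by simp
    qed (use v(1) S in simp)
  qed
  finally show ?thesis by simp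
qed

text \<open>Each partition has its own harmonic bound. By the Baire argument the values of these bounds at \<open>0\<close> are
uniformly bounded on some cylinder, that is, once the membership of finitely many indices is prescribed.
The average of the bounds over all partitions of a finite segment is harmonic and dominates a quarter of the
sum over that segment; by compactness these averages converge along a subsequence. The finitely many
prescribed indices are treated by the partitions that single out one index.\<close>

theorem interpolating_imp_separated:
  assumes NI: "Nevanlinna_interpolating I a"
  obtains H where "H \<in> Har_pos" "Nevanlinna_separated I a H"
proof -
  have aD: "a ` I \<subseteq> unit_disk" and inj: "inj_on a I"
    using NI by (auto simp: Nevanlinna_interpolating_def)
  have aD': "k \<in> I \<Longrightarrow> a k \<in> unit_disk" for k using aD by auto
  let ?L = "log_pseudo_dist a"
  have L0: "0 \<le> ?L k l" if "k \<in> I" "l \<in> I" for k l using log_pseudo_dist_nonneg aD' that by blast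
  define Q where "Q M n T \<longleftrightarrow> (\<exists>u\<in>Har_pos. u 0 \<le> real M \<and>
     (\<forall>k\<in>I \<inter> T \<inter> {..<n}. (\<Sum>l\<in>(I - T) \<inter> {..<n}. ?L k l) \<le> u (a k)))" for M n T
  obtain M m T0 where MT: "\<And>T n. T \<inter> {..<m} = T0 \<inter> {..<m} \<Longrightarrow> Q M n T"
  proof (rule uniform_on_cylinder[of Q])
    fix M M' n n' T assume "Q M n T" and le: "M \<le> M'" "n' \<le> n"
    then obtain u where u: "u \<in> Har_pos" "u 0 \<le> real M"
        "\<And>k. k \<in> I \<inter> T \<inter> {..<n} \<Longrightarrow> (\<Sum>l\<in>(I - T) \<inter> {..<n}. ?L k l) \<le> u (a k)"
      unfolding Q_def by blast
    show "Q M' n' T" unfolding Q_def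
    proof (intro bexI[OF _ u(1)] conjI ballI)
      show "u 0 \<le> real M'" using u(2) le by linarith
      fix k assume k: "k \<in> I \<inter> T \<inter> {..<n'}"
      have "(\<Sum>l\<in>(I - T) \<inter> {..<n'}. ?L k l) \<le> (\<Sum>l\<in>(I - T) \<inter> {..<n}. ?L k l)"
        using le k L0 by (intro sum_mono2) auto
      also have "\<dots> \<le> u (a k)" using u(3) k le by auto
      finally show "(\<Sum>l\<in>(I - T) \<inter> {..<n'}. ?L k l) \<le> u (a k)" .
    qed
  next
    fix M n and T T' :: "nat set" assume T: "T \<inter> {..<n} = T' \<inter> {..<n}" and "Q M n T"
    have "I \<inter> T \<inter> {..<n} = I \<inter> T' \<inter> {..<n}" "(I - T) \<inter> {..<n} = (I - T') \<inter> {..<n}" using T by blast+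
    then show "Q M n T'" using \<open>Q M n T\<close> unfolding Q_def by simp
  next
    fix T
    obtain u where u: "u \<in> Har_pos"
      "\<And>k F. k \<in> I \<inter> T \<Longrightarrow> finite F \<Longrightarrow> F \<subseteq> I - (I \<inter> T) \<Longrightarrow> (\<Sum>l\<in>F. ?L k l) \<le> u (a k)"
      using interpolating_imp_partition_bound[OF NI, of "I \<inter> T"] by auto
    obtain M where "u 0 \<le> real M" using real_arch_simple by blast
    then show "\<exists>M. \<forall>n. Q M n T"
      unfolding Q_def by (intro exI[of _ M] allI bexI[OF _ u(1)] conjI ballI u(2)) auto
  qed blast
  \<comment> \<open>The membership of the indices below \<open>m\<close> is prescribed by \<open>T0\<close>; only \<open>J n\<close> is partitioned freely.\<close>
  define J where "J n = I \<inter> {m..<n}" for n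
  have J: "finite (J n)" for n by (simp add: J_def)
  have "\<exists>U\<in>Har_pos. U 0 \<le> real M + 1 \<and> (\<forall>k\<in>J n. (\<Sum>l\<in>J n - {k}. ?L k l) \<le> 4 * U (a k))" for n
  proof -
    have "\<exists>u\<in>Har_pos. u 0 \<le> real M \<and> (\<forall>k\<in>S. (\<Sum>l\<in>J n - S. ?L k l) \<le> u (a k))" if S: "S \<subseteq> J n" for S
    proof -
      define T where "T = (T0 \<inter> {..<m}) \<union> S"
      have "T \<inter> {..<m} = T0 \<inter> {..<m}" using S by (auto simp: T_def J_def)
      then have "Q M n T" by (rule MT)
      then obtain u where u: "u \<in> Har_pos" "u 0 \<le> real M"
        "\<And>k. k \<in> I \<inter> T \<inter> {..<n} \<Longrightarrow> (\<Sum>l\<in>(I - T) \<inter> {..<n}. ?L k l) \<le> u (a k)"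
        unfolding Q_def by blast
      show ?thesis
      proof (intro bexI[OF _ u(1)] conjI u(2) ballI)
        fix k assume k: "k \<in> S"
        have "(\<Sum>l\<in>J n - S. ?L k l) \<le> (\<Sum>l\<in>(I - T) \<inter> {..<n}. ?L k l)"
          using S k L0 by (intro sum_mono2) (auto simp: T_def J_def)
        also have "\<dots> \<le> u (a k)" using S k by (intro u(3)) (auto simp: T_def J_def)
        finally show "(\<Sum>l\<in>J n - S. ?L k l) \<le> u (a k)" .
      qed
    qed
    then obtain u where u: "\<And>S. S \<subseteq> J n \<Longrightarrow> u S \<in> Har_pos" "\<And>S. S \<subseteq> J n \<Longrightarrow> u S 0 \<le> real M"
      "\<And>S k. S \<subseteq> J n \<Longrightarrow> k \<in> S \<Longrightarrow> (\<Sum>l\<in>J n - S. ?L k l) \<le> u S (a k)"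
      by metis
    define c :: real where "c = 2 ^ card (J n)"
    have c: "c > 0" by (simp add: c_def)
    have card: "real (card (Pow (J n))) = c" using J by (simp add: c_def card_Pow)
    define U where "U z = (1 / c) * (c + (\<Sum>S\<in>Pow (J n). u S z))" for z
    show ?thesis
    proof (intro bexI[of _ U] conjI ballI)
      show "U \<in> Har_pos"
        unfolding U_def[abs_def] by (intro Har_pos_scale Har_pos_sum) (use J u c in auto)
      have "(\<Sum>S\<in>Pow (J n). u S 0) \<le> c * real M"
        using sum_bounded_above[of "Pow (J n)" "\<lambda>S. u S 0" "real M"] u(2) card by simp
      then show "U 0 \<le> real M + 1" using c by (simp add: U_def field_simps)
      fix k assume k: "k \<in> J n"
      have akD: "a k \<in> unit_disk" using k aD' by (auto simp: J_def)
      have "c * (\<Sum>l\<in>J n - {k}. ?L k l) \<le> 4 * (\<Sum>S\<in>Pow (J n). u S (a k))"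
        unfolding c_def by (rule average_over_partitions[OF J k]) (use u Har_pos_pos[OF _ akD] in \<open>auto intro: less_imp_le\<close>)
      also have "\<dots> \<le> c * (4 * U (a k))" using c by (simp add: U_def field_simps)
      finally show "(\<Sum>l\<in>J n - {k}. ?L k l) \<le> 4 * U (a k)" using c by simp
    qed
  qed
  then obtain U where U: "\<And>n. U n \<in> Har_pos" "\<And>n. U n 0 \<le> real M + 1"
    "\<And>n k. k \<in> J n \<Longrightarrow> (\<Sum>l\<in>J n - {k}. ?L k l) \<le> 4 * U n (a k)"
    by metis
  obtain V r where V: "V \<in> Har_pos" "strict_mono (r :: nat \<Rightarrow> nat)"
    "\<And>z. z \<in> unit_disk \<Longrightarrow> (\<lambda>n. U (r n) z) \<longlonglongrightarrow> V z - 1"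
    using Har_pos_compact[of U, OF U(1,2)] by blast
  have tail: "(\<Sum>l\<in>F. ?L k l) \<le> 4 * V (a k)" if k: "k \<in> I" "m \<le> k" and F: "finite F" "F \<subseteq> I \<inter> {m..} - {k}" for k F
  proof -
    obtain N where N: "insert k F \<subseteq> {..<N}" using F(1) by (meson finite_insert finite_nat_iff_bounded)
    have "(\<Sum>l\<in>F. ?L k l) \<le> 4 * U (r n) (a k)" if "n \<ge> N" for n
    proof -
      have rn: "N \<le> r n" using strict_mono_imp_increasing[OF V(2), of n] that by linarith
      have "F \<subseteq> J (r n) - {k}"
      proof
        fix x assume "x \<in> F"
        then have "x \<in> I \<inter> {m..} - {k}" "x < N" using F(2) N by blast+
        then show "x \<in> J (r n) - {k}" using rn by (auto simp: J_def)
      qed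
      then have "(\<Sum>l\<in>F. ?L k l) \<le> (\<Sum>l\<in>J (r n) - {k}. ?L k l)"
        using J L0 k by (intro sum_mono2) (auto simp: J_def)
      also have "\<dots> \<le> 4 * U (r n) (a k)" using k N rn by (intro U(3)) (auto simp: J_def)
      finally show ?thesis .
    qed
    then have "(\<Sum>l\<in>F. ?L k l) \<le> 4 * (V (a k) - 1)"
      by (intro tendsto_lowerbound[OF tendsto_mult_left[OF V(3)[OF aD'[OF k(1)]]]] eventually_sequentiallyI) auto
    then show ?thesis by simp
  qed
  have "\<exists>u\<in>Har_pos. \<forall>F. finite F \<longrightarrow> F \<subseteq> I - {p} \<longrightarrow> (\<Sum>l\<in>F. ?L p l) \<le> u (a p)" if "p \<in> I" for p
    using interpolating_imp_partition_bound[OF NI, of "{p}"] that by (metis empty_subsetI insert_subset singletonI)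
  then obtain u1 where u1: "\<And>p. p \<in> I \<Longrightarrow> u1 p \<in> Har_pos"
    "\<And>p F. p \<in> I \<Longrightarrow> finite F \<Longrightarrow> F \<subseteq> I - {p} \<Longrightarrow> (\<Sum>l\<in>F. ?L p l) \<le> u1 p (a p)" by metis
  have "\<exists>u\<in>Har_pos. \<forall>k\<in>I - {p}. ?L k p \<le> u (a k)" if "p \<in> I" for p
  proof -
    obtain u where u: "u \<in> Har_pos" "\<And>k F. k \<in> I - {p} \<Longrightarrow> finite F \<Longrightarrow> F \<subseteq> I - (I - {p}) \<Longrightarrow> (\<Sum>l\<in>F. log_pseudo_dist a k l) \<le> u (a k)"
      using interpolating_imp_partition_bound[OF NI, of "I - {p}"] by auto
    then show ?thesis using u(2)[of _ "{p}"] that by (intro bexI[OF _ u(1)]) auto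
  qed
  then obtain u2 where u2: "\<And>p. p \<in> I \<Longrightarrow> u2 p \<in> Har_pos"
    "\<And>p k. p \<in> I \<Longrightarrow> k \<in> I - {p} \<Longrightarrow> ?L k p \<le> u2 p (a k)" by metis
  define P where "P = I \<inter> {..<m}"
  define H where "H z = 4 * V z + (1 + (\<Sum>p\<in>P. u1 p z + u2 p z))" for z
  have bound: "(\<Sum>l\<in>F. ?L k l) \<le> H (a k)" if k: "k \<in> I" and F: "finite F" "F \<subseteq> I - {k}" for k F
  proof -
    have akD: "a k \<in> unit_disk" using aD'[OF k] .
    have pos: "0 < V (a k)" "\<And>p. p \<in> P \<Longrightarrow> 0 < u1 p (a k)" "\<And>p. p \<in> P \<Longrightarrow> 0 < u2 p (a k)"
      using Har_pos_pos[OF V(1) akD] Har_pos_pos[OF u1(1) akD] Har_pos_pos[OF u2(1) akD] by (auto simp: P_def)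
    have pos2: "0 \<le> u1 p (a k) + u2 p (a k)" if "p \<in> P" for p
      using pos(2)[OF that] pos(3)[OF that] by linarith
    show ?thesis
    proof (cases "k < m")
      case True
      have "(\<Sum>l\<in>F. ?L k l) \<le> u1 k (a k)" by (rule u1(2)[OF k F])
      also have "\<dots> \<le> (\<Sum>p\<in>{k}. u1 p (a k) + u2 p (a k))" using pos(3)[of k] k True by (simp add: P_def)
      also have "\<dots> \<le> (\<Sum>p\<in>P. u1 p (a k) + u2 p (a k))"
        using k True pos2 by (intro sum_mono2) (auto simp: P_def)
      also have "\<dots> \<le> H (a k)" using pos(1) by (simp add: H_def)
      finally show ?thesis .
    next
      case False
      have "(\<Sum>l\<in>F. ?L k l) = (\<Sum>l\<in>F \<inter> {m..}. ?L k l) + (\<Sum>l\<in>F - {m..}. ?L k l)"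
        using F(1) by (rule sum.Int_Diff)
      also have "(\<Sum>l\<in>F \<inter> {m..}. ?L k l) \<le> 4 * V (a k)"
        by (rule tail) (use F k False in auto)
      also have "(\<Sum>l\<in>F - {m..}. ?L k l) \<le> (\<Sum>l\<in>F - {m..}. u1 l (a k) + u2 l (a k))"
      proof (rule sum_mono)
        fix l assume l: "l \<in> F - {m..}"
        then have "l \<in> P" using F by (auto simp: P_def)
        then show "?L k l \<le> u1 l (a k) + u2 l (a k)"
        proof -
          have "l \<in> I" "k \<in> I - {l}" using F(2) l k by auto
          then show ?thesis using u2(2)[of l k] pos(2)[OF \<open>l \<in> P\<close>] by linarith
        qed
      qed
      also have "\<dots> \<le> (\<Sum>p\<in>P. u1 p (a k) + u2 p (a k))"
        using F pos2 by (intro sum_mono2) (auto simp: P_def)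
      finally show ?thesis by (simp add: H_def)
    qed
  qed
  show ?thesis
  proof (rule that)
    show "H \<in> Har_pos"
      unfolding H_def[abs_def]
      by (intro Har_pos_add Har_pos_scale Har_pos_sum V(1)) (auto simp: P_def intro: u1 u2 Har_pos_add)
    show "Nevanlinna_separated I a H"
      unfolding Nevanlinna_separated_def
    proof (intro ballI allI impI)
      fix k F assume k: "k \<in> I" and F: "finite F" "F \<subseteq> I - {k}"
      show "exp (- H (a k)) \<le> (\<Prod>l\<in>F. pseudo_dist (a k) (a l))"
        unfolding exp_sum_log_pseudo_dist[OF inj aD k F(2,1), symmetric] using bound[OF k F] by simp
    qed
  qed
qed

section \<open>Lower bounds for finite products of interpolating Blaschke products\<close>

text \<open>Transfers a product bound from \<open>x\<close> to \<open>y\<close>: if \<open>r < 1/4\<close> is the distance of \<open>y\<close> to a point, then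
\<open>(2 r)\<^sup>2 \<le> r\<close>, so the loss of a factor \<open>2\<close> in every distance is absorbed by squaring the product, however
many points are close to \<open>y\<close>. The points far from \<open>y\<close> are taken care of by the Poisson sum.\<close>

lemma prod_pseudo_dist_compare:
  assumes B: "Blaschke_condition I a" and x: "x \<in> unit_disk" and y: "y \<in> unit_disk"
    and F: "finite F" "F \<subseteq> I"
    and le: "\<And>l. l \<in> F \<Longrightarrow> pseudo_dist y (a l) < 1/4 \<Longrightarrow> pseudo_dist x (a l) \<le> 2 * pseudo_dist y (a l)"
  shows "(\<Prod>l\<in>F. pseudo_dist x (a l))\<^sup>2 * exp (- (8 * Re (Poisson_sum I a y))) \<le> (\<Prod>l\<in>F. pseudo_dist y (a l))"
proof -
  have aD: "a l \<in> unit_disk" if "l \<in> F" for l using Blaschke_in_disk[OF B] F that by auto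
  define N where "N = {l\<in>F. pseudo_dist y (a l) < 1/4}"
  have N: "N \<subseteq> F" "finite N" using F by (auto simp: N_def)
  have "(\<Prod>l\<in>F - N. pseudo_dist x (a l)) \<le> 1"
    by (rule prod_le_1) (use pseudo_dist_less_1[OF x aD] in \<open>auto intro: less_imp_le\<close>)
  then have "(\<Prod>l\<in>F - N. pseudo_dist x (a l)) * (\<Prod>l\<in>N. pseudo_dist x (a l)) \<le> 1 * (\<Prod>l\<in>N. pseudo_dist x (a l))"
    by (intro mult_right_mono prod_nonneg) auto
  then have "(\<Prod>l\<in>F. pseudo_dist x (a l)) \<le> (\<Prod>l\<in>N. pseudo_dist x (a l))"
    using prod.subset_diff[OF N(1) F(1), of "\<lambda>l. pseudo_dist x (a l)"] by simp
  then have "(\<Prod>l\<in>F. pseudo_dist x (a l))\<^sup>2 \<le> (\<Prod>l\<in>N. pseudo_dist x (a l))\<^sup>2"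
    by (intro power_mono prod_nonneg) auto
  also have "\<dots> = (\<Prod>l\<in>N. (pseudo_dist x (a l))\<^sup>2)" by (simp add: prod_power_distrib)
  also have "\<dots> \<le> (\<Prod>l\<in>N. pseudo_dist y (a l))"
  proof (intro prod_mono conjI)
    fix l assume "l \<in> N"
    then have l: "l \<in> F" "pseudo_dist y (a l) < 1/4" by (auto simp: N_def)
    have "(pseudo_dist x (a l))\<^sup>2 \<le> (2 * pseudo_dist y (a l))\<^sup>2" using le[OF l] by (intro power_mono) auto
    also have "\<dots> = (4 * pseudo_dist y (a l)) * pseudo_dist y (a l)" by (simp add: power2_eq_square)
    also have "\<dots> \<le> 1 * pseudo_dist y (a l)" using l by (intro mult_right_mono) auto
    finally show "(pseudo_dist x (a l))\<^sup>2 \<le> pseudo_dist y (a l)" by simp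
  qed auto
  finally have 1: "(\<Prod>l\<in>F. pseudo_dist x (a l))\<^sup>2 \<le> (\<Prod>l\<in>N. pseudo_dist y (a l))" .
  have 2: "exp (- (8 * Re (Poisson_sum I a y))) \<le> (\<Prod>l\<in>F - N. pseudo_dist y (a l))"
    by (rule prod_far_pseudo_dist_ge[OF B y]) (use F in \<open>auto simp: N_def\<close>)
  have "(\<Prod>l\<in>F. pseudo_dist x (a l))\<^sup>2 * exp (- (8 * Re (Poisson_sum I a y))) \<le> (\<Prod>l\<in>N. pseudo_dist y (a l)) * (\<Prod>l\<in>F - N. pseudo_dist y (a l))"
    using 1 2 by (intro mult_mono prod_nonneg) auto
  also have "\<dots> = (\<Prod>l\<in>F. pseudo_dist y (a l))"
    using prod.subset_diff[OF N(1) F(1), of "\<lambda>l. pseudo_dist y (a l)"] by (simp add: mult.commute)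
  finally show ?thesis .
qed

text \<open>Compare with the zero \<open>a\<^sub>k\<close> nearest to \<open>z\<close>: all other zeros are at most twice as far from \<open>a\<^sub>k\<close> as from
\<open>z\<close>, so the separation at \<open>a\<^sub>k\<close> carries over to \<open>z\<close>.\<close>

lemma separated_Blaschke_lower_bound:
  assumes B: "Blaschke_condition I a" and H: "H \<in> Har_pos" and sep: "Nevanlinna_separated I a H"
    and z: "z \<in> unit_disk" and t: "0 \<le> t" "t \<le> 1" "\<And>k. k \<in> I \<Longrightarrow> t \<le> pseudo_dist z (a k)"
  shows "t * exp (- (4 * H z + 8 * Re (Poisson_sum I a z))) \<le> cmod (Blaschke_product I a z)"
proof (rule cmod_Blaschke_product_ge[OF B z])
  fix F assume F: "finite F" "F \<subseteq> I"
  let ?P = "Re (Poisson_sum I a z)"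
  show "t * exp (- (4 * H z + 8 * ?P)) \<le> (\<Prod>k\<in>F. pseudo_dist z (a k))"
  proof (cases "\<forall>k\<in>F. 1/4 \<le> pseudo_dist z (a k)")
    case True
    have "t * exp (- (4 * H z + 8 * ?P)) \<le> 1 * exp (- (8 * ?P))"
      using t Har_pos_pos[OF H z] by (intro mult_mono) auto
    also have "\<dots> \<le> (\<Prod>k\<in>F. pseudo_dist z (a k))" using prod_far_pseudo_dist_ge[OF B z F] True by simp
    finally show ?thesis .
  next
    case False
    then have "F \<noteq> {}" by auto
    then obtain k where k: "k \<in> F" "\<And>l. l \<in> F \<Longrightarrow> pseudo_dist z (a k) \<le> pseudo_dist z (a l)"
      using F(1) by (meson ex_min_if_finite[of "(\<lambda>l. pseudo_dist z (a l)) ` F"] finite_imageI image_is_empty arg_min_if_finite(1) arg_min_least)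
    have kI: "k \<in> I" using k F by auto
    have near: "pseudo_dist z (a k) < 1/4" using False k(2) by (meson le_less_trans not_le)
    have akD: "a k \<in> unit_disk" by (rule Blaschke_in_disk[OF B kI])
    have Hk: "H (a k) \<le> 2 * H z"
      by (rule Harnack[OF H z akD]) (use near in \<open>simp add: pseudo_dist_commute\<close>)
    have "exp (- H (a k)) \<le> (\<Prod>l\<in>F - {k}. pseudo_dist (a k) (a l))"
      using sep kI finite_Diff[OF F(1), of "{k}"] Diff_mono[OF F(2) order_refl, of "{k}"]
      unfolding Nevanlinna_separated_def by blast
    then have "(exp (- H (a k)))\<^sup>2 \<le> (\<Prod>l\<in>F - {k}. pseudo_dist (a k) (a l))\<^sup>2"
      by (intro power_mono) auto
    moreover have "exp (- (4 * H z)) \<le> (exp (- H (a k)))\<^sup>2"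
      using Hk by (simp flip: exp_double)
    ultimately have "exp (- (4 * H z)) * exp (- (8 * ?P)) \<le> (\<Prod>l\<in>F - {k}. pseudo_dist (a k) (a l))\<^sup>2 * exp (- (8 * ?P))"
      by (intro mult_right_mono) auto
    also have "\<dots> \<le> (\<Prod>l\<in>F - {k}. pseudo_dist z (a l))"
    proof (rule prod_pseudo_dist_compare[OF B akD z])
      fix l assume l: "l \<in> F - {k}"
      then have "a l \<in> unit_disk" using Blaschke_in_disk[OF B] F by auto
      then show "pseudo_dist (a k) (a l) \<le> 2 * pseudo_dist z (a l)"
        using pseudo_dist_triangle[OF akD z, of "a l"] k(2)[of l] l by (simp add: pseudo_dist_commute[of "a k" z])
    qed (use F in auto)
    finally have "t * (exp (- (4 * H z)) * exp (- (8 * ?P))) \<le> pseudo_dist z (a k) * (\<Prod>l\<in>F - {k}. pseudo_dist z (a l))"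
      using t kI by (intro mult_mono) auto
    also have "\<dots> = (\<Prod>l\<in>F. pseudo_dist z (a l))" using F(1) k(1) by (simp add: prod.remove)
    finally show ?thesis by (simp flip: exp_add)
  qed
qed

lemma half_norm_diff_le_pseudo_dist:
  assumes "x \<in> unit_disk" "y \<in> unit_disk" shows "cmod (x - y) / 2 \<le> pseudo_dist x y"
proof -
  have "cmod (1 - cnj y * x) \<le> 2"
    using norm_triangle_ineq4[of 1 "cnj y * x"] cmod_cnj_mult_less_1[OF assms] by simp
  then show ?thesis unfolding pseudo_dist_def norm_divide using disk_denom_nonzero[OF assms]
    by (intro divide_left_mono) auto
qed

lemma bounded_by_quotient_finite_product_NIB:
  assumes B: "finite_product_NIB B" and q: "q holomorphic_on unit_disk"
    and bd: "\<And>z. z \<in> unit_disk \<Longrightarrow> cmod (q z) * cmod (B z) \<le> C" and z: "z \<in> unit_disk"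
  shows "cmod (q z) \<le> C"
proof -
  obtain n :: nat and b where nb: "\<And>j. j < n \<Longrightarrow> Nevanlinna_interpolating_Blaschke (b j)"
    and Bz: "\<And>z. z \<in> unit_disk \<Longrightarrow> B z = (\<Prod>j<n. b j z)"
    using B unfolding finite_product_NIB_def by blast
  have bhol: "b j holomorphic_on unit_disk" if "j < n" for j
  proof -
    obtain I a where "Blaschke_condition I a" "\<forall>z\<in>unit_disk. b j z = Blaschke_product I a z"
      using nb[OF \<open>j < n\<close>] unfolding Nevanlinna_interpolating_Blaschke_def by blast
    then show ?thesis using Blaschke_product_holomorphic holomorphic_transform[of "Blaschke_product I a" unit_disk "b j"] by auto
  qed
  have "\<forall>z\<in>unit_disk. cmod (q z) \<le> C"
    if "m \<le> n" "q holomorphic_on unit_disk" "\<forall>z\<in>unit_disk. cmod (q z) * cmod (\<Prod>j<m. b j z) \<le> C" for m q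
    using that
  proof (induction m arbitrary: q)
    case 0
    then show ?case by simp
  next
    case (Suc m)
    have "\<forall>z\<in>unit_disk. cmod (q z * b m z) \<le> C"
      using Suc.prems bhol by (intro Suc.IH holomorphic_intros) (auto simp: norm_mult mult_ac)
    moreover obtain I a where "Blaschke_condition I a" "\<forall>z\<in>unit_disk. b m z = Blaschke_product I a z"
      using nb[of m] Suc.prems unfolding Nevanlinna_interpolating_Blaschke_def by auto
    ultimately show ?case
      by (intro ballI bounded_by_quotient_Blaschke_product[of I a q C]) (use Suc.prems in \<open>auto simp: norm_mult\<close>)
  qed
  from this[of n q] show ?thesis using q bd Bz z by auto
qed

lemma finite_product_NIB_holomorphic_bounded:
  assumes B: "finite_product_NIB B"
  shows "B holomorphic_on unit_disk" "\<And>z. z \<in> unit_disk \<Longrightarrow> cmod (B z) \<le> 1"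
proof -
  obtain n :: nat and b where nb: "\<And>j. j < n \<Longrightarrow> Nevanlinna_interpolating_Blaschke (b j)"
    and Bz: "\<And>z. z \<in> unit_disk \<Longrightarrow> B z = (\<Prod>j<n. b j z)"
    using B unfolding finite_product_NIB_def by blast
  have b: "b j holomorphic_on unit_disk \<and> (\<forall>z\<in>unit_disk. cmod (b j z) \<le> 1)" if "j < n" for j
  proof -
    obtain I a where "Blaschke_condition I a" "\<forall>z\<in>unit_disk. b j z = Blaschke_product I a z"
      using nb[OF \<open>j < n\<close>] unfolding Nevanlinna_interpolating_Blaschke_def by blast
    then show ?thesis using Blaschke_product_holomorphic holomorphic_transform[of "Blaschke_product I a" unit_disk "b j"]
        cmod_Blaschke_product_le_1 by auto
  qed
  have "(\<lambda>z. \<Prod>j<n. b j z) holomorphic_on unit_disk" by (intro holomorphic_intros) (use b in auto)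
  then show "B holomorphic_on unit_disk" by (rule holomorphic_transform) (simp add: Bz)
  show "cmod (B z) \<le> 1" if "z \<in> unit_disk" for z
    unfolding Bz[OF that] prod_norm[symmetric] by (rule prod_le_1) (use b that in auto)
qed

text \<open>Take \<open>n + 1\<close> points in the disk of radius \<open>R\<close> around \<open>z\<close> with mutual distance of order \<open>R\<close>. If each were
close to a zero of one of the \<open>n\<close> factors, two of them would be close to zeros of the same factor; these
zeros coincide or violate the separation, both of which are impossible. The extra parameter \<open>c\<close> allows
\<open>H\<close> to be chosen large in terms of \<open>n\<close>, which is needed later to absorb constants.\<close>

lemma finite_product_NIB_good_points:
  assumes B: "finite_product_NIB B" and c: "c > 0"
  obtains n :: nat and H where "H \<in> Har_pos" "\<And>z. z \<in> unit_disk \<Longrightarrow> real (n + 4) * c \<le> H z"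
    "\<And>z R. z \<in> unit_disk \<Longrightarrow> 0 < R \<Longrightarrow> R \<le> exp (- H z) \<Longrightarrow>
       \<exists>w\<in>unit_disk. pseudo_dist w z \<le> R \<and> R ^ n * exp (- H z) \<le> cmod (B w)"
proof -
  obtain n :: nat and b where nb: "\<And>j. j < n \<Longrightarrow> Nevanlinna_interpolating_Blaschke (b j)"
    and Bz: "\<And>z. z \<in> unit_disk \<Longrightarrow> B z = (\<Prod>j<n. b j z)"
    using B unfolding finite_product_NIB_def by blast
  have "\<exists>I a H. Blaschke_condition I a \<and> (\<forall>z\<in>unit_disk. b j z = Blaschke_product I a z) \<and>
      H \<in> Har_pos \<and> Nevanlinna_separated I a H" if "j < n" for j
    using nb[OF that] unfolding Nevanlinna_interpolating_Blaschke_def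
    by (meson interpolating_imp_separated)
  then obtain I a H where Bl: "\<And>j. j < n \<Longrightarrow> Blaschke_condition (I j) (a j)"
    and b: "\<And>j z. j < n \<Longrightarrow> z \<in> unit_disk \<Longrightarrow> b j z = Blaschke_product (I j) (a j) z"
    and H: "\<And>j. j < n \<Longrightarrow> H j \<in> Har_pos" and sep: "\<And>j. j < n \<Longrightarrow> Nevanlinna_separated (I j) (a j) (H j)"
    by metis
  define K where "K j z = 4 * H j z + 8 * (1 + Re (Poisson_sum (I j) (a j) z))" for j z
  have K: "K j \<in> Har_pos" if "j < n" for j
    unfolding K_def[abs_def] by (intro Har_pos_add Har_pos_scale H Poisson_Har_pos Bl that) auto
  define L where "L z = 1 + (\<Sum>j<n. K j z)" for z
  have L: "L \<in> Har_pos" unfolding L_def[abs_def] by (rule Har_pos_sum) (use K in auto)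
  have Kpos: "0 \<le> K j z" if "j < n" "z \<in> unit_disk" for j z
    using Har_pos_pos[OF K that(2)] that by (simp add: less_imp_le)
  have KL: "K j z \<le> L z" if "j < n" "z \<in> unit_disk" for j z
    using member_le_sum[of j "{..<n}" "\<lambda>j. K j z"] that Kpos by (simp add: L_def)
  have HK: "H j z \<le> K j z" if "j < n" "z \<in> unit_disk" for j z
    using Har_pos_pos[OF H that(2)] Poisson_sum_nonneg[OF Bl that(2)] that by (simp add: K_def add_increasing2)
  define d where "d = real n * ln (4 * (real n + 1)) + ln 6 + real (n + 4) * c"
  have d: "0 < d" "ln 6 \<le> d" "real n * ln (4 * (real n + 1)) \<le> d" "real (n + 4) * c \<le> d"
    using c by (auto simp: d_def intro!: add_nonneg_pos add_nonneg_nonneg mult_nonneg_nonneg)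
  show ?thesis
  proof (rule that)
    show "(\<lambda>z. 2 * L z + d) \<in> Har_pos"
      by (intro Har_pos_add Har_pos_scale L Har_pos_const d) auto
    show "real (n + 4) * c \<le> 2 * L z + d" if "z \<in> unit_disk" for z
      using Har_pos_pos[OF L that] d by linarith
    fix z R assume z: "z \<in> unit_disk" and R: "0 < R" "R \<le> exp (- (2 * L z + d))"
    have Lz: "0 < L z" by (rule Har_pos_pos[OF L z])
    have R6: "R \<le> exp (- (2 * L z)) / 6"
    proof -
      have "exp (- (2 * L z + d)) \<le> exp (- (2 * L z) - ln 6)" using d by simp
      also have "\<dots> = exp (- (2 * L z)) / 6" by (simp add: exp_diff)
      finally show ?thesis using R by linarith
    qed
    have R16: "R \<le> 1/6" using R6 Lz by (smt (verit) exp_le_one_iff divide_right_mono)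
    \<comment> \<open>Equally spaced points on a radius; the Moebius map below carries \<open>0\<close> to \<open>z\<close>.\<close>
    define x where "x i = complex_of_real (R * (real i / (real n + 1)))" for i :: nat
    have frac: "0 \<le> real i / (real n + 1)" "real i / (real n + 1) \<le> 1" if "i \<le> n" for i
      using that by auto
    have xn: "cmod (x i) \<le> R" if "i \<le> n" for i
    proof -
      have "cmod (x i) = R * (real i / (real n + 1))"
        unfolding x_def norm_of_real using R frac[OF that] by (simp add: abs_mult)
      also have "\<dots> \<le> R * 1" using R frac[OF that] by (intro mult_left_mono) auto
      finally show ?thesis by simp
    qed
    have xD: "x i \<in> unit_disk" if "i \<le> n" for i using xn[OF that] R16 by simp
    have mz: "- z \<in> unit_disk" using z by simp
    define \<zeta> where "\<zeta> i = disk_moebius (- z) (x i)" for i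
    have \<zeta>D: "\<zeta> i \<in> unit_disk" if "i \<le> n" for i
      unfolding \<zeta>_def by (rule disk_moebius_in_disk[OF xD[OF that] mz])
    have \<zeta>z: "pseudo_dist (\<zeta> i) z \<le> R" if "i \<le> n" for i
      using pseudo_dist_disk_moebius[OF xD[OF that] _ mz, of 0] xn[OF that] by (simp add: \<zeta>_def disk_moebius_def[of _ 0])
    define t where "t = R / (4 * (real n + 1))"
    have t: "0 < t" "2 * t \<le> R" "t \<le> 1" using R R16 by (auto simp: t_def field_simps)
    have sp: "2 * t \<le> pseudo_dist (\<zeta> i) (\<zeta> i')" if "i \<le> n" "i' \<le> n" "i \<noteq> i'" for i i'
    proof -
      have "x i - x i' = of_real (R / (real n + 1) * (real i - real i'))"
        unfolding x_def of_real_diff[symmetric] by (simp add: diff_divide_distrib right_diff_distrib)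
      then have "cmod (x i - x i') = R / (real n + 1) * \<bar>real i - real i'\<bar>"
        using R by (simp only: norm_of_real) (simp add: abs_mult)
      moreover have "1 \<le> \<bar>real i - real i'\<bar>" using that(3) by linarith
      ultimately have "R / (real n + 1) \<le> cmod (x i - x i')"
        using R mult_left_mono[of 1 "\<bar>real i - real i'\<bar>" "R / (real n + 1)"] by simp
      then have "2 * t \<le> cmod (x i - x i') / 2" by (simp add: t_def field_simps)
      also have "\<dots> \<le> pseudo_dist (x i) (x i')" by (rule half_norm_diff_le_pseudo_dist[OF xD[OF that(1)] xD[OF that(2)]])
      also have "\<dots> = pseudo_dist (\<zeta> i) (\<zeta> i')" unfolding \<zeta>_def by (rule pseudo_dist_disk_moebius[symmetric, OF xD[OF that(1)] xD[OF that(2)] mz])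
      finally show ?thesis .
    qed
    have "\<exists>i\<le>n. \<forall>j<n. \<forall>k\<in>I j. t \<le> pseudo_dist (\<zeta> i) (a j k)"
    proof (rule ccontr)
      assume contr: "\<not> ?thesis"
      have "\<exists>j k. j < n \<and> k \<in> I j \<and> pseudo_dist (\<zeta> i) (a j k) < t" if "i \<le> n" for i
        using contr that by (meson not_le)
      then obtain J k where J: "\<And>i. i \<le> n \<Longrightarrow> J i < n" "\<And>i. i \<le> n \<Longrightarrow> k i \<in> I (J i)"
          "\<And>i. i \<le> n \<Longrightarrow> pseudo_dist (\<zeta> i) (a (J i) (k i)) < t"
        by metis
      have "\<not> inj_on J {..n}"
      proof
        assume "inj_on J {..n}"
        then have "card {..n} \<le> card {..<n}" by (rule card_inj_on_le) (use J(1) in auto)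
        then show False by simp
      qed
      then obtain i i' where i: "i \<le> n" "i' \<le> n" "i \<noteq> i'" "J i = J i'" by (auto simp: inj_on_def)
      define j where "j = J i"
      have j: "j < n" "J i' = j" "J i = j" "k i \<in> I j" "k i' \<in> I j"
        using J(1)[OF i(1)] J(2)[OF i(1)] J(2)[OF i(2)] i(4) by (auto simp: j_def)
      define \<alpha> \<beta> where "\<alpha> = a j (k i)" and "\<beta> = a j (k i')"
      have D: "\<alpha> \<in> unit_disk" "\<beta> \<in> unit_disk" "\<zeta> i \<in> unit_disk" "\<zeta> i' \<in> unit_disk"
        using Blaschke_in_disk[OF Bl] j \<zeta>D i by (auto simp: \<alpha>_def \<beta>_def)
      have near: "pseudo_dist (\<zeta> i) \<alpha> < t" "pseudo_dist (\<zeta> i') \<beta> < t"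
        using J(3)[OF i(1)] J(3)[OF i(2)] j by (auto simp: \<alpha>_def \<beta>_def)
      show False
      proof (cases "k i = k i'")
        case True
        then have "\<alpha> = \<beta>" by (simp add: \<alpha>_def \<beta>_def)
        then show False
          using pseudo_dist_triangle[OF D(3) D(1) D(4)] near sp[OF i(1-3)] by (simp add: pseudo_dist_commute[of \<beta> "\<zeta> i'"])
      next
        case False
        have "exp (- H j \<alpha>) \<le> (\<Prod>l\<in>{k i'}. pseudo_dist \<alpha> (a j l))"
          using sep[OF j(1)] j False unfolding Nevanlinna_separated_def \<alpha>_def by blast
        then have 1: "exp (- H j \<alpha>) \<le> pseudo_dist \<alpha> \<beta>" by (simp add: \<beta>_def)
        have 2: "pseudo_dist \<alpha> z \<le> 2 * R"
          using pseudo_dist_triangle[OF D(1) D(3) z] near(1) \<zeta>z[OF i(1)] t R by (simp add: pseudo_dist_commute[of \<alpha>])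
        have "H j \<alpha> \<le> 2 * H j z"
          by (rule Harnack[OF H[OF j(1)] z D(1)]) (use 2 R16 in linarith)
        also have "\<dots> \<le> 2 * L z" using HK[OF j(1) z] KL[OF j(1) z] by simp
        finally have 3: "exp (- (2 * L z)) \<le> exp (- H j \<alpha>)" by simp
        have 4: "pseudo_dist z \<beta> \<le> R + t"
          using pseudo_dist_triangle[OF z D(4) D(2)] near(2) \<zeta>z[OF i(2)] by (simp add: pseudo_dist_commute[of z])
        have "pseudo_dist \<alpha> \<beta> \<le> 4 * R" using pseudo_dist_triangle[OF D(1) z D(2)] 2 4 t R by linarith
        then show False using 1 3 R6 R by linarith
      qed
    qed
    then obtain i where i: "i \<le> n" "\<And>j k. j < n \<Longrightarrow> k \<in> I j \<Longrightarrow> t \<le> pseudo_dist (\<zeta> i) (a j k)" by blast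
    have D: "\<zeta> i \<in> unit_disk" by (rule \<zeta>D[OF i(1)])
    have "R ^ n * exp (- (2 * L z + d)) \<le> R ^ n * (exp (- (real n * ln (4 * (real n + 1)))) * exp (- (2 * L z)))"
      using R d by (intro mult_left_mono) (auto simp flip: exp_add)
    also have "exp (- (real n * ln (4 * (real n + 1)))) = 1 / (4 * (real n + 1)) ^ n"
      by (simp add: exp_minus exp_of_nat_mult field_simps)
    also have "R ^ n * (1 / (4 * (real n + 1)) ^ n * exp (- (2 * L z))) = t ^ n * exp (- (2 * L z))"
      by (simp add: t_def power_divide)
    also have "\<dots> \<le> t ^ n * exp (- (\<Sum>j<n. K j (\<zeta> i)))"
    proof -
      have "L (\<zeta> i) \<le> 2 * L z" by (rule Harnack[OF L z D]) (use \<zeta>z[OF i(1)] R16 in linarith)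
      then have "(\<Sum>j<n. K j (\<zeta> i)) \<le> 2 * L z" by (simp add: L_def)
      then show ?thesis using t by simp
    qed
    also have "\<dots> = (\<Prod>j<n. t * exp (- K j (\<zeta> i)))"
      by (simp add: prod.distrib exp_sum flip: sum_negf)
    also have "\<dots> \<le> (\<Prod>j<n. cmod (b j (\<zeta> i)))"
    proof (intro prod_mono conjI)
      fix j assume j: "j \<in> {..<n}"
      have "t * exp (- K j (\<zeta> i)) \<le> t * exp (- (4 * H j (\<zeta> i) + 8 * Re (Poisson_sum (I j) (a j) (\<zeta> i))))"
        using t by (simp add: K_def)
      also have "\<dots> \<le> cmod (b j (\<zeta> i))"
        using separated_Blaschke_lower_bound[OF Bl H sep D, of j t] i(2)[of j] j t b[of j, OF _ D] by auto
      finally show "t * exp (- K j (\<zeta> i)) \<le> cmod (b j (\<zeta> i))" .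
    qed (use t in auto)
    also have "\<dots> = cmod (B (\<zeta> i))" by (simp add: Bz[OF D] prod_norm)
    finally show "\<exists>w\<in>unit_disk. pseudo_dist w z \<le> R \<and> R ^ n * exp (- (2 * L z + d)) \<le> cmod (B w)"
      using D \<zeta>z[OF i(1)] by blast
  qed
qed

section \<open>The zeros of a bounded holomorphic function\<close>

lemma eventually_nonzero_disk:
  assumes "f holomorphic_on unit_disk" "z0 \<in> unit_disk" "f z0 \<noteq> 0" "z \<in> unit_disk"
  shows "eventually (\<lambda>w. f w \<noteq> 0) (at z)"
proof -
  have "eventually (\<lambda>w. f w \<noteq> 0 \<and> w \<in> unit_disk) (at z)"
    by (rule non_zero_neighbour_alt[where ?\<beta> = z0]) (use assms in auto)
  then show ?thesis by (rule eventually_mono) auto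
qed

lemma analytic_at_disk:
  "f holomorphic_on unit_disk \<Longrightarrow> z \<in> unit_disk \<Longrightarrow> f analytic_on {z}"
  using analytic_at open_ball by blast

text \<open>Multiplicities are encoded by repeating a zero in the sequence, so that each index of the sequence can be
given a colour of its own.\<close>

definition enumerates_zeros :: "(complex \<Rightarrow> complex) \<Rightarrow> nat set \<Rightarrow> (nat \<Rightarrow> complex) \<Rightarrow> bool" where
  "enumerates_zeros f I c \<longleftrightarrow> c ` I \<subseteq> unit_disk \<and>
     (\<forall>\<alpha>\<in>unit_disk. finite {k\<in>I. c k = \<alpha>} \<and> zorder f \<alpha> = int (card {k\<in>I. c k = \<alpha>}))"

lemma exists_enumeration_of_zeros:
  assumes f: "f holomorphic_on unit_disk" and z0: "z0 \<in> unit_disk" "f z0 \<noteq> 0"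
  obtains I c where "enumerates_zeros f I c"
proof -
  have ana: "f analytic_on {z}" and ev: "eventually (\<lambda>w. f w \<noteq> 0) (at z)" if "z \<in> unit_disk" for z
    using analytic_at_disk[OF f that] eventually_nonzero_disk[OF f z0 that] by auto
  have count: "countable {z \<in> unit_disk. f z = 0}"
  proof (cases "f constant_on unit_disk")
    case True
    then obtain y where "\<forall>z\<in>unit_disk. f z = y" unfolding constant_on_def by blast
    then have "{z \<in> unit_disk. f z = 0} = {}" using z0 by auto
    then show ?thesis by (simp only: countable_empty)
  next
    case False
    have "unit_disk = (\<Union>n. cball 0 (1 - inverse (real (Suc n))))"
    proof (intro set_eqI iffI)
      fix z :: complex assume "z \<in> unit_disk"
      then obtain n where "inverse (real (Suc n)) < 1 - cmod z" using reals_Archimedean[of "1 - cmod z"] by auto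
      then show "z \<in> (\<Union>n. cball 0 (1 - inverse (real (Suc n))))" by (intro UN_I[of n]) auto
    next
      fix z :: complex assume "z \<in> (\<Union>n. cball 0 (1 - inverse (real (Suc n))))"
      then obtain n where "cmod z \<le> 1 - inverse (real (Suc n))" by auto
      moreover have "0 < inverse (real (Suc n))" by simp
      ultimately have "cmod z < 1" by linarith
      then show "z \<in> unit_disk" by simp
    qed
    moreover have "fsigma (\<Union>n. cball (0::complex) (1 - inverse (real (Suc n))))" by (rule fsigma.intros) simp
    ultimately have "fsigma unit_disk" by simp
    then show ?thesis by (intro holomorphic_countable_zeros f False) auto
  qed
  define S where "S = (SIGMA z:{z \<in> unit_disk. f z = 0}. {..<nat (zorder f z)})"
  have "countable S" unfolding S_def by (intro countable_SIGMA count) auto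
  then obtain e :: "complex \<times> nat \<Rightarrow> nat" where e: "inj_on e S" by (auto simp: countable_def)
  define I where "I = e ` S"
  define c where "c k = fst (inv_into S e k)" for k
  have ce: "c (e p) = fst p" if "p \<in> S" for p using that e by (simp add: c_def)
  have eq: "{k\<in>I. c k = \<alpha>} = e ` ({\<alpha>} \<times> {..<nat (zorder f \<alpha>)})" if \<alpha>: "\<alpha> \<in> unit_disk" "f \<alpha> = 0" for \<alpha>
    using \<alpha> ce unfolding I_def S_def by force
  show ?thesis
  proof (rule that[of I c], unfold enumerates_zeros_def, intro conjI ballI)
    show "c ` I \<subseteq> unit_disk" using ce by (auto simp: I_def S_def)
    fix \<alpha> assume \<alpha>: "\<alpha> \<in> unit_disk"
    have "finite {k\<in>I. c k = \<alpha>} \<and> zorder f \<alpha> = int (card {k\<in>I. c k = \<alpha>})"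
    proof (cases "f \<alpha> = 0")
      case True
      have "inj_on e ({\<alpha>} \<times> {..<nat (zorder f \<alpha>)})"
        by (rule inj_on_subset[OF e]) (use True \<alpha> in \<open>auto simp: S_def\<close>)
      then have "card {k\<in>I. c k = \<alpha>} = nat (zorder f \<alpha>)"
        unfolding eq[OF \<alpha> True] by (simp add: card_image card_cartesian_product)
      moreover have "zorder f \<alpha> \<ge> 0"
        by (rule zorder_ge_0[OF ana[OF \<alpha>] eventually_frequently[OF _ ev[OF \<alpha>]]]) simp
      ultimately show ?thesis unfolding eq[OF \<alpha> True] by simp
    next
      case False
      have "{k\<in>I. c k = \<alpha>} = {}" using False ce by (auto simp: I_def S_def)
      then show ?thesis using zorder_eq_0I[OF ana[OF \<alpha>] False] by (simp only: finite.emptyI card.empty) simp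
    qed
    then show "finite {k\<in>I. c k = \<alpha>}" "zorder f \<alpha> = int (card {k\<in>I. c k = \<alpha>})" by auto
  qed
qed

lemma Blaschke_factor_disk_moebius: "\<exists>e. e \<noteq> 0 \<and> (\<forall>z. Blaschke_factor a z = e * disk_moebius a z)"
proof (cases "a = 0")
  case True
  then show ?thesis by (intro exI[of _ 1]) (simp add: Blaschke_factor_def disk_moebius_def)
next
  case False
  have "(a - z) / d = - ((z - a) / d)" for z d by (simp add: minus_divide_left)
  then have "x * ((a - z) / d) = - x * ((z - a) / d)" for x z d
    by (simp only: mult_minus_left mult_minus_right)
  then show ?thesis using False
    by (intro exI[of _ "- (of_real (cmod a) / a)"]) (simp add: Blaschke_factor_def disk_moebius_def)
qed

lemma divide_out_finite_zeros:
  assumes f: "f holomorphic_on unit_disk" and z0: "z0 \<in> unit_disk" "f z0 \<noteq> 0"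
    and bd: "\<And>z. z \<in> unit_disk \<Longrightarrow> cmod (f z) \<le> C"
    and en: "enumerates_zeros f I c" and F: "finite F" "F \<subseteq> I"
  obtains q where "q holomorphic_on unit_disk" "\<And>z. z \<in> unit_disk \<Longrightarrow> cmod (q z) \<le> C"
    "\<And>z. z \<in> unit_disk \<Longrightarrow> f z = q z * (\<Prod>k\<in>F. Blaschke_factor (c k) z)"
proof -
  have "\<exists>q. q holomorphic_on unit_disk \<and> (\<forall>z\<in>unit_disk. cmod (q z) \<le> C \<and> f z = q z * (\<Prod>k\<in>F. Blaschke_factor (c k) z))"
    using F
  proof (induction F rule: finite_induct)
    case empty
    then show ?case using f bd by auto
  next
    case (insert i F)
    then obtain q where q: "q holomorphic_on unit_disk" "\<And>z. z \<in> unit_disk \<Longrightarrow> cmod (q z) \<le> C"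
       "\<And>z. z \<in> unit_disk \<Longrightarrow> f z = q z * (\<Prod>k\<in>F. Blaschke_factor (c k) z)" by auto
    define \<alpha> where "\<alpha> = c i"
    have \<alpha>: "\<alpha> \<in> unit_disk" using insert en by (auto simp: \<alpha>_def enumerates_zeros_def)
    have cF: "c ` F \<subseteq> unit_disk" using insert en by (auto simp: enumerates_zeros_def)
    have BF: "Blaschke_condition F c" by (rule Blaschke_condition_finite[OF insert(1) cF])
    have BFz: "Blaschke_product F c = (\<lambda>z. \<Prod>k\<in>F. Blaschke_factor (c k) z)"
      using Blaschke_product_finite[OF insert(1)] by blast
    have Bh: "Blaschke_product F c holomorphic_on unit_disk" by (rule Blaschke_product_holomorphic[OF BF])
    have ev: "eventually (\<lambda>w. q w * Blaschke_product F c w \<noteq> 0) (at \<alpha>)"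
    proof (rule eventually_nonzero_disk[OF _ z0(1) _ \<alpha>])
      show "(\<lambda>w. q w * Blaschke_product F c w) holomorphic_on unit_disk" by (intro holomorphic_intros q(1) Bh)
      show "q z0 * Blaschke_product F c z0 \<noteq> 0" unfolding BFz q(3)[OF z0(1), symmetric] by (rule z0(2))
    qed
    have "zorder f \<alpha> = zorder (\<lambda>z. q z * Blaschke_product F c z) \<alpha>"
    proof (rule zorder_cong)
      show "eventually (\<lambda>w. f w = q w * Blaschke_product F c w) (at \<alpha>)"
        using eventually_at_in_open'[OF open_ball \<alpha>] by (rule eventually_mono) (use q(3) BFz in auto)
    qed simp
    also have "\<dots> = zorder q \<alpha> + zorder (Blaschke_product F c) \<alpha>"
      by (rule zorder_times_analytic[OF analytic_at_disk[OF q(1) \<alpha>] analytic_at_disk[OF Bh \<alpha>] ev])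
    also have "zorder (Blaschke_product F c) \<alpha> = int (card {k\<in>F. c k = \<alpha>})"
      by (rule zorder_Blaschke_product[OF BF \<alpha>])
    finally have "zorder q \<alpha> = int (card {k\<in>I. c k = \<alpha>}) - int (card {k\<in>F. c k = \<alpha>})"
      using en \<alpha> by (simp add: enumerates_zeros_def)
    moreover have "card {k\<in>F. c k = \<alpha>} < card {k\<in>I. c k = \<alpha>}"
    proof (rule psubset_card_mono)
      show "finite {k\<in>I. c k = \<alpha>}" using en \<alpha> by (simp add: enumerates_zeros_def)
      show "{k\<in>F. c k = \<alpha>} \<subset> {k\<in>I. c k = \<alpha>}"
        using insert(2) insert.prems by (auto simp: \<alpha>_def)
    qed
    ultimately have "zorder q \<alpha> > 0" by simp
    moreover have "frequently (\<lambda>w. q w \<noteq> 0) (at \<alpha>)"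
      by (rule eventually_frequently[OF _ eventually_mono[OF ev]]) auto
    ultimately have "q \<alpha> = 0" using zorder_pos_iff'[OF analytic_at_disk[OF q(1) \<alpha>]] by blast
    then obtain p where p: "p holomorphic_on unit_disk" "\<And>z. z \<in> unit_disk \<Longrightarrow> q z = disk_moebius \<alpha> z * p z"
      using divide_out_zero[OF q(1) \<alpha> _ q(2)] by metis
    obtain e where e: "e \<noteq> 0" "\<And>z. Blaschke_factor \<alpha> z = e * disk_moebius \<alpha> z" using Blaschke_factor_disk_moebius by blast
    define r where "r z = p z / e" for z
    have r: "r holomorphic_on unit_disk" unfolding r_def[abs_def] using e by (intro holomorphic_intros p) auto
    have qr: "q z = r z * Blaschke_factor \<alpha> z" if "z \<in> unit_disk" for z
      using p(2)[OF that] e by (simp add: r_def)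
    show ?case
    proof (intro exI[of _ r] conjI ballI r)
      fix z assume z: "z \<in> unit_disk"
      show "f z = r z * (\<Prod>k\<in>insert i F. Blaschke_factor (c k) z)"
        using q(3)[OF z] qr[OF z] insert(1,2) by (simp add: \<alpha>_def mult_ac)
      show "cmod (r z) \<le> C"
      proof (rule bounded_by_quotient_Blaschke[OF r \<alpha> _ z])
        fix w assume w: "w \<in> unit_disk"
        show "cmod (r w) * pseudo_dist w \<alpha> \<le> C"
          using q(2)[OF w] qr[OF w] by (simp add: norm_mult cmod_Blaschke_factor)
      qed
    qed
  qed
  then show ?thesis using that by blast
qed

lemma bounded_by_prod_over_zeros:
  assumes "f holomorphic_on unit_disk" "z0 \<in> unit_disk" "f z0 \<noteq> 0"
    "\<And>z. z \<in> unit_disk \<Longrightarrow> cmod (f z) \<le> C"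
    "enumerates_zeros f I c" "finite F" "F \<subseteq> I" and z: "z \<in> unit_disk"
  shows "cmod (f z) \<le> C * (\<Prod>k\<in>F. pseudo_dist z (c k))"
proof -
  obtain q where "q holomorphic_on unit_disk" and q: "\<And>z. z \<in> unit_disk \<Longrightarrow> cmod (q z) \<le> C"
    "\<And>z. z \<in> unit_disk \<Longrightarrow> f z = q z * (\<Prod>k\<in>F. Blaschke_factor (c k) z)"
    using divide_out_finite_zeros[OF assms(1-7)] by metis
  have "cmod (f z) = cmod (q z) * (\<Prod>k\<in>F. pseudo_dist z (c k))"
    using q(2)[OF z] by (simp add: norm_mult cmod_Blaschke_factor flip: prod_norm)
  also have "\<dots> \<le> C * (\<Prod>k\<in>F. pseudo_dist z (c k))"
    using q(1)[OF z] by (intro mult_right_mono prod_nonneg) auto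
  finally show ?thesis .
qed

text \<open>The finite Schwarz-Pick inequality at a point \<open>z\<^sub>0\<close> with \<open>f(z\<^sub>0) \<noteq> 0\<close> bounds \<open>\<Sum> (1 - \<rho>(z\<^sub>0, c\<^sub>k)\<^sup>2)\<close>, whose terms
are comparable to \<open>1 - |c\<^sub>k|\<close>.\<close>

lemma zeros_Blaschke_condition:
  assumes f: "f holomorphic_on unit_disk" and z0: "z0 \<in> unit_disk" "f z0 \<noteq> 0"
    and bd: "\<And>z. z \<in> unit_disk \<Longrightarrow> cmod (f z) \<le> C" and en: "enumerates_zeros f I c"
  shows "Blaschke_condition I c"
  unfolding Blaschke_condition_def
proof
  show cI: "c ` I \<subseteq> unit_disk" using en by (simp add: enumerates_zeros_def)
  have C: "C > 0" using bd[OF z0(1)] z0(2) by (meson less_le_trans zero_less_norm_iff)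
  define M where "M = 2 * ln (C / cmod (f z0))"
  define \<eta> where "\<eta> = (1 - (cmod z0)\<^sup>2) / 4"
  have \<eta>: "\<eta> > 0" using one_minus_norm_sq_pos[OF z0(1)] by (simp add: \<eta>_def)
  have bound: "(\<Sum>k\<in>F. 1 - cmod (c k)) \<le> M / \<eta>" if F: "finite F" "F \<subseteq> I" for F
  proof -
    have cD: "c k \<in> unit_disk" if "k \<in> F" for k using cI F that by blast
    have "\<eta> * (\<Sum>k\<in>F. 1 - cmod (c k)) \<le> (\<Sum>k\<in>F. 1 - (pseudo_dist z0 (c k))\<^sup>2)"
      unfolding sum_distrib_left
    proof (rule sum_mono)
      fix k assume k: "k \<in> F"
      have cc: "cmod (c k) < 1" using cD[OF k] by simp
      have "1 - cmod (c k) \<le> 1 - (cmod (c k))\<^sup>2" using cc by (simp add: power2_eq_square mult_left_le)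
      moreover have "(cmod (1 - cnj (c k) * z0))\<^sup>2 \<le> 2\<^sup>2"
        using norm_triangle_ineq4[of 1 "cnj (c k) * z0"] cmod_cnj_mult_less_1[OF z0(1) cD[OF k]]
        by (intro power_mono) auto
      ultimately have "(1 - (cmod z0)\<^sup>2) * (1 - cmod (c k)) / 4 \<le> (1 - (cmod z0)\<^sup>2) * (1 - (cmod (c k))\<^sup>2) / (cmod (1 - cnj (c k) * z0))\<^sup>2"
        using one_minus_norm_sq_pos[OF z0(1)] one_minus_norm_sq_pos[OF cD[OF k]] disk_denom_nonzero[OF z0(1) cD[OF k]] cc
        by (intro frac_le mult_left_mono mult_nonneg_nonneg) auto
      then show "\<eta> * (1 - cmod (c k)) \<le> 1 - (pseudo_dist z0 (c k))\<^sup>2"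
        unfolding one_minus_pseudo_dist_sq[OF z0(1) cD[OF k]] by (simp add: \<eta>_def)
    qed
    also have "\<dots> \<le> M"
    proof -
      have "cmod (f z0) \<le> C * (\<Prod>k\<in>F. pseudo_dist z0 (c k))"
        by (rule bounded_by_prod_over_zeros[OF f z0 bd en F z0(1)])
      also have "(\<Prod>k\<in>F. pseudo_dist z0 (c k)) \<le> (\<Prod>k\<in>F. exp (- ((1 - (pseudo_dist z0 (c k))\<^sup>2) / 2)))"
      proof (intro prod_mono conjI)
        fix k
        define x where "x = pseudo_dist z0 (c k)"
        have "x\<^sup>2 \<le> exp (x\<^sup>2 - 1)" using exp_ge_add_one_self[of "x\<^sup>2 - 1"] by simp
        also have "x\<^sup>2 - 1 = 2 * (- ((1 - x\<^sup>2) / 2))" by (simp add: field_simps)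
        also have "exp \<dots> = (exp (- ((1 - x\<^sup>2) / 2)))\<^sup>2" by (rule exp_double)
        finally have "x \<le> exp (- ((1 - x\<^sup>2) / 2))" by (rule power2_le_imp_le) simp
        then show "pseudo_dist z0 (c k) \<le> exp (- ((1 - (pseudo_dist z0 (c k))\<^sup>2) / 2))" by (simp only: x_def)
      qed auto
      also have "\<dots> = exp (\<Sum>k\<in>F. - ((1 - (pseudo_dist z0 (c k))\<^sup>2) / 2))" using F(1) by (rule exp_sum[symmetric])
      also have "(\<Sum>k\<in>F. - ((1 - (pseudo_dist z0 (c k))\<^sup>2) / 2)) = - ((\<Sum>k\<in>F. 1 - (pseudo_dist z0 (c k))\<^sup>2) / 2)"
        by (simp only: sum_negf sum_divide_distrib[symmetric])
      finally have "cmod (f z0) \<le> C * exp (- ((\<Sum>k\<in>F. 1 - (pseudo_dist z0 (c k))\<^sup>2) / 2))" using C by simp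
      then have "exp ((\<Sum>k\<in>F. 1 - (pseudo_dist z0 (c k))\<^sup>2) / 2) \<le> C / cmod (f z0)"
        using z0(2) by (simp add: exp_minus field_simps)
      then have "(\<Sum>k\<in>F. 1 - (pseudo_dist z0 (c k))\<^sup>2) / 2 \<le> ln (C / cmod (f z0))"
        using C z0(2) by (subst ln_ge_iff) auto
      then show ?thesis by (simp add: M_def)
    qed
    finally show ?thesis using \<eta> by (simp add: pos_le_divide_eq mult.commute)
  qed
  show "summable (\<lambda>k. if k \<in> I then 1 - cmod (c k) else 0)"
  proof (rule summableI_nonneg_bounded)
    show "0 \<le> (if k \<in> I then 1 - cmod (c k) else 0)" for k using cI by (auto intro: less_imp_le)
    fix N
    have "(\<Sum>k<N. if k \<in> I then 1 - cmod (c k) else 0) = (\<Sum>k\<in>{..<N} \<inter> I. 1 - cmod (c k))"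
      by (simp add: sum.inter_restrict)
    also have "\<dots> \<le> M / \<eta>" by (rule bound) auto
    finally show "(\<Sum>k<N. if k \<in> I then 1 - cmod (c k) else 0) \<le> M / \<eta>" .
  qed
qed

lemma canonical_factorization:
  assumes f: "f holomorphic_on unit_disk" and z0: "z0 \<in> unit_disk" "f z0 \<noteq> 0"
    and en: "enumerates_zeros f I c" and B: "Blaschke_condition I c"
  obtains G where "G holomorphic_on unit_disk" "\<And>z. z \<in> unit_disk \<Longrightarrow> G z \<noteq> 0"
    "\<And>z. z \<in> unit_disk \<Longrightarrow> f z = G z * Blaschke_product I c z"
proof (rule holomorphic_zorder_factorization[OF f open_ball _ Blaschke_product_holomorphic[OF B]])
  fix z assume z: "z \<in> unit_disk"
  show zo: "zorder (Blaschke_product I c) z = zorder f z"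
    using zorder_Blaschke_product[OF B z] en z by (simp add: enumerates_zeros_def)
  have "f z = 0 \<longleftrightarrow> zorder f z > 0"
    using zorder_pos_iff'[OF analytic_at_disk[OF f z] eventually_frequently[OF _ eventually_nonzero_disk[OF f z0 z]]] by auto
  also have "\<dots> \<longleftrightarrow> {k\<in>I. c k = z} \<noteq> {}"
    using en z by (auto simp: enumerates_zeros_def card_gt_0_iff)
  also have "\<dots> \<longleftrightarrow> Blaschke_product I c z = 0"
    unfolding Blaschke_product_eq_0_iff[OF B z] by auto
  finally show "Blaschke_product I c z = 0 \<longleftrightarrow> f z = 0" by simp
qed (auto intro: that)

section \<open>Greedy colouring\<close>

function greedy_colour :: "(nat \<Rightarrow> nat \<Rightarrow> bool) \<Rightarrow> nat \<Rightarrow> nat" where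
  "greedy_colour E k = (LEAST i. i \<notin> greedy_colour E ` {l. l < k \<and> E k l})"
  by auto
termination by (relation "Wellfounded.measure snd") auto

declare greedy_colour.simps [simp del]

lemma greedy_colour_proper:
  assumes "l < k" "E k l" shows "greedy_colour E k \<noteq> greedy_colour E l"
proof -
  have "finite (greedy_colour E ` {l. l < k \<and> E k l})" by simp
  then have "\<exists>i. i \<notin> greedy_colour E ` {l. l < k \<and> E k l}" using ex_new_if_finite infinite_UNIV_nat by blast
  then have "greedy_colour E k \<notin> greedy_colour E ` {l. l < k \<and> E k l}"
    unfolding greedy_colour.simps[of E k] by (rule LeastI_ex)
  then show ?thesis using assms by auto
qed

lemma greedy_colour_less:
  assumes "card {l. l < k \<and> E k l} < n" shows "greedy_colour E k < n"
proof -
  have fin: "finite (greedy_colour E ` {l. l < k \<and> E k l})" by simp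
  have "card (greedy_colour E ` {l. l < k \<and> E k l}) < card {..<n}"
    using card_image_le[of "{l. l < k \<and> E k l}" "greedy_colour E"] assms by simp
  then have "\<not> {..<n} \<subseteq> greedy_colour E ` {l. l < k \<and> E k l}"
    using card_mono[OF fin, of "{..<n}"] by linarith
  then obtain i where i: "i < n" "i \<notin> greedy_colour E ` {l. l < k \<and> E k l}" by auto
  have "greedy_colour E k \<le> i" unfolding greedy_colour.simps[of E k] by (rule Least_le, rule i(2))
  then show ?thesis using i by simp
qed

section \<open>Factoring the perturbed function\<close>

lemma Blaschke_product_colour_classes:
  fixes col :: "nat \<Rightarrow> nat"
  assumes B: "Blaschke_condition I c" and col: "\<And>k. k \<in> I \<Longrightarrow> col k < n" and z: "z \<in> unit_disk"
  shows "Blaschke_product I c z = (\<Prod>j<n. Blaschke_product {k\<in>I. col k = j} c z)"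
proof -
  have "Blaschke_product {k\<in>I. col k < m} c z = (\<Prod>j<m. Blaschke_product {k\<in>I. col k = j} c z)" for m
  proof (induction m)
    case 0
    then show ?case by (simp add: Blaschke_product_def)
  next
    case (Suc m)
    have eq: "{k\<in>I. col k < Suc m} = {k\<in>I. col k < m} \<union> {k\<in>I. col k = m}" by (auto simp: less_Suc_eq)
    have "Blaschke_condition ({k\<in>I. col k < m} \<union> {k\<in>I. col k = m}) c"
      by (rule Blaschke_condition_mono[OF B]) auto
    from Blaschke_product_Un[OF this _ z]
    have "Blaschke_product ({k\<in>I. col k < m} \<union> {k\<in>I. col k = m}) c z
        = Blaschke_product {k\<in>I. col k < m} c z * Blaschke_product {k\<in>I. col k = m} c z" by blast
    then show ?case unfolding eq using Suc by simp
  qed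
  from this[of n] show ?thesis using col by (simp cong: conj_cong)
qed

text \<open>The properties of \<open>f = B - g\<close> on which the factorization depends. The scales \<open>exp (- m H)\<close> are used
with \<open>m = 2\<close> for counting zeros and for Harnack's inequality, with \<open>m = 4\<close> for colouring, and with
\<open>m = 5\<close>, which is finer than the distances inside a colour class, for separation. The lower bound on \<open>H\<close>
absorbs the powers of \<open>2\<close> that depend on \<open>n\<close>.\<close>

locale perturbation =
  fixes f :: "complex \<Rightarrow> complex" and n :: nat and H :: "complex \<Rightarrow> real"
  assumes f: "f holomorphic_on unit_disk"
    and f_le: "\<And>z. z \<in> unit_disk \<Longrightarrow> cmod (f z) \<le> 2"
    and H: "H \<in> Har_pos"
    and H_ge: "\<And>z. z \<in> unit_disk \<Longrightarrow> real (n + 4) * ln 2 \<le> H z"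
    and good: "\<And>z R. z \<in> unit_disk \<Longrightarrow> exp (- (5 * H z)) \<le> R \<Longrightarrow> R \<le> exp (- H z) \<Longrightarrow>
       \<exists>w\<in>unit_disk. pseudo_dist w z \<le> R \<and> R ^ n * exp (- H z) / 2 \<le> cmod (f w)"
begin

lemma exp_H_le: "z \<in> unit_disk \<Longrightarrow> exp (- H z) \<le> 1 / 2 ^ (n + 4)"
proof -
  assume "z \<in> unit_disk"
  then have "exp (- H z) \<le> exp (- (real (n + 4) * ln 2))" using H_ge by simp
  also have "\<dots> = 1 / 2 ^ (n + 4)" by (simp only: exp_minus exp_of_nat_mult exp_ln[of 2] inverse_eq_divide zero_less_numeral)
  finally show ?thesis .
qed

lemma exp_H_le': "z \<in> unit_disk \<Longrightarrow> exp (- H z) \<le> 1 / 16"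
proof -
  assume z: "z \<in> unit_disk"
  have "exp (- H z) \<le> 1 / 2 ^ (n + 4)" by (rule exp_H_le[OF z])
  also have "\<dots> \<le> 1 / 2 ^ 4" by (intro divide_left_mono power_increasing) auto
  finally show ?thesis by simp
qed

lemma H_pos: "z \<in> unit_disk \<Longrightarrow> 0 < H z"
  by (rule Har_pos_pos[OF H])

lemma good_scale:
  assumes z: "z \<in> unit_disk" and m: "1 \<le> m" "m \<le> 5"
  obtains w where "w \<in> unit_disk" "pseudo_dist w z \<le> exp (- (m * H z))" 
    "exp (- ((m * real n + 1) * H z)) / 2 \<le> cmod (f w)"
proof -
  have "exp (- (5 * H z)) \<le> exp (- (m * H z))" "exp (- (m * H z)) \<le> exp (- H z)"
    using m H_pos[OF z] by auto
  from good[OF z this] obtain w where w: "w \<in> unit_disk" "pseudo_dist w z \<le> exp (- (m * H z))"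
     "exp (- (m * H z)) ^ n * exp (- H z) / 2 \<le> cmod (f w)" by blast
  have "exp (- (m * H z)) ^ n * exp (- H z) = exp (real n * (- (m * H z)) + - H z)"
    by (simp only: exp_of_nat_mult exp_add)
  also have "real n * (- (m * H z)) + - H z = - ((m * real n + 1) * H z)" by (simp add: algebra_simps)
  finally have "exp (- ((m * real n + 1) * H z)) / 2 \<le> cmod (f w)" using w(3) by simp
  with w(1,2) show ?thesis by (rule that)
qed

lemma nonzero_somewhere: obtains z0 where "z0 \<in> unit_disk" "f z0 \<noteq> 0"
proof -
  obtain w where "w \<in> unit_disk" "exp (- ((1 * real n + 1) * H 0)) / 2 \<le> cmod (f w)"
    using good_scale[of 0 1] by auto
  moreover have "0 < exp (- ((1 * real n + 1) * H 0)) / 2" by simp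
  ultimately have "0 < cmod (f w)" by linarith
  then show ?thesis using that[OF \<open>w \<in> unit_disk\<close>] by simp
qed

text \<open>With \<open>n + 1\<close> zeros within \<open>R = exp (- 2 H)\<close> of \<open>z\<close>, Schwarz-Pick bounds \<open>|f|\<close> on the disk of radius \<open>R\<close> by a
multiple of \<open>R\<^bsup>n+1\<^esup>\<close>. This contradicts the lower bound \<open>R\<^sup>n exp (- H)/2\<close> at the good point, because
\<open>R\<close> is much smaller than \<open>exp (- H)\<close>.\<close>

lemma few_zeros_nearby:
  assumes en: "enumerates_zeros f I c" and z: "z \<in> unit_disk"
    and F: "finite F" "F \<subseteq> I" "\<And>k. k \<in> F \<Longrightarrow> pseudo_dist (c k) z \<le> exp (- (2 * H z))"
  shows "card F \<le> n"
proof (rule ccontr)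
  assume "\<not> card F \<le> n"
  then obtain F' where F': "F' \<subseteq> F" "card F' = Suc n" by (meson Suc_leI not_le obtain_subset_with_card_n)
  have fF': "finite F'" using F' F(1) finite_subset by blast
  obtain z0 where z0: "z0 \<in> unit_disk" "f z0 \<noteq> 0" by (rule nonzero_somewhere)
  obtain w where w: "w \<in> unit_disk" "pseudo_dist w z \<le> exp (- (2 * H z))"
    "exp (- ((2 * real n + 1) * H z)) / 2 \<le> cmod (f w)"
    using good_scale[OF z, of 2] by auto
  define E where "E = exp (- H z)"
  have E: "0 < E" "E \<le> 1 / 2 ^ (n + 4)" using exp_H_le[OF z] by (auto simp: E_def)
  have E2: "exp (- (2 * H z)) = E ^ 2" unfolding E_def using exp_double[of "- H z"] by simp
  have "E ^ (2 * n + 1) = exp (real (2 * n + 1) * (- H z))"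
    unfolding E_def by (rule exp_of_nat_mult[symmetric])
  also have "real (2 * n + 1) * (- H z) = - ((2 * real n + 1) * H z)" by (simp add: algebra_simps)
  finally have "E ^ (2 * n + 1) / 2 \<le> cmod (f w)" using w(3) by simp
  also have "\<dots> \<le> 2 * (\<Prod>k\<in>F'. pseudo_dist w (c k))"
    by (rule bounded_by_prod_over_zeros[OF f z0 f_le en fF' _ w(1)]) (use F F' in auto)
  also have "(\<Prod>k\<in>F'. pseudo_dist w (c k)) \<le> (\<Prod>k\<in>F'. 2 * E ^ 2)"
  proof (intro prod_mono conjI)
    fix k assume k: "k \<in> F'"
    have "k \<in> I" using k F(2) F'(1) by blast
    then have "c k \<in> unit_disk" using en unfolding enumerates_zeros_def by blast
    then show "pseudo_dist w (c k) \<le> 2 * E ^ 2"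
      using pseudo_dist_triangle[OF w(1) z, of "c k"] w(2) F(3)[of k] k F' E2 by (auto simp: pseudo_dist_commute[of z])
  qed auto
  also have "\<dots> = 2 ^ Suc n * E ^ (2 * n + 1) * E"
    using F'(2) by (simp add: power_mult_distrib flip: power_mult power_add)
  finally have "E ^ (2 * n + 1) * 1 \<le> E ^ (2 * n + 1) * (2 ^ (n + 3) * E)" by (simp add: power_add mult_ac)
  then have "1 \<le> 2 ^ (n + 3) * E" using E(1) by (simp only: mult_le_cancel_left_pos zero_less_power)
  also have "\<dots> \<le> 2 ^ (n + 3) * (1 / 2 ^ (n + 4))" using E(2) by (intro mult_left_mono) auto
  also have "\<dots> = 1 / 2" by (simp add: power_add)
  finally show False by simp
qed

text \<open>Symmetric in \<open>k\<close> and \<open>l\<close>, as the colouring requires; by Harnack's inequality neither disjunct allows more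
than the radius \<open>exp (- 2 H(c\<^sub>k))\<close> at which zeros are counted.\<close>

definition close :: "(nat \<Rightarrow> complex) \<Rightarrow> nat \<Rightarrow> nat \<Rightarrow> bool" where
  "close c k l \<longleftrightarrow> pseudo_dist (c k) (c l) \<le> exp (- (4 * H (c k))) \<or> pseudo_dist (c k) (c l) \<le> exp (- (4 * H (c l)))"

lemma closeD:
  assumes "close c k l" and D: "c k \<in> unit_disk" "c l \<in> unit_disk"
  shows "pseudo_dist (c l) (c k) \<le> exp (- (2 * H (c k)))"
  using assms(1) unfolding close_def
proof
  assume "pseudo_dist (c k) (c l) \<le> exp (- (4 * H (c k)))"
  also have "\<dots> \<le> exp (- (2 * H (c k)))" using H_pos[OF D(1)] by simp
  finally show ?thesis by (simp add: pseudo_dist_commute)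
next
  assume le: "pseudo_dist (c k) (c l) \<le> exp (- (4 * H (c l)))"
  also have "\<dots> \<le> exp (- H (c l))" using H_pos[OF D(2)] by simp
  also have "\<dots> \<le> 1 / 3" using exp_H_le'[OF D(2)] by simp
  finally have "H (c k) \<le> 2 * H (c l)" by (rule Harnack[OF H D(2,1)])
  then have "exp (- (4 * H (c l))) \<le> exp (- (2 * H (c k)))" by simp
  from order_trans[OF le this] show ?thesis by (subst pseudo_dist_commute)
qed

lemma colour_zeros:
  assumes en: "enumerates_zeros f I c"
  obtains col :: "nat \<Rightarrow> nat" where "\<And>k. k \<in> I \<Longrightarrow> col k < n"
    "\<And>k l. k \<in> I \<Longrightarrow> l \<in> I \<Longrightarrow> k \<noteq> l \<Longrightarrow> col k = col l \<Longrightarrow> exp (- (4 * H (c k))) < pseudo_dist (c k) (c l)"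
proof -
  have cD: "c k \<in> unit_disk" if "k \<in> I" for k using en that by (auto simp: enumerates_zeros_def)
  define E where "E k l \<longleftrightarrow> l \<in> I \<and> close c k l" for k l
  show ?thesis
  proof (rule that[of "greedy_colour E"])
    fix k assume k: "k \<in> I"
    let ?N = "{l. l < k \<and> E k l}"
    have "card (insert k ?N) \<le> n"
    proof (rule few_zeros_nearby[OF en cD[OF k]])
      show "insert k ?N \<subseteq> I" using k by (auto simp: E_def)
      fix l assume "l \<in> insert k ?N"
      then show "pseudo_dist (c l) (c k) \<le> exp (- (2 * H (c k)))"
        using closeD[of c k l] cD k by (auto simp: E_def)
    qed simp
    then have "card ?N < n" by (simp add: card_insert_if)
    then show "greedy_colour E k < n" by (rule greedy_colour_less)
  next
    fix k l assume kl: "k \<in> I" "l \<in> I" "k \<noteq> l" "greedy_colour E k = greedy_colour E l"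
    have "\<not> close c k l"
    proof
      assume "close c k l"
      moreover from this have "close c l k" by (auto simp: close_def pseudo_dist_commute)
      ultimately have "E k l" "E l k" using kl by (auto simp: E_def)
      then show False using greedy_colour_proper[of l k E] greedy_colour_proper[of k l E] kl by (metis linorder_neqE_nat)
    qed
    then show "exp (- (4 * H (c k))) < pseudo_dist (c k) (c l)" by (simp add: close_def)
  qed
qed

text \<open>At a good point \<open>w\<close> within \<open>exp (- 5 H(\<alpha>))\<close> of the zero \<open>\<alpha>\<close> the product of the distances to the other zeros
is bounded below, because \<open>|f(w)|\<close> is. Zeros in the same class are farther than this from \<open>\<alpha>\<close>, so
that their distances from \<open>w\<close> are at most twice those from \<open>\<alpha>\<close>.\<close>

lemma colour_class_separated:
  assumes en: "enumerates_zeros f I c" and B: "Blaschke_condition I c" and J: "J \<subseteq> I"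
    and sep: "\<And>k l. k \<in> J \<Longrightarrow> l \<in> J \<Longrightarrow> k \<noteq> l \<Longrightarrow> exp (- (4 * H (c k))) < pseudo_dist (c k) (c l)"
  obtains K where "K \<in> Har_pos" "Nevanlinna_separated J c K"
proof (rule that)
  let ?K = "\<lambda>z. (2 * (5 * real n + 1) * H z + 2 * ln 4) + 8 * (1 + Re (Poisson_sum I c z))"
  show "?K \<in> Har_pos"
    by (intro Har_pos_add Har_pos_scale H Har_pos_const Poisson_Har_pos B) auto
  show "Nevanlinna_separated J c ?K"
    unfolding Nevanlinna_separated_def
  proof (intro ballI allI impI)
    fix k F assume k: "k \<in> J" and F: "finite F" "F \<subseteq> J - {k}"
    have cD: "c l \<in> unit_disk" if "l \<in> I" for l using en that by (auto simp: enumerates_zeros_def)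
    define \<alpha> where "\<alpha> = c k"
    have \<alpha>: "\<alpha> \<in> unit_disk" using cD k J by (auto simp: \<alpha>_def)
    have FI: "F \<subseteq> I" using F J by auto
    obtain z0 where z0: "z0 \<in> unit_disk" "f z0 \<noteq> 0" by (rule nonzero_somewhere)
    obtain w where w: "w \<in> unit_disk" "pseudo_dist w \<alpha> \<le> exp (- (5 * H \<alpha>))"
      "exp (- ((5 * real n + 1) * H \<alpha>)) / 2 \<le> cmod (f w)"
      using good_scale[OF \<alpha>, of 5] by auto
    have "cmod (f w) \<le> 2 * (\<Prod>l\<in>F. pseudo_dist w (c l))"
      by (rule bounded_by_prod_over_zeros[OF f z0 f_le en F(1) FI w(1)])
    then have "exp (- ((5 * real n + 1) * H \<alpha>)) / 4 \<le> (\<Prod>l\<in>F. pseudo_dist w (c l))" using w(3) by simp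
    then have sq: "(exp (- ((5 * real n + 1) * H \<alpha>)) / 4)\<^sup>2 \<le> (\<Prod>l\<in>F. pseudo_dist w (c l))\<^sup>2"
      by (intro power_mono) auto
    have "exp (- ?K \<alpha>) \<le> exp (2 * (- ((5 * real n + 1) * H \<alpha>) - ln 4) + - (8 * Re (Poisson_sum I c \<alpha>)))"
      by (simp add: algebra_simps)
    also have "\<dots> = (exp (- ((5 * real n + 1) * H \<alpha>)) / 4)\<^sup>2 * exp (- (8 * Re (Poisson_sum I c \<alpha>)))"
      unfolding exp_add exp_double exp_diff by simp
    also have "\<dots> \<le> (\<Prod>l\<in>F. pseudo_dist w (c l))\<^sup>2 * exp (- (8 * Re (Poisson_sum I c \<alpha>)))"
      using sq by (intro mult_right_mono) auto
    also have "\<dots> \<le> (\<Prod>l\<in>F. pseudo_dist \<alpha> (c l))"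
    proof (rule prod_pseudo_dist_compare[OF B w(1) \<alpha> F(1) FI])
      fix l assume l: "l \<in> F"
      then have "c l \<in> unit_disk" using cD FI by auto
      then have "pseudo_dist w (c l) \<le> pseudo_dist w \<alpha> + pseudo_dist \<alpha> (c l)" by (rule pseudo_dist_triangle[OF w(1) \<alpha>])
      moreover have "exp (- (4 * H \<alpha>)) < pseudo_dist \<alpha> (c l)"
        unfolding \<alpha>_def using sep[of k l] k l F by auto
      moreover have "exp (- (5 * H \<alpha>)) \<le> exp (- (4 * H \<alpha>))" using H_pos[OF \<alpha>] by simp
      ultimately show "pseudo_dist w (c l) \<le> 2 * pseudo_dist \<alpha> (c l)" using w(2) by linarith
    qed
    finally show "exp (- ?K (c k)) \<le> (\<Prod>l\<in>F. pseudo_dist (c k) (c l))" by (simp only: \<alpha>_def)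
  qed
qed

lemma colour_class_interpolating:
  assumes en: "enumerates_zeros f I c" and B: "Blaschke_condition I c" and J: "J \<subseteq> I"
    and sep: "\<And>k l. k \<in> J \<Longrightarrow> l \<in> J \<Longrightarrow> k \<noteq> l \<Longrightarrow> exp (- (4 * H (c k))) < pseudo_dist (c k) (c l)"
  shows "Nevanlinna_interpolating J c"
proof -
  obtain K where "K \<in> Har_pos" "Nevanlinna_separated J c K"
    using colour_class_separated[OF assms] by blast
  moreover have "inj_on c J"
  proof (rule inj_onI, rule ccontr)
    fix k l assume "k \<in> J" "l \<in> J" "c k = c l" "k \<noteq> l"
    then show False using sep[of k l] exp_gt_zero[of "- (4 * H (c l))"] by simp
  qed
  ultimately show ?thesis
    using separated_imp_interpolating[OF Blaschke_condition_mono[OF B J]] by blast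
qed

theorem factorization:
  obtains B1 G where "finite_product_NIB B1" "G holomorphic_on unit_disk"
    "\<And>z. z \<in> unit_disk \<Longrightarrow> G z \<noteq> 0" "\<And>z. z \<in> unit_disk \<Longrightarrow> f z = B1 z * G z"
    "\<And>z. z \<in> unit_disk \<Longrightarrow> cmod (G z) \<le> 2" "\<And>z. z \<in> unit_disk \<Longrightarrow> cmod (B1 z) \<le> 1"
proof -
  obtain z0 where z0: "z0 \<in> unit_disk" "f z0 \<noteq> 0" by (rule nonzero_somewhere)
  obtain I c where en: "enumerates_zeros f I c" by (rule exists_enumeration_of_zeros[OF f z0])
  have B: "Blaschke_condition I c" by (rule zeros_Blaschke_condition[OF f z0 f_le en])
  obtain G where G: "G holomorphic_on unit_disk" "\<And>z. z \<in> unit_disk \<Longrightarrow> G z \<noteq> 0"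
    "\<And>z. z \<in> unit_disk \<Longrightarrow> f z = G z * Blaschke_product I c z"
    using canonical_factorization[OF f z0 en B] by blast
  obtain col :: "nat \<Rightarrow> nat" where col: "\<And>k. k \<in> I \<Longrightarrow> col k < n"
    "\<And>k l. k \<in> I \<Longrightarrow> l \<in> I \<Longrightarrow> k \<noteq> l \<Longrightarrow> col k = col l \<Longrightarrow> exp (- (4 * H (c k))) < pseudo_dist (c k) (c l)"
    using colour_zeros[OF en] by blast
  have "Nevanlinna_interpolating_Blaschke (Blaschke_product {k\<in>I. col k = j} c)" for j
    unfolding Nevanlinna_interpolating_Blaschke_def
    by (intro exI[of _ "{k\<in>I. col k = j}"] exI[of _ c] conjI Blaschke_condition_mono[OF B]
          colour_class_interpolating[OF en B]) (auto intro: col(2))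
  then have "finite_product_NIB (Blaschke_product I c)"
    unfolding finite_product_NIB_def
    using Blaschke_product_colour_classes[OF B col(1)]
    by (intro exI[of _ n] exI[of _ "\<lambda>j. Blaschke_product {k\<in>I. col k = j} c"]) auto
  moreover have "cmod (G z) \<le> 2" if "z \<in> unit_disk" for z
    by (rule bounded_by_quotient_Blaschke_product[OF B G(1) _ that]) (use f_le G(3) in \<open>auto simp: norm_mult\<close>)
  ultimately show ?thesis
    using that[of "Blaschke_product I c" G] G cmod_Blaschke_product_le_1[OF B] by (auto simp: mult.commute)
qed

text \<open>Since \<open>|G| \<le> 2\<close>, the function \<open>ln (4/|G|)\<close> is positive and harmonic. At a nearby good point it is
controlled by the lower bound for \<open>|f| \<le> |G|\<close>; Harnack's inequality carries this to \<open>z\<close>.\<close>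

lemma factor_lower_bound:
  assumes G: "G holomorphic_on unit_disk" "\<And>z. z \<in> unit_disk \<Longrightarrow> G z \<noteq> 0"
    "\<And>z. z \<in> unit_disk \<Longrightarrow> cmod (G z) \<le> 2" "\<And>z. z \<in> unit_disk \<Longrightarrow> cmod (f z) \<le> cmod (G z)"
    and z: "z \<in> unit_disk"
  shows "exp (- ((4 * real n + 2) * H z)) / 16 \<le> cmod (G z)"
proof -
  have "(\<lambda>z. 4 / G z) holomorphic_on unit_disk" by (intro holomorphic_intros G(1,2))
  then obtain h where h: "h holomorphic_on unit_disk" "\<And>z. z \<in> unit_disk \<Longrightarrow> exp (h z) = 4 / G z"
    by (rule holomorphic_logarithm_exists[OF convex_ball open_ball, of "\<lambda>z. 4 / G z" 0 1 0]) (use G(2) in auto)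
  have hG: "exp (- Re (h z)) = cmod (G z) / 4" if "z \<in> unit_disk" for z
  proof -
    have "exp (Re (h z)) = 4 / cmod (G z)"
      using h(2)[OF that] by (metis norm_exp_eq_Re norm_divide norm_numeral)
    then show ?thesis by (simp add: exp_minus)
  qed
  have V: "(\<lambda>z. Re (h z)) \<in> Har_pos"
  proof (rule Har_posI[OF h(1)])
    fix z assume z: "z \<in> unit_disk"
    have "exp (- Re (h z)) < 1" using hG[OF z] G(3)[OF z] by linarith
    then show "0 < Re (h z)" by simp
  qed simp
  obtain w where w: "w \<in> unit_disk" "pseudo_dist w z \<le> exp (- (2 * H z))"
    "exp (- ((2 * real n + 1) * H z)) / 2 \<le> cmod (f w)"
    using good_scale[OF z, of 2] by auto
  have "pseudo_dist z w \<le> exp (- (2 * H z))" using w(2) by (simp add: pseudo_dist_commute)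
  also have "\<dots> \<le> exp (- H z)" using H_pos[OF z] by simp
  also have "\<dots> \<le> 1 / 3" using exp_H_le'[OF z] by simp
  finally have "Re (h z) \<le> 2 * Re (h w)" by (rule Harnack[OF V w(1) z])
  have "exp (- ((2 * real n + 1) * H z)) / 8 \<le> exp (- Re (h w))"
    using w(3) G(4)[OF w(1)] hG[OF w(1)] by simp
  then have "(exp (- ((2 * real n + 1) * H z)) / 8)\<^sup>2 \<le> (exp (- Re (h w)))\<^sup>2" by (intro power_mono) auto
  also have "\<dots> = exp (2 * (- Re (h w)))" by (rule exp_double[symmetric])
  also have "\<dots> \<le> exp (- Re (h z))" using \<open>Re (h z) \<le> 2 * Re (h w)\<close> by simp
  also have "\<dots> = cmod (G z) / 4" by (rule hG[OF z])
  finally have "(exp (- ((2 * real n + 1) * H z)))\<^sup>2 / 64 \<le> cmod (G z) / 4" by (simp add: power_divide)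
  moreover have "(exp (- ((2 * real n + 1) * H z)))\<^sup>2 = exp (- ((4 * real n + 2) * H z))"
    unfolding exp_double[symmetric] by (simp add: algebra_simps)
  ultimately show ?thesis by simp
qed

end

section \<open>The factorization theorem\<close>

theorem mainTheorem4:
  fixes B :: "complex \<Rightarrow> complex"
  assumes "finite_product_NIB B"
  shows "\<exists>H\<^sub>0\<in>Har_pos. \<forall>g\<in>H_infinity.
           (\<forall>z\<in>unit_disk. cmod (g z) \<le> exp (- H\<^sub>0 z)) \<longrightarrow>
           (\<exists>B\<^sub>1 G. finite_product_NIB B\<^sub>1 \<and>
              G \<in> H_infinity \<and> (\<forall>z\<in>unit_disk. G z \<noteq> 0) \<and> (\<lambda>z. 1 / G z) \<in> H_infinity \<and>
              (\<forall>z\<in>unit_disk. B z - g z = B\<^sub>1 z * G z))"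
proof -
  obtain n :: nat and H where H: "H \<in> Har_pos" "\<And>z. z \<in> unit_disk \<Longrightarrow> real (n + 4) * ln 2 \<le> H z"
    and good: "\<And>z R. z \<in> unit_disk \<Longrightarrow> 0 < R \<Longrightarrow> R \<le> exp (- H z) \<Longrightarrow>
       \<exists>w\<in>unit_disk. pseudo_dist w z \<le> R \<and> R ^ n * exp (- H z) \<le> cmod (B w)"
  proof (rule finite_product_NIB_good_points[OF assms])
    show "0 < ln (2::real)" by simp
  qed blast
  note Bh = finite_product_NIB_holomorphic_bounded[OF assms]
  \<comment> \<open>\<open>10 n + 2 = 2 (5 n + 1)\<close>: the exponent at the finest scale, doubled by Harnack's inequality; \<open>ln 2\<close> makes \<open>|g| \<le> 1/2\<close>.\<close>
  define H0 where "H0 z = (10 * real n + 2) * H z + ln 2" for z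
  have H0: "H0 \<in> Har_pos"
    unfolding H0_def[abs_def] by (intro Har_pos_add Har_pos_scale Har_pos_const H(1)) auto
  have eH0: "exp (- H0 z) = exp (- ((10 * real n + 2) * H z)) / 2" for z
  proof -
    have "- H0 z = - ((10 * real n + 2) * H z) - ln 2" by (simp add: H0_def)
    then have "exp (- H0 z) = exp (- ((10 * real n + 2) * H z)) / exp (ln 2)" by (simp only: exp_diff)
    then show ?thesis by simp
  qed
  show ?thesis
  proof (intro bexI[OF _ H0] ballI impI)
    fix g assume "g \<in> H_infinity" and g_le: "\<forall>z\<in>unit_disk. cmod (g z) \<le> exp (- H0 z)"
    then have g: "g holomorphic_on unit_disk" by (simp add: H_infinity_def)
    define f where "f z = B z - g z" for z
    have g_half: "cmod (g z) \<le> 1 / 2" if "z \<in> unit_disk" for z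
    proof -
      have "0 \<le> (10 * real n + 2) * H z" using Har_pos_pos[OF H(1) that] by simp
      then have "exp (- H0 z) \<le> 1 / 2" unfolding eH0 by simp
      then show ?thesis using g_le that by force
    qed
    interpret perturbation f n H
    proof
      show "f holomorphic_on unit_disk" unfolding f_def[abs_def] by (intro holomorphic_intros Bh g)
      show "cmod (f z) \<le> 2" if "z \<in> unit_disk" for z
        unfolding f_def using norm_triangle_ineq4[of "B z" "g z"] Bh(2)[OF that] g_half[OF that] by linarith
      fix z R assume z: "z \<in> unit_disk" and R: "exp (- (5 * H z)) \<le> R" "R \<le> exp (- H z)"
      have R0: "0 < R" using R(1) exp_gt_zero[of "- (5 * H z)"] by linarith
      obtain w where w: "w \<in> unit_disk" "pseudo_dist w z \<le> R" "R ^ n * exp (- H z) \<le> cmod (B w)"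
        using good[OF z R0 R(2)] by blast
      have "4 * ln 2 \<le> real (n + 4) * ln 2" by (intro mult_right_mono) auto
      from order_trans[OF this H(2)[OF z]] have "exp (- H z) \<le> exp (- (4 * ln 2))" by simp
      also have "\<dots> = 1 / 16" using exp_of_nat_mult[of 4 "ln (2::real)"] by (simp add: exp_minus)
      finally have "pseudo_dist z w \<le> 1 / 3" using w(2) R(2) by (simp add: pseudo_dist_commute)
      then have "H z \<le> 2 * H w" by (rule Harnack[OF H(1) w(1) z])
      then have "(5 * real n + 1) * H z \<le> (5 * real n + 1) * (2 * H w)" by (intro mult_left_mono) auto
      then have "exp (- ((10 * real n + 2) * H w)) \<le> exp (real n * (- (5 * H z)) + - H z)"
        by (simp add: algebra_simps)
      also have "\<dots> = exp (- (5 * H z)) ^ n * exp (- H z)" by (simp only: exp_of_nat_mult exp_add)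
      also have "\<dots> \<le> R ^ n * exp (- H z)" using R(1) by (intro mult_right_mono power_mono) auto
      finally have "cmod (g w) \<le> R ^ n * exp (- H z) / 2"
        using g_le w(1) unfolding eH0 by force
      then have "R ^ n * exp (- H z) / 2 \<le> cmod (f w)"
        unfolding f_def using norm_triangle_ineq2[of "B w" "g w"] w(3) by linarith
      then show "\<exists>w\<in>unit_disk. pseudo_dist w z \<le> R \<and> R ^ n * exp (- H z) / 2 \<le> cmod (f w)" using w by blast
    qed (use H in auto)
    obtain B1 G where F: "finite_product_NIB B1" "G holomorphic_on unit_disk"
      "\<And>z. z \<in> unit_disk \<Longrightarrow> G z \<noteq> 0" "\<And>z. z \<in> unit_disk \<Longrightarrow> f z = B1 z * G z"
      "\<And>z. z \<in> unit_disk \<Longrightarrow> cmod (G z) \<le> 2" "\<And>z. z \<in> unit_disk \<Longrightarrow> cmod (B1 z) \<le> 1"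
      by (rule factorization) blast
    have fG: "cmod (f z) \<le> cmod (G z)" if "z \<in> unit_disk" for z
      using F(4,6)[OF that] mult_right_mono[of "cmod (B1 z)" 1 "cmod (G z)"] by (simp add: norm_mult)
    have "cmod (1 / G z) * cmod (B z) \<le> 16" if z: "z \<in> unit_disk" for z
    proof -
      have "cmod (B z) \<le> 16 * cmod (G z)"
      proof (cases "2 * cmod (g z) \<le> cmod (B z)")
        case True
        then have "cmod (B z) \<le> 2 * cmod (f z)"
          unfolding f_def using norm_triangle_ineq2[of "B z" "g z"] by linarith
        then show ?thesis using fG[OF z] norm_ge_zero[of "G z"] by linarith
      next
        case False
        then have "cmod (B z) \<le> exp (- ((10 * real n + 2) * H z))"
          using g_le z unfolding eH0 by force
        also have "\<dots> \<le> exp (- ((4 * real n + 2) * H z))"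
          using H_pos[OF z] by (simp add: mult_right_mono)
        also have "\<dots> \<le> 16 * cmod (G z)"
          using factor_lower_bound[OF F(2,3,5) fG z] by simp
        finally show ?thesis .
      qed
      then show ?thesis using F(3)[OF z] by (simp add: norm_divide divide_le_eq)
    qed
    moreover have Gi: "(\<lambda>z. 1 / G z) holomorphic_on unit_disk" by (intro holomorphic_intros F(2,3))
    ultimately have inv: "cmod (1 / G z) \<le> 16" if "z \<in> unit_disk" for z
      using bounded_by_quotient_finite_product_NIB[OF assms, of "\<lambda>z. 1 / G z" 16 z] that by blast
    show "\<exists>B1 G. finite_product_NIB B1 \<and>
              G \<in> H_infinity \<and> (\<forall>z\<in>unit_disk. G z \<noteq> 0) \<and> (\<lambda>z. 1 / G z) \<in> H_infinity \<and>
              (\<forall>z\<in>unit_disk. B z - g z = B1 z * G z)"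
    proof (rule exI[of _ B1], rule exI[of _ G], intro conjI ballI)
      show "G \<in> H_infinity"
        unfolding H_infinity_def using F(2,5) by (auto intro!: boundedI[of _ 2])
      show "(\<lambda>z. 1 / G z) \<in> H_infinity"
        unfolding H_infinity_def using Gi inv by (auto intro!: boundedI[of _ 16])
      show "B z - g z = B1 z * G z" if "z \<in> unit_disk" for z using F(4)[OF that] by (simp add: f_def)
    qed (use F(1,3) in auto)
  qed
qed

end
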